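(* Consider a supercritical branching random walk with $m(1)=1$, $\operatorname{Var}W_1(1)<\infty$ and $m(2)<1$. Let $L_n:\Omega\to\mathbb M(\mathbb R^\infty)$ be the conditional law of the process $$\left(\frac{W_\infty(1)-W_{n+r}(1)}{(m(2))^{(n+r)/2}}\right)_{r\in\mathbb N_0}$$ given the $\sigma$-field $\mathcal F_n$, viewed as a random variable on $(\Omega,\mathcal F,\mathbb P)$ with values in $\mathbb M(\mathbb R^\infty)$. Then, as $n\to\infty$, $L_n$ converges almost surely weakly to the Markov kernel $$L_\infty:\Omega\to\mathbb M(\mathbb R^\infty),\qquad \omega\mapsto\mathcal L\left\{\left(\sqrt{v^2W_\infty(2;\omega)}\,U_r\right)_{r\in\mathbb N_0}\right\},$$ where $v^2:=\operatorname{Var}W_\infty(1)=\operatorname{Var}W_1(1)\,(1-m(2))^{-1}$, $\mathcal L\{\cdot\}$ denotes the probability law of a process, and $(U_r)_{r\in\mathbb N_0}$ is a stationary zero-mean Gaussian sequence with $\operatorname{Cov}(U_r,U_s)=(m(2))^{|r-s|/2}$, $r,s\in\mathbb N_0$, defined on some probability space other than $(\Omega,\mathcal F,\mathbb P)$ (so that in $\mathcal L\{\cdot\}$ the number $W_\infty(2;\omega)$ is treated as a constant).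
   Context: Branching random walk (BRW): Let $\mathcal Z=\sum_{i=1}^{J}\delta_{X_i}$ be a point process on $\mathbb R$, where $J=\mathcal Z(\mathbb R)\in\{0,1,2,\dots\}\cup\{\infty\}$ is random and may be infinite with positive probability; no assumption is made on the dependence structure of $J,X_1,X_2,\dots$. Let $\mathbb V=\bigcup_{n\ge0}\mathbb N^n$ and let $\mathcal Z(u)=\sum_{i=1}^{J(u)}\delta_{X_i(u)}$, $u\in\mathbb V$, be i.i.d. copies of $\mathcal Z$ on a probability space $(\Omega,\mathcal F,\mathbb P)$. The ancestor $\varnothing$ is at $S(\varnothing)=0$. An individual $u$ of generation $n$ at position $S(u)$ has children $ui$, $1\le i\le J(u)$ (all $i\in\mathbb N$ if $J(u)=\infty$), at positions $S(ui)=S(u)+X_i(u)$, forming part of generation $n+1$. $\sum_{|u|=n}$ denotes the sum over all individuals actually present in generation $n$. The BRW is supercritical: $\mathbb E J>1$. For $\theta\in\mathbb R$ let $m(\theta)=\mathbb E\big[\sum_{i=1}^J e^{-\theta X_i}\big]\in[0,\infty]$. For $\gamma$ with $m(\gamma)<\infty$, the Biggins martingale is $W_n(\gamma)=(m(\gamma))^{-n}\sum_{|u|=n}e^{-\gamma S(u)}$, $n\in\mathbb N_0$; it is a nonnegative martingale with respect to $\mathcal F_n=\sigma\{\mathcal Z(u):u\in\mathbb N^k,\ k<n\}$ (the information on the first $n$ generations), and $W_\infty(\gamma)$ denotes its almost sure limit; $W_\infty(\gamma;\omega)$ is its value at $\omega\in\Omega$. $\mathbb R^\infty$ is the space of real sequences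 $(x_0,x_1,\dots)$ with the complete separable metric $\rho(x,y)=\sum_{j\ge0}2^{-j}\frac{|x_j-y_j|}{1+|x_j-y_j|}$, which metrizes pointwise convergence. For a Polish space $E$, $\mathbb M(E)$ is the space of probability measures on $E$ with the topology of weak convergence. A Markov kernel is a random variable $L:\Omega\to\mathbb M(E)$. The conditional law of an $E$-valued random variable $\xi$ given a $\sigma$-field $\mathcal G\subset\mathcal F$ is the (a.s. unique) $\mathcal G$-measurable $L:\Omega\to\mathbb M(E)$ with $\mathbb E[f(\xi)\mathbf 1_A]=\int_A\big(\int_E f(x)L(\omega;dx)\big)\mathbb P(d\omega)$ for all $A\in\mathcal G$ and bounded Borel $f:E\to\mathbb R$. Markov kernels $L_n$ converge to $L_\infty$ almost surely weakly if the set of $\omega\in\Omega$ for which $L_n(\omega)\to L_\infty(\omega)$ weakly on $E$ has probability $1$. *)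

theory Defs
  imports "HOL-Probability.Probability"
begin

section \<open>Branching random walk\<close>

text \<open>
  Individuals are words over the natural numbers; the children of \<open>u\<close> are the words \<open>u @ [i]\<close>
  with \<open>i < J u\<close> (indices start at \<open>0\<close>, and all \<open>i\<close> are allowed if \<open>J u = \<infinity>\<close>), displaced from
  \<open>u\<close> by \<open>X u i\<close>.  The point process attached to \<open>u\<close> is carried together with the enumeration
  of its points, because the tree and the positions depend on it: it is the pair of \<open>J u\<close> and the
  sequence of displacements.  The values \<open>X u i\<close> with \<open>i \<ge> J u\<close> have no meaning; they are
  replaced by \<open>0\<close>, so that no assumption is imposed on them.
\<close>

definition repro :: "(nat list \<Rightarrow> 'w \<Rightarrow> enat) \<Rightarrow> (nat list \<Rightarrow> nat \<Rightarrow> 'w \<Rightarrow> real)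
    \<Rightarrow> nat list \<Rightarrow> 'w \<Rightarrow> enat \<times> (nat \<Rightarrow> real)"
  where "repro J X u \<omega> = (J u \<omega>, \<lambda>i. if enat i < J u \<omega> then X u i \<omega> else 0)"

definition repro_space :: "(enat \<times> (nat \<Rightarrow> real)) measure"
  where "repro_space = count_space UNIV \<Otimes>\<^sub>M borel"

locale branching_random_walk = prob_space M
  for M :: "'w measure"
    and J :: "nat list \<Rightarrow> 'w \<Rightarrow> enat"
    and X :: "nat list \<Rightarrow> nat \<Rightarrow> 'w \<Rightarrow> real" +
  assumes indep_repro: "indep_vars (\<lambda>_. repro_space) (repro J X) UNIV"
    and ident_repro: "\<And>u. distr M repro_space (repro J X u) = distr M repro_space (repro J X [])"

definition supercritical :: "'w measure \<Rightarrow> (nat list \<Rightarrow> 'w \<Rightarrow> enat) \<Rightarrow> bool"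
  where "supercritical M J \<longleftrightarrow> (\<integral>\<^sup>+ \<omega>. ennreal_of_enat (J [] \<omega>) \<partial>M) > 1"

definition alive :: "(nat list \<Rightarrow> 'w \<Rightarrow> enat) \<Rightarrow> nat list \<Rightarrow> 'w \<Rightarrow> bool"
  where "alive J u \<omega> \<longleftrightarrow> (\<forall>k < length u. enat (u ! k) < J (take k u) \<omega>)"

definition position :: "(nat list \<Rightarrow> nat \<Rightarrow> 'w \<Rightarrow> real) \<Rightarrow> nat list \<Rightarrow> 'w \<Rightarrow> real"
  where "position X u \<omega> = (\<Sum>k < length u. X (take k u) (u ! k) \<omega>)"

lemma alive_Nil [simp]: "alive J [] \<omega>"
  by (simp add: alive_def)

lemma alive_snoc: "alive J (u @ [i]) \<omega> \<longleftrightarrow> alive J u \<omega> \<and> enat i < J u \<omega>"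
  by (auto simp: alive_def nth_append less_Suc_eq)

lemma position_Nil [simp]: "position X [] \<omega> = 0"
  by (simp add: position_def)

lemma position_snoc: "position X (u @ [i]) \<omega> = position X u \<omega> + X u i \<omega>"
  by (simp add: position_def nth_append)

definition generation :: "(nat list \<Rightarrow> 'w \<Rightarrow> enat) \<Rightarrow> nat \<Rightarrow> 'w \<Rightarrow> nat list set"
  where "generation J n \<omega> = {u. length u = n \<and> alive J u \<omega>}"

definition laplace :: "'w measure \<Rightarrow> (nat list \<Rightarrow> 'w \<Rightarrow> enat) \<Rightarrow> (nat list \<Rightarrow> nat \<Rightarrow> 'w \<Rightarrow> real)
    \<Rightarrow> real \<Rightarrow> ennreal"
  where "laplace M J X \<theta> =
    (\<integral>\<^sup>+ \<omega>. (\<integral>\<^sup>+ i. ennreal (exp (- \<theta> * X [] i \<omega>)) \<partial>count_space {i. enat i < J [] \<omega>}) \<partial>M)"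

text \<open>
  For \<open>laplace M J X \<gamma> < \<infinity>\<close>, the sum over the \<open>n\<close>-th generation is almost surely finite, and
  \<^const>\<open>enn2real\<close> matters only on a null set.
\<close>

definition biggins :: "'w measure \<Rightarrow> (nat list \<Rightarrow> 'w \<Rightarrow> enat) \<Rightarrow> (nat list \<Rightarrow> nat \<Rightarrow> 'w \<Rightarrow> real)
    \<Rightarrow> real \<Rightarrow> nat \<Rightarrow> 'w \<Rightarrow> real"
  where "biggins M J X \<gamma> n \<omega> =
    enn2real (\<integral>\<^sup>+ u. ennreal (exp (- \<gamma> * position X u \<omega>)) \<partial>count_space (generation J n \<omega>))
      / enn2real (laplace M J X \<gamma>) ^ n"

definition biggins_limit :: "'w measure \<Rightarrow> (nat list \<Rightarrow> 'w \<Rightarrow> enat)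
    \<Rightarrow> (nat list \<Rightarrow> nat \<Rightarrow> 'w \<Rightarrow> real) \<Rightarrow> real \<Rightarrow> 'w \<Rightarrow> real"
  where "biggins_limit M J X \<gamma> \<omega> = lim (\<lambda>n. biggins M J X \<gamma> n \<omega>)"

definition brw_filtration :: "'w measure \<Rightarrow> (nat list \<Rightarrow> 'w \<Rightarrow> enat)
    \<Rightarrow> (nat list \<Rightarrow> nat \<Rightarrow> 'w \<Rightarrow> real) \<Rightarrow> nat \<Rightarrow> 'w measure"
  where "brw_filtration M J X n = sigma (space M)
    {repro J X u -` A \<inter> space M | u A. length u < n \<and> A \<in> sets repro_space}"


section \<open>Conditional laws and weak convergence\<close>

text \<open>
  For a Polish space, \<^term>\<open>prob_algebra borel\<close> is the Borel \<open>\<sigma>\<close>-algebra of the topology of weak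
  convergence on the set of Borel probability measures.
\<close>

definition is_conditional_law :: "'w measure \<Rightarrow> 'w measure \<Rightarrow> ('w \<Rightarrow> 'e::polish_space)
    \<Rightarrow> ('w \<Rightarrow> 'e measure) \<Rightarrow> bool"
  where "is_conditional_law M G \<xi> L \<longleftrightarrow>
    L \<in> G \<rightarrow>\<^sub>M prob_algebra borel \<and>
    (\<forall>A \<in> sets G. \<forall>f :: 'e \<Rightarrow> real. f \<in> borel_measurable borel \<and> bounded (range f) \<longrightarrow>
      (LINT \<omega>:A|M. f (\<xi> \<omega>)) = (LINT \<omega>:A|M. (\<integral>x. f x \<partial>L \<omega>)))"

definition converges_weakly :: "(nat \<Rightarrow> 'e::polish_space measure) \<Rightarrow> 'e measure \<Rightarrow> bool"
  where "converges_weakly \<mu> \<nu> \<longleftrightarrow>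
    (\<forall>f :: 'e \<Rightarrow> real. continuous_on UNIV f \<and> bounded (range f) \<longrightarrow>
      (\<lambda>n. \<integral>x. f x \<partial>\<mu> n) \<longlonglongrightarrow> (\<integral>x. f x \<partial>\<nu>))"


section \<open>Variance and Gaussian sequences\<close>

definition finite_variance :: "'w measure \<Rightarrow> ('w \<Rightarrow> real) \<Rightarrow> bool"
  where "finite_variance M Y \<longleftrightarrow>
    integrable M Y \<and> integrable M (\<lambda>\<omega>. (Y \<omega> - (\<integral>\<omega>. Y \<omega> \<partial>M))\<^sup>2)"

definition covariance :: "'v measure \<Rightarrow> ('v \<Rightarrow> real) \<Rightarrow> ('v \<Rightarrow> real) \<Rightarrow> real"
  where "covariance N Y Z = (\<integral>x. (Y x - (\<integral>x. Y x \<partial>N)) * (Z x - (\<integral>x. Z x \<partial>N)) \<partial>N)"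

text \<open>Point masses count as (degenerate) Gaussian laws.\<close>

definition gaussian_variable :: "'v measure \<Rightarrow> ('v \<Rightarrow> real) \<Rightarrow> bool"
  where "gaussian_variable N Y \<longleftrightarrow>
    (\<exists>\<mu> \<sigma>. 0 < \<sigma> \<and> distributed N lborel Y (normal_density \<mu> \<sigma>)) \<or>
    (Y \<in> borel_measurable N \<and> (\<exists>\<mu>. AE x in N. Y x = \<mu>))"

definition gaussian_sequence :: "'v measure \<Rightarrow> (nat \<Rightarrow> 'v \<Rightarrow> real) \<Rightarrow> bool"
  where "gaussian_sequence N U \<longleftrightarrow>
    (\<forall>I a. finite I \<longrightarrow> gaussian_variable N (\<lambda>x. \<Sum>r\<in>I. a r * U r x))"

definition stationary_sequence :: "'v measure \<Rightarrow> (nat \<Rightarrow> 'v \<Rightarrow> real) \<Rightarrow> bool"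
  where "stationary_sequence N U \<longleftrightarrow>
    (\<forall>k. distr N borel (\<lambda>x r. U (r + k) x) = distr N borel (\<lambda>x r. U r x))"

end

theory Submission
  imports Defs
begin

text \<open>
  Let \<open>q = m(2)\<close>. Freezing the first \<open>n\<close> generations and resampling the rest, one has
  \<open>W\<^sub>\<infinity> - W\<^sub>n\<^sub>+\<^sub>r = \<Sum> e\<^bsup>-S(u)\<^esup> (W\<^sub>\<infinity>(u) - W\<^sub>r(u))\<close>, summed over \<open>|u| = n\<close>, where the martingales
  \<open>W(u)\<close> of the subtrees are independent copies of \<open>W\<close>. After division by \<open>q\<^bsup>(n+r)/2\<^esup>\<close> the squared
  coefficients \<open>e\<^bsup>-2S(u)\<^esup> q\<^bsup>-n\<^esup>\<close> sum to \<open>Y\<^sub>n = W\<^sub>n(2)\<close>, which converges as a nonnegative martingale.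
  Once the largest coefficient is known to vanish, the characteristic functions of all finite linear
  combinations converge to the Gaussian ones for every fixed past, and second moments give tightness.

  The largest coefficient vanishes for one of two reasons. If \<open>Y\<^sub>1\<close> is not constant, every large
  individual produces a definite conditional increase of the bounded submartingale \<open>exp (- Y\<^sub>n)\<close>.
  If \<open>Y\<^sub>1 = 1\<close>, the coefficients split mass conservatively, and \<open>E J > 1\<close> forces \<open>m(4) < q\<^sup>2\<close>.
\<close>

section \<open>Nonnegative supermartingales\<close>

text \<open>The statement is quenched: convergence has to hold along almost every fixed past, so
  limit theorems averaged over the past do not suffice. For one given past the error of each
  characteristic function is therefore bounded by \<open>Y n\<close> times a remainder taken at the
  largest coefficient. Only second moments of the tails are available, so the cubic remainder is
  truncated by a quadratic one. The argument lives on a product space of reproduction pairs, where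
  freezing and resampling is an actual map and the conditional law is an explicit image measure.
  Nothing ensures that \<open>Y n\<close> converges in mean; its limit may vanish. The largest
  coefficient is therefore controlled through the bounded quantity \<open>exp (- Y n)\<close>, whose
  gain at a large individual is strictly positive exactly when \<open>Y 1\<close> is not almost
  surely 1. This is the origin of the two cases. The covariances of the limit come from orthogonal
  martingale increments: the tails from \<open>r\<close> and \<open>s\<close> have covariance
  \<open>V * q ^ max r s\<close>, and the normalisation by \<open>q\<close> to the power
  \<open>(r + s) / 2\<close> leaves the exponent \<open>\<bar>r - s\<bar> / 2\<close>.\<close>

text \<open>
  The strategy that buys below \<open>a\<close> and sells above \<open>b\<close>: its gain bounds the number of upcrossings.
\<close>

primrec holding :: "real \<Rightarrow> real \<Rightarrow> (nat \<Rightarrow> real) \<Rightarrow> nat \<Rightarrow> bool" where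
  "holding a b y 0 = (y 0 < a)"
| "holding a b y (Suc n) = (if holding a b y n then y (Suc n) \<le> b else y (Suc n) < a)"

definition upcrossings :: "real \<Rightarrow> real \<Rightarrow> (nat \<Rightarrow> real) \<Rightarrow> nat \<Rightarrow> nat" where
  "upcrossings a b y n = card {k. k < n \<and> holding a b y k \<and> \<not> holding a b y (Suc k)}"

lemma upcrossings_Suc:
  "upcrossings a b y (Suc n) =
    upcrossings a b y n + (if holding a b y n \<and> \<not> holding a b y (Suc n) then 1 else 0)"
proof -
  have "{k. k < Suc n \<and> holding a b y k \<and> \<not> holding a b y (Suc k)} =
    {k. k < n \<and> holding a b y k \<and> \<not> holding a b y (Suc k)} \<union>
    (if holding a b y n \<and> \<not> holding a b y (Suc n) then {n} else {})"
    by (auto simp: less_Suc_eq simp del: holding.simps)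
  then show ?thesis
    unfolding upcrossings_def by (simp del: holding.simps)
qed

lemma upcrossings_mono: "m \<le> n \<Longrightarrow> upcrossings a b y m \<le> upcrossings a b y n"
  unfolding upcrossings_def by (intro card_mono) auto

text \<open>The term \<open>y n - a\<close> values a position that is still open, which balances
  every step: opening below \<open>a\<close> adds a negative amount on the left only, holding
  changes both sides equally, and closing above \<open>b\<close> turns at least \<open>b - a\<close>
  into one counted upcrossing.\<close>

lemma upcrossings_gain:
  assumes "a < b"
  shows "(b - a) * real (upcrossings a b y n) + (if holding a b y n then y n - a else 0)
    \<le> (\<Sum>k<n. if holding a b y k then y (Suc k) - y k else 0)"
proof (induction n)
  case 0
  then show ?case by (simp add: upcrossings_def)
next
  case (Suc n)
  then show ?case
    using assms by (auto simp: upcrossings_Suc algebra_simps split: if_splits)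
qed

lemma oscillation_upcrossings:
  assumes "a < b" and inf: "\<exists>\<^sub>F n in sequentially. y n < a" and sup: "\<exists>\<^sub>F n in sequentially. b < y n"
  shows "\<exists>n. K \<le> upcrossings a b y n"
proof (induction K)
  case 0
  then show ?case by simp
next
  case (Suc K)
  then obtain n where n: "K \<le> upcrossings a b y n" by auto
  from inf obtain p where p: "p > n" "y p < a"
    by (metis frequently_sequentially less_eq_Suc_le)
  have hp: "holding a b y p"
    using p assms(1) by (cases p) auto
  from sup obtain q where q: "q > p" "b < y q"
    by (metis frequently_sequentially less_eq_Suc_le)
  have nq: "\<not> holding a b y q"
    using q assms(1) by (cases q) auto
  \<comment> \<open>The position is open at \<open>p\<close> and closed at \<open>q\<close> whatever
    happened before, because the values there lie beyond \<open>a\<close> and \<open>b\<close>; a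
    sale must fall in between.\<close>
  have "\<exists>k. p \<le> k \<and> k < q \<and> holding a b y k \<and> \<not> holding a b y (Suc k)"
  proof (rule ccontr)
    assume H: "\<not> ?thesis"
    have "k \<le> q \<longrightarrow> holding a b y k" if "p \<le> k" for k
      using that
    proof (induction k rule: dec_induct)
      case base
      then show ?case using hp by simp
    next
      case (step k)
      then show ?case using H by (auto simp del: holding.simps)
    qed
    with nq q show False by auto
  qed
  then obtain k where k: "p \<le> k" "k < q" "holding a b y k" "\<not> holding a b y (Suc k)"
    by blast
  have "Suc K \<le> Suc (upcrossings a b y k)"
    using n p k upcrossings_mono[of n k a b y] by simp
  also have "\<dots> \<le> upcrossings a b y (Suc k)"
    using k by (simp add: upcrossings_Suc del: holding.simps)
  finally show ?case by blast
qed

text \<open>Doob's upcrossing argument. The supermartingale inequality is integrated over events of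
  \<open>F n\<close>; this suffices because the strategy uses it only on the event of holding at
  time \<open>n\<close>.\<close>

theorem (in prob_space) nonneg_supermartingale_convergent:
  fixes Y :: "nat \<Rightarrow> 'a \<Rightarrow> real"
  assumes sub: "\<And>n. subalgebra M (F n)" and mono: "\<And>n. sets (F n) \<subseteq> sets (F (Suc n))"
    and meas: "\<And>n. Y n \<in> borel_measurable (F n)"
    and int: "\<And>n. integrable M (Y n)" and nn: "\<And>n x. 0 \<le> Y n x"
    and super: "\<And>n A. A \<in> sets (F n) \<Longrightarrow> (LINT x:A|M. Y (Suc n) x) \<le> (LINT x:A|M. Y n x)"
  shows "AE x in M. convergent (\<lambda>n. Y n x)"
proof -
  have spF: "space (F n) = space M" for n
    using sub[of n] by (auto simp: subalgebra_def)
  have setF: "sets (F n) \<subseteq> sets M" for n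
    using sub[of n] by (auto simp: subalgebra_def)
  have measM[measurable]: "Y n \<in> borel_measurable M" for n
    using measurable_from_subalg[OF sub meas] .
  have hold: "{x\<in>space M. holding a b (\<lambda>n. Y n x) n} \<in> sets (F n)" for a b n
  proof (induction n)
    case 0
    have [measurable]: "Y 0 \<in> borel_measurable (F 0)" by (rule meas)
    have "{x\<in>space (F 0). Y 0 x < a} \<in> sets (F 0)" by measurable
    then show ?case by (simp add: spF)
  next
    case (Suc n)
    have [measurable]: "Y (Suc n) \<in> borel_measurable (F (Suc n))" by (rule meas)
    have "{x\<in>space M. holding a b (\<lambda>n. Y n x) n} \<in> sets (F (Suc n))"
      using Suc mono by auto
    then have [measurable]: "Measurable.pred (F (Suc n)) (\<lambda>x. holding a b (\<lambda>n. Y n x) n)"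
      by (simp add: pred_def spF)
    have "{x\<in>space (F (Suc n)). holding a b (\<lambda>n. Y n x) (Suc n)} \<in> sets (F (Suc n))"
      by simp measurable
    then show ?case by (simp add: spF)
  qed
  have holdM[measurable]: "Measurable.pred M (\<lambda>x. holding a b (\<lambda>n. Y n x) n)" for a b n
    using hold[of a b n] setF[of n] by (auto simp: pred_def)
  have upM[measurable]: "(\<lambda>x. upcrossings a b (\<lambda>n. Y n x) n) \<in> measurable M (count_space UNIV)" for a b n
    by (induction n) (auto simp: upcrossings_Suc simp del: holding.simps, simp add: upcrossings_def)
  have E_up: "(\<integral>\<^sup>+x. ennreal (real (upcrossings a b (\<lambda>n. Y n x) n)) \<partial>M) \<le> ennreal (\<bar>a\<bar> / (b - a))"
    if ab: "a < b" for a b n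
  proof -
    have i1: "integrable M (\<lambda>x. if holding a b (\<lambda>n. Y n x) k then Y (Suc k) x - Y k x else 0)" for k
      by (rule Bochner_Integration.integrable_bound[where f="\<lambda>x. Y (Suc k) x - Y k x"]) (use int in auto)
    have i2: "(\<integral>x. (if holding a b (\<lambda>n. Y n x) k then Y (Suc k) x - Y k x else 0) \<partial>M) \<le> 0" for k
    proof -
      let ?A = "{x\<in>space M. holding a b (\<lambda>n. Y n x) k}"
      have A: "?A \<in> sets M" by measurable
      have "(\<integral>x. (if holding a b (\<lambda>n. Y n x) k then Y (Suc k) x - Y k x else 0) \<partial>M)
        = (LINT x:?A|M. Y (Suc k) x - Y k x)"
        unfolding set_lebesgue_integral_def
        by (intro Bochner_Integration.integral_cong) (auto simp: indicator_def)
      also have "\<dots> = (LINT x:?A|M. Y (Suc k) x) - (LINT x:?A|M. Y k x)"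
        by (rule set_integral_diff; unfold set_integrable_def; intro integrable_mult_indicator A int)
      also have "\<dots> \<le> 0"
        using super[OF hold[of a b k]] by simp
      finally show ?thesis .
    qed
    let ?G = "\<lambda>x. \<Sum>k<n. if holding a b (\<lambda>n. Y n x) k then Y (Suc k) x - Y k x else 0"
    \<comment> \<open>Nonnegativity of \<open>Y\<close> enters here: an open position is worth at
      least \<open>- a\<close>, so it costs at most \<open>\<bar>a\<bar>\<close>.\<close>
    have pt: "real (upcrossings a b (\<lambda>n. Y n x) n) \<le> (?G x + \<bar>a\<bar>) / (b - a)" for x
    proof -
      have "(b - a) * real (upcrossings a b (\<lambda>n. Y n x) n) \<le> ?G x + \<bar>a\<bar>"
        using upcrossings_gain[OF ab, of "\<lambda>n. Y n x" n] nn[of n x] by (auto split: if_splits)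
      then show ?thesis using ab by (simp add: field_simps)
    qed
    have "(\<integral>\<^sup>+x. ennreal (real (upcrossings a b (\<lambda>n. Y n x) n)) \<partial>M) \<le> (\<integral>\<^sup>+x. ennreal ((?G x + \<bar>a\<bar>) / (b - a)) \<partial>M)"
      by (intro nn_integral_mono ennreal_leI pt)
    also have "\<dots> = ennreal (\<integral>x. (?G x + \<bar>a\<bar>) / (b - a) \<partial>M)"
      by (intro nn_integral_eq_integral Bochner_Integration.integrable_divide Bochner_Integration.integrable_add Bochner_Integration.integrable_sum i1 AE_I2
           order_trans[OF _ pt]) auto
    also have "(\<integral>x. (?G x + \<bar>a\<bar>) / (b - a) \<partial>M) = ((\<Sum>k<n. (\<integral>x. (if holding a b (\<lambda>n. Y n x) k then Y (Suc k) x - Y k x else 0) \<partial>M)) + \<bar>a\<bar>) / (b - a)"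
      using i1 by (simp add: prob_space Bochner_Integration.integral_sum Bochner_Integration.integrable_sum)
    also have "\<dots> \<le> \<bar>a\<bar> / (b - a)"
      using ab i2 by (intro divide_right_mono) (auto intro: sum_nonpos)
    finally show ?thesis by (simp add: ennreal_leI)
  qed
  have AE_up: "AE x in M. \<exists>K. \<forall>n. upcrossings a b (\<lambda>n. Y n x) n < K" if ab: "a < b" for a b
  proof -
    have "(\<integral>\<^sup>+x. (SUP n. ennreal (real (upcrossings a b (\<lambda>n. Y n x) n))) \<partial>M)
      = (SUP n. \<integral>\<^sup>+x. ennreal (real (upcrossings a b (\<lambda>n. Y n x) n)) \<partial>M)"
      by (intro nn_integral_monotone_convergence_SUP) (auto simp: incseq_def le_fun_def intro!: ennreal_leI upcrossings_mono)
    also have "\<dots> \<le> ennreal (\<bar>a\<bar> / (b - a))"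
      by (intro SUP_least E_up ab)
    finally have "(\<integral>\<^sup>+x. (SUP n. ennreal (real (upcrossings a b (\<lambda>n. Y n x) n))) \<partial>M) \<noteq> \<infinity>"
      by (auto simp: top_unique)
    then have "AE x in M. (SUP n. ennreal (real (upcrossings a b (\<lambda>n. Y n x) n))) \<noteq> \<infinity>"
      by (intro nn_integral_PInf_AE) auto
    then show ?thesis
    proof eventually_elim
      case (elim x)
      then obtain r where r: "(SUP n. ennreal (real (upcrossings a b (\<lambda>n. Y n x) n))) = ennreal r" "0 \<le> r"
        by (cases "SUP n. ennreal (real (upcrossings a b (\<lambda>n. Y n x) n))") auto
      have "upcrossings a b (\<lambda>n. Y n x) n < nat \<lceil>r\<rceil> + 1" for n
      proof -
        have "ennreal (real (upcrossings a b (\<lambda>n. Y n x) n)) \<le> ennreal r"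
          unfolding r(1)[symmetric] by (rule SUP_upper) auto
        then have "real (upcrossings a b (\<lambda>n. Y n x) n) \<le> r" using r(2) by simp
        then show ?thesis by linarith
      qed
      then show ?case by blast
    qed
  qed
  have EY: "(\<integral>\<^sup>+x. ennreal (Y n x) \<partial>M) \<le> ennreal (\<integral>x. Y 0 x \<partial>M)" for n
  proof (induction n)
    case 0
    show ?case using int nn by (subst nn_integral_eq_integral) auto
  next
    case (Suc n)
    have "(\<integral>x. Y (Suc n) x \<partial>M) \<le> (\<integral>x. Y n x \<partial>M)"
      using super[of "space M" n] sets.top[of "F n"] by (simp add: spF set_lebesgue_integral_def cong: Bochner_Integration.integral_cong)
    then show ?case using Suc int nn by (simp add: nn_integral_eq_integral integral_nonneg_AE)
  qed
  \<comment> \<open>Fatou's lemma with bounded means excludes divergence to infinity, which finite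
    upcrossing counts alone would allow.\<close>
  have "(\<integral>\<^sup>+x. liminf (\<lambda>n. ennreal (Y n x)) \<partial>M) \<le> liminf (\<lambda>n. \<integral>\<^sup>+x. ennreal (Y n x) \<partial>M)"
    by (intro nn_integral_liminf) auto
  also have "\<dots> \<le> ennreal (\<integral>x. Y 0 x \<partial>M)"
    by (intro Liminf_le) (use EY in \<open>auto intro: always_eventually\<close>)
  finally have "(\<integral>\<^sup>+x. liminf (\<lambda>n. ennreal (Y n x)) \<partial>M) \<noteq> \<infinity>" by (auto simp: top_unique)
  then have fin: "AE x in M. liminf (\<lambda>n. ennreal (Y n x)) \<noteq> \<infinity>"
    by (intro nn_integral_PInf_AE) auto
  have "AE x in M. \<forall>p::rat \<times> rat. fst p < snd p \<longrightarrow>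
      (\<exists>K. \<forall>n. upcrossings (of_rat (fst p)) (of_rat (snd p)) (\<lambda>n. Y n x) n < K)"
  proof (subst AE_all_countable, rule allI)
    fix p :: "rat \<times> rat"
    show "AE x in M. fst p < snd p \<longrightarrow> (\<exists>K. \<forall>n. upcrossings (of_rat (fst p)) (of_rat (snd p)) (\<lambda>n. Y n x) n < K)"
      using AE_up[of "of_rat (fst p)" "of_rat (snd p)"] by (cases "fst p < snd p") (auto simp: of_rat_less)
  qed
  with fin show ?thesis
  proof eventually_elim
    case (elim x)
    let ?e = "\<lambda>n. ereal (Y n x)"
    have li0: "0 \<le> liminf ?e" by (intro Liminf_bounded) (auto simp: nn)
    have lifin: "liminf ?e \<noteq> \<infinity>"
    proof
      assume "liminf ?e = \<infinity>"
      then have "liminf (\<lambda>n. ennreal (Y n x)) \<ge> of_nat k" for k :: nat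
      proof -
        have "ereal (real k) < liminf ?e" using \<open>liminf ?e = \<infinity>\<close> by simp
        then have "\<forall>\<^sub>F n in sequentially. ereal (real k) < ?e n" by (rule less_LiminfD)
        then have "\<forall>\<^sub>F n in sequentially. of_nat k \<le> ennreal (Y n x)"
          by eventually_elim (simp add: ennreal_of_nat_eq_real_of_nat ennreal_leI)
        then show ?thesis by (rule Liminf_bounded)
      qed
      then have "liminf (\<lambda>n. ennreal (Y n x)) = \<infinity>"
        by (metis elim(1) ennreal_Ex_less_of_nat infinity_ennreal_def leD less_top)
      with elim show False by simp
    qed
    have "liminf ?e = limsup ?e"
    proof (rule ccontr)
      assume "liminf ?e \<noteq> limsup ?e"
      then have "liminf ?e < limsup ?e"
        using Liminf_le_Limsup[of sequentially ?e] by (simp add: less_le)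
      then obtain a where a: "liminf ?e < ereal (of_rat a)" "ereal (of_rat a) < limsup ?e"
        using ereal_dense3 by blast
      then obtain b where b: "ereal (of_rat a) < ereal (of_rat b)" "ereal (of_rat b) < limsup ?e"
        using ereal_dense3 by blast
      have "\<exists>\<^sub>F n in sequentially. Y n x < of_rat a"
      proof (rule ccontr)
        assume "\<not> ?thesis"
        then have "\<forall>\<^sub>F n in sequentially. ereal (of_rat a) \<le> ?e n"
          by (simp add: frequently_def not_less)
        then have "ereal (of_rat a) \<le> liminf ?e" by (rule Liminf_bounded)
        with a show False by simp
      qed
      moreover have "\<exists>\<^sub>F n in sequentially. of_rat b < Y n x"
      proof (rule ccontr)
        assume "\<not> ?thesis"
        then have "\<forall>\<^sub>F n in sequentially. ?e n \<le> ereal (of_rat b)"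
          by (simp add: frequently_def not_less)
        then have "limsup ?e \<le> ereal (of_rat b)" by (rule Limsup_bounded)
        with b show False by simp
      qed
      moreover have "a < b" using b by (simp add: of_rat_less)
      ultimately obtain K where "\<And>n. upcrossings (of_rat a) (of_rat b) (\<lambda>n. Y n x) n < K"
         "\<exists>n. K \<le> upcrossings (of_rat a) (of_rat b) (\<lambda>n. Y n x) n"
        using elim(2)[rule_format, of "(a,b)"] oscillation_upcrossings[of "of_rat a" "of_rat b" "\<lambda>n. Y n x"]
        by (auto simp: of_rat_less)
      then show False by (meson not_less)
    qed
    then have "?e \<longlonglongrightarrow> liminf ?e"
      by (simp add: tendsto_iff_Liminf_eq_Limsup)
    moreover have "liminf ?e = ereal (real_of_ereal (liminf ?e))"
      using li0 lifin by (cases "liminf ?e") auto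
    ultimately have "(\<lambda>n. Y n x) \<longlonglongrightarrow> real_of_ereal (liminf ?e)"
      by (metis lim_ereal)
    then show ?case by (auto simp: convergent_def)
  qed
qed

section \<open>Weak convergence of laws of sequences\<close>

text \<open>The phase \<open>d\<close> supplies the sines, and the product formula for cosines makes
  this span an algebra, as Stone-Weierstrass requires. Integrals of its members are determined by
  the characteristic functions of finitely many coordinates.\<close>

inductive trig_poly :: "((nat \<Rightarrow> real) \<Rightarrow> real) \<Rightarrow> bool" where
  cos: "trig_poly (\<lambda>x. c * cos ((\<Sum>r<k. t r * x r) + d))"
| add: "trig_poly f \<Longrightarrow> trig_poly g \<Longrightarrow> trig_poly (\<lambda>x. f x + g x)"

lemma linear_functional_add:
  fixes x t t' :: "nat \<Rightarrow> real"
  shows "(\<Sum>r<k. t r * x r) + (\<Sum>r<k'. t' r * x r) =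
    (\<Sum>r<max k k'. ((if r < k then t r else 0) + (if r < k' then t' r else 0)) * x r)"
proof -
  have "(\<Sum>r<k. t r * x r) = (\<Sum>r<max k k'. (if r < k then t r else 0) * x r)"
    by (rule sum.mono_neutral_cong_left) auto
  moreover have "(\<Sum>r<k'. t' r * x r) = (\<Sum>r<max k k'. (if r < k' then t' r else 0) * x r)"
    by (rule sum.mono_neutral_cong_left) auto
  ultimately show ?thesis by (simp add: sum.distrib distrib_right)
qed

lemma trig_poly_cos_functional:
  assumes "\<And>x. g x = (\<Sum>r<k. t r * x r) + d"
  shows "trig_poly (\<lambda>x. c * cos (g x))"
  unfolding assms by (rule trig_poly.cos)

lemma trig_poly_mult:
  assumes "trig_poly f" "trig_poly g"
  shows "trig_poly (\<lambda>x. f x * g x)"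
  using assms
proof (induction arbitrary: g)
  case (cos c t k d)
  from cos show ?case
  proof (induction)
    case (cos c' t' k' d')
    let ?A = "\<lambda>x::nat\<Rightarrow>real. (\<Sum>r<k. t r * x r)" and ?B = "\<lambda>x::nat\<Rightarrow>real. (\<Sum>r<k'. t' r * x r)"
    have e1: "trig_poly (\<lambda>x. (c * c' / 2) * cos ((?A x + ?B x) + (d + d')))"
      unfolding linear_functional_add by (rule trig_poly.cos)
    have "?A x - ?B x = (\<Sum>r<k. t r * x r) + (\<Sum>r<k'. (- t' r) * x r)" for x
      by (simp add: sum_negf)
    then have e2: "trig_poly (\<lambda>x. (c * c' / 2) * cos ((?A x - ?B x) + (d - d')))"
      unfolding linear_functional_add by (intro trig_poly_cos_functional) simp
    have "(\<lambda>x. c * cos (?A x + d) * (c' * cos (?B x + d'))) =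
      (\<lambda>x. (c * c' / 2) * cos ((?A x + ?B x) + (d + d')) + (c * c' / 2) * cos ((?A x - ?B x) + (d - d')))"
    proof
      fix x
      have "c * cos (?A x + d) * (c' * cos (?B x + d')) = c * c' * (cos (?A x + d) * cos (?B x + d'))"
        by simp
      also have "\<dots> = c * c' * ((cos ((?A x + d) - (?B x + d')) + cos ((?A x + d) + (?B x + d'))) / 2)"
        by (simp only: cos_times_cos)
      also have "(?A x + d) - (?B x + d') = (?A x - ?B x) + (d - d')" by simp
      also have "(?A x + d) + (?B x + d') = (?A x + ?B x) + (d + d')" by simp
      finally show "c * cos (?A x + d) * (c' * cos (?B x + d')) =
         (c * c' / 2) * cos ((?A x + ?B x) + (d + d')) + (c * c' / 2) * cos ((?A x - ?B x) + (d - d'))"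
        by (simp add: algebra_simps add_divide_distrib)
    qed
    then show ?case using trig_poly.add[OF e1 e2] by simp
  next
    case (add f g)
    then show ?case by (simp add: distrib_left trig_poly.add)
  qed
next
  case (add f f')
  then show ?case by (simp add: distrib_right trig_poly.add)
qed

lemma trig_poly_const: "trig_poly (\<lambda>_. c)"
  using trig_poly.cos[of c "\<lambda>_. 0" 0 0] by simp

lemma trig_poly_polynomial:
  fixes p :: "real \<Rightarrow> real"
  assumes "real_polynomial_function p" "trig_poly g"
  shows "trig_poly (\<lambda>x. p (g x))"
  using assms(1)
proof induction
  case (linear p)
  then interpret bounded_linear p .
  have "p (g x) = p 1 * g x" for x
    using scaleR[of "g x" 1] by simp
  then show ?case
    using trig_poly_mult[OF trig_poly_const[of "p 1"] assms(2)] by simp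
qed (auto intro: trig_poly_const trig_poly.add trig_poly_mult)

lemma trig_poly_continuous: "trig_poly f \<Longrightarrow> continuous_on S f"
  by (induction rule: trig_poly.induct)
     (auto intro!: continuous_intros continuous_on_product_coordinates[THEN continuous_on_subset])

lemma trig_poly_bounded: "trig_poly f \<Longrightarrow> \<exists>B. \<forall>x. \<bar>f x\<bar> \<le> B"
proof (induction rule: trig_poly.induct)
  case (cos c t k d)
  have "\<bar>c * cos y\<bar> \<le> \<bar>c\<bar>" for y
    by (simp add: abs_mult mult_left_le)
  then show ?case by blast
next
  case (add f g)
  then obtain B C where "\<forall>x. \<bar>f x\<bar> \<le> B" "\<forall>x. \<bar>g x\<bar> \<le> C" by auto
  then have "\<forall>x. \<bar>f x + g x\<bar> \<le> B + C" by (meson abs_triangle_ineq add_mono order_trans)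
  then show ?case by blast
qed

lemma trig_poly_separates:
  assumes "x \<noteq> y"
  shows "\<exists>f. trig_poly f \<and> f x \<noteq> f y"
proof -
  from assms obtain r where r: "x r \<noteq> y r" by auto
  \<comment> \<open>With this frequency the cosine centred at \<open>y r\<close> is 1 at
    \<open>y\<close> and, a phase of \<open>pi / 2\<close> away, 0 at \<open>x\<close>.\<close>
  define s where "s = pi / (2 * \<bar>x r - y r\<bar>)"
  have lin: "s * (z r - y r) = (\<Sum>j<Suc r. (if j = r then s else 0) * z j) + (- s * y r)" for z :: "nat \<Rightarrow> real"
    by (simp add: algebra_simps)
  have "trig_poly (\<lambda>z. 1 * cos (s * (z r - y r)))"
    using lin by (rule trig_poly_cos_functional)
  moreover have "cos (s * (x r - y r)) = 0"
  proof -
    have "s * \<bar>x r - y r\<bar> = pi / 2" using r by (simp add: s_def)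
    then have "\<bar>s * (x r - y r)\<bar> = pi / 2" by (simp add: s_def abs_mult)
    then show ?thesis by (metis cos_abs_real cos_pi_half)
  qed
  ultimately show ?thesis
    by (intro exI[of _ "\<lambda>z. 1 * cos (s * (z r - y r))"] conjI) simp_all
qed

lemma measurable_coordinate_sequence [measurable]:
  "(\<lambda>x::nat \<Rightarrow> real. x r) \<in> borel_measurable borel"
  by (intro borel_measurable_continuous_onI continuous_on_product_coordinates)

lemma trig_poly_integral_convergent:
  fixes \<mu> :: "nat \<Rightarrow> (nat \<Rightarrow> real) measure"
  assumes "\<And>n. prob_space (\<mu> n)" "\<And>n. sets (\<mu> n) = sets borel"
    and "prob_space \<nu>" "sets \<nu> = sets borel"
    and char: "\<And>k t. (\<lambda>n. CLINT x|\<mu> n. iexp (\<Sum>r<k. t r * x r)) \<longlonglongrightarrow> (CLINT x|\<nu>. iexp (\<Sum>r<k. t r * x r))"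
    and "trig_poly f"
  shows "(\<lambda>n. \<integral>x. f x \<partial>\<mu> n) \<longlonglongrightarrow> (\<integral>x. f x \<partial>\<nu>)"
  using \<open>trig_poly f\<close>
proof (induction rule: trig_poly.induct)
  case (cos c t k d)
  have eq: "(\<integral>x. c * cos ((\<Sum>r<k. t r * x r) + d) \<partial>\<kappa>) = Re (c * iexp d * (CLINT x|\<kappa>. iexp (\<Sum>r<k. t r * x r)))"
    if "prob_space \<kappa>" and [measurable_cong]: "sets \<kappa> = sets borel" for \<kappa> :: "(nat \<Rightarrow> real) measure"
  proof -
    interpret prob_space \<kappa> by fact
    have [measurable]: "(\<lambda>x. \<Sum>r<k. t r * x r) \<in> borel_measurable \<kappa>" by measurable
    have pt: "Re (c * iexp d * iexp y) = c * cos (y + d)" for y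
      unfolding cis_conv_exp[symmetric] by (simp add: mult.assoc cis_mult add.commute)
    have int: "complex_integrable \<kappa> (\<lambda>x. iexp (\<Sum>r<k. t r * x r))"
      by (intro integrable_const_bound[where B=1]) (auto simp: norm_exp_eq_Re)
    have "c * iexp d * (CLINT x|\<kappa>. iexp (\<Sum>r<k. t r * x r)) = (CLINT x|\<kappa>. c * iexp d * iexp (\<Sum>r<k. t r * x r))"
      using int by simp
    also have "Re \<dots> = (\<integral>x. Re (c * iexp d * iexp (\<Sum>r<k. t r * x r)) \<partial>\<kappa>)"
      using int by (intro integral_Re[symmetric]) auto
    also have "\<dots> = (\<integral>x. c * cos ((\<Sum>r<k. t r * x r) + d) \<partial>\<kappa>)"
      by (intro Bochner_Integration.integral_cong refl pt)
    finally show ?thesis ..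
  qed
  show ?case
    unfolding eq[OF assms(1,2)] eq[OF assms(3,4)] by (intro tendsto_intros char)
next
  case (add f g)
  have "integrable \<kappa> f" if \<kappa>: "prob_space \<kappa>" "sets \<kappa> = sets borel" "trig_poly f" for \<kappa> and f
  proof -
    interpret prob_space \<kappa> by fact
    obtain B where "\<forall>x. \<bar>f x\<bar> \<le> B" using trig_poly_bounded[OF \<kappa>(3)] by auto
    moreover have "f \<in> borel_measurable \<kappa>"
      unfolding measurable_cong_sets[OF \<kappa>(2) refl]
      by (intro borel_measurable_continuous_onI trig_poly_continuous \<kappa>)
    ultimately show ?thesis by (intro integrable_const_bound[where B=B]) auto
  qed
  with add assms show ?case
    by (auto intro!: tendsto_add)
qed

section \<open>Tightness of laws of sequences\<close>

lemma compact_cube: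
  fixes C :: "nat \<Rightarrow> real"
  shows "compact {x. \<forall>r. \<bar>x r\<bar> \<le> C r}"
proof -
  have "{x. \<forall>r. \<bar>x r\<bar> \<le> C r} = PiE UNIV (\<lambda>r. {- C r..C r})"
    by (simp add: PiE_UNIV_domain Pi_def abs_le_iff minus_le_iff[of "C _"] conj_commute)
  moreover have "compactin (product_topology (\<lambda>_. euclidean) UNIV) (PiE UNIV (\<lambda>r. {- C r..C r}))"
    unfolding compactin_PiE by (auto simp: compactin_euclidean_iff)
  ultimately show ?thesis
    by (simp add: euclidean_product_topology compactin_euclidean_iff)
qed

text \<open>Chebyshev's inequality in every coordinate, where coordinate \<open>r\<close> is
  allotted the mass \<open>\<epsilon> / 2 ^ Suc r\<close>, and a union bound. The \<open>+ 1\<close>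
  keeps the cube from degenerating when \<open>C r = 0\<close>.\<close>

lemma second_moments_tight:
  fixes K :: "(nat \<Rightarrow> real) measure"
  assumes "prob_space K" and [measurable_cong]: "sets K = sets borel"
    and mom: "\<And>r. (\<integral>\<^sup>+x. ennreal ((x r)\<^sup>2) \<partial>K) \<le> ennreal (C r)" and C: "\<And>r. 0 \<le> C r"
    and "0 < \<epsilon>"
  shows "measure K {x\<in>space K. \<not> (\<forall>r. \<bar>x r\<bar> \<le> sqrt ((C r + 1) * 2 ^ Suc r / \<epsilon>))} \<le> \<epsilon>"
proof -
  interpret prob_space K by fact
  let ?D = "\<lambda>r. sqrt ((C r + 1) * 2 ^ Suc r / \<epsilon>)"
  have D2: "(?D r)\<^sup>2 = (C r + 1) * 2 ^ Suc r / \<epsilon>" for r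
    using C[of r] \<open>0 < \<epsilon>\<close> by simp
  have one: "emeasure K {x\<in>space K. \<not> \<bar>x r\<bar> \<le> ?D r} \<le> ennreal (\<epsilon> * (1/2) ^ Suc r)" for r
  proof -
    have "(?D r)\<^sup>2 > 0" unfolding D2 using C[of r] \<open>0 < \<epsilon>\<close> by (intro divide_pos_pos mult_pos_pos) auto
    have "emeasure K {x\<in>space K. \<not> \<bar>x r\<bar> \<le> ?D r} \<le> emeasure K {x\<in>space K. 1 \<le> ennreal (1 / (?D r)\<^sup>2) * ennreal ((x r)\<^sup>2)}"
    proof (intro emeasure_mono subsetI, safe)
      fix x assume "\<not> \<bar>x r\<bar> \<le> ?D r"
      then have "(?D r)\<^sup>2 \<le> \<bar>x r\<bar>\<^sup>2"
        using C[of r] \<open>0 < \<epsilon>\<close> by (intro power_mono) auto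
      then show "1 \<le> ennreal (1 / (?D r)\<^sup>2) * ennreal ((x r)\<^sup>2)"
        using \<open>(?D r)\<^sup>2 > 0\<close> by (simp add: ennreal_mult[symmetric] del: real_sqrt_pow2_iff real_sqrt_pow2 flip: ennreal_1)
    qed measurable
    also have "\<dots> \<le> ennreal (1 / (?D r)\<^sup>2) * (\<integral>\<^sup>+x. ennreal ((x r)\<^sup>2) * indicator (space K) x \<partial>K)"
      using nn_integral_Markov_inequality[of "\<lambda>x. ennreal ((x r)\<^sup>2)" "space K" K "ennreal (1 / (?D r)\<^sup>2)"] by simp
    also have "(\<integral>\<^sup>+x. ennreal ((x r)\<^sup>2) * indicator (space K) x \<partial>K) = (\<integral>\<^sup>+x. ennreal ((x r)\<^sup>2) \<partial>K)"
      by (intro nn_integral_cong) auto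
    also have "ennreal (1 / (?D r)\<^sup>2) * \<dots> \<le> ennreal (1 / (?D r)\<^sup>2) * ennreal (C r)"
      by (intro mult_left_mono mom) auto
    also have "\<dots> = ennreal (C r / (?D r)\<^sup>2)" using C[of r] by (simp add: ennreal_mult[symmetric])
    also have "C r / (?D r)\<^sup>2 \<le> \<epsilon> * (1/2) ^ Suc r"
    proof -
      have "C r / (?D r)\<^sup>2 = (C r / (C r + 1)) * (\<epsilon> * (1/2) ^ Suc r)"
        unfolding D2 using C[of r] \<open>0 < \<epsilon>\<close> by (simp add: field_simps)
      also have "\<dots> \<le> 1 * (\<epsilon> * (1/2) ^ Suc r)"
        using C[of r] \<open>0 < \<epsilon>\<close> by (intro mult_right_mono) (auto simp: field_simps)
      finally show ?thesis by simp
    qed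
    finally show ?thesis by (simp add: ennreal_leI)
  qed
  have "emeasure K {x\<in>space K. \<not> (\<forall>r. \<bar>x r\<bar> \<le> ?D r)} = emeasure K (\<Union>r. {x\<in>space K. \<not> \<bar>x r\<bar> \<le> ?D r})"
    by (intro arg_cong2[where f=emeasure]) auto
  also have "\<dots> \<le> (\<Sum>r. emeasure K {x\<in>space K. \<not> \<bar>x r\<bar> \<le> ?D r})"
    by (intro emeasure_subadditive_countably) auto
  also have "\<dots> \<le> (\<Sum>r. ennreal (\<epsilon> * (1/2) ^ Suc r))"
    by (intro suminf_le one) auto
  also have "\<dots> = ennreal \<epsilon>"
  proof -
    have "(\<lambda>r. \<epsilon> * (1/2) ^ Suc r) sums (\<epsilon> * 1)"
      by (intro sums_mult power_half_series)
    then show ?thesis using \<open>0 < \<epsilon>\<close> by (intro suminf_ennreal_eq) auto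
  qed
  finally show ?thesis using \<open>0 < \<epsilon>\<close> by (simp add: emeasure_eq_measure)
qed

text \<open>
  On a compact cube carrying most of the mass, a continuous test function is approximated by a
  trigonometric polynomial; composing the latter with a polynomial that approximates truncation
  keeps the approximation bounded off the cube.
\<close>

theorem converges_weakly_sequencesI:
  fixes \<mu> :: "nat \<Rightarrow> (nat \<Rightarrow> real) measure"
  assumes P: "\<And>n. prob_space (\<mu> n)" and S: "\<And>n. sets (\<mu> n) = sets borel"
    and P': "prob_space \<nu>" and S': "sets \<nu> = sets borel"
    and char: "\<And>k t. (\<lambda>n. CLINT x|\<mu> n. iexp (\<Sum>r<k. t r * x r)) \<longlonglongrightarrow> (CLINT x|\<nu>. iexp (\<Sum>r<k. t r * x r))"
    and mom: "\<And>n r. (\<integral>\<^sup>+x. ennreal ((x r)\<^sup>2) \<partial>\<mu> n) \<le> ennreal (C r)"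
    and mom': "\<And>r. (\<integral>\<^sup>+x. ennreal ((x r)\<^sup>2) \<partial>\<nu>) \<le> ennreal (C r)"
    and C: "\<And>r. 0 \<le> C r"
  shows "converges_weakly \<mu> \<nu>"
  unfolding converges_weakly_def
proof (intro allI impI, elim conjE)
  fix f :: "(nat \<Rightarrow> real) \<Rightarrow> real"
  assume f: "continuous_on UNIV f" and "bounded (range f)"
  then obtain B0 where B0: "\<And>x. \<bar>f x\<bar> \<le> B0" by (auto simp: bounded_iff)
  define B where "B = max B0 1"
  have B: "\<bar>f x\<bar> \<le> B" "B \<ge> 1" for x using B0[of x] by (auto simp: B_def)
  \<comment> \<open>The factor collects \<open>\<epsilon>\<close> from approximating
    \<open>f\<close> on the cube, \<open>\<epsilon>\<close> from the polynomial that replaces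
    truncation, and \<open>2 * B + 1\<close> for the mass of at most \<open>\<epsilon>\<close> off
    the cube.\<close>
  have key: "\<exists>g. trig_poly g \<and> (\<forall>\<kappa>. prob_space \<kappa> \<and> sets \<kappa> = sets borel \<and> (\<forall>r. (\<integral>\<^sup>+x. ennreal ((x r)\<^sup>2) \<partial>\<kappa>) \<le> ennreal (C r))
      \<longrightarrow> \<bar>(\<integral>x. f x \<partial>\<kappa>) - (\<integral>x. g x \<partial>\<kappa>)\<bar> \<le> (2 + 2 * B + 1) * \<epsilon>)" if "0 < \<epsilon>" "\<epsilon> \<le> 1" for \<epsilon>
  proof -
    let ?K = "{x. \<forall>r. \<bar>x r\<bar> \<le> sqrt ((C r + 1) * 2 ^ Suc r / \<epsilon>)}"
    interpret ring: function_ring_on "Collect trig_poly" ?K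
      by unfold_locales
         (auto intro!: compact_cube trig_poly_const trig_poly_mult trig_poly.add dest: trig_poly_continuous trig_poly_separates)
    obtain g where g: "trig_poly g" "\<And>x. x \<in> ?K \<Longrightarrow> \<bar>f x - g x\<bar> < \<epsilon>"
      using ring.Stone_Weierstrass_basic[OF continuous_on_subset[OF f] \<open>0 < \<epsilon>\<close>] by auto
    obtain D where D: "\<And>x. \<bar>g x\<bar> \<le> D" using trig_poly_bounded[OF g(1)] by auto
    let ?c = "\<lambda>y::real. max (- B) (min B y)"
    obtain p :: "real \<Rightarrow> real" where p: "real_polynomial_function p" "\<And>y. y \<in> {-D..D} \<Longrightarrow> \<bar>?c y - p y\<bar> < \<epsilon>"
      by (rule Stone_Weierstrass_real_polynomial_function[of "{-D..D}" ?c \<epsilon>]) (use \<open>0 < \<epsilon>\<close> in \<open>auto intro!: continuous_intros\<close>)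
    have pg: "\<bar>?c (g x) - p (g x)\<bar> < \<epsilon>" for x
      using D[of x] by (intro p(2)) (auto simp: abs_le_iff)
    define h where "h x = p (g x)" for x
    have h: "trig_poly h" unfolding h_def by (rule trig_poly_polynomial[OF p(1) g(1)])
    have cl: "\<bar>a - ?c y\<bar> \<le> \<bar>a - y\<bar>" if "\<bar>a\<bar> \<le> B" for a y
      using that by linarith
    have cB: "\<bar>?c y\<bar> \<le> B" for y
      using B(2) by linarith
    have near: "\<bar>f x - h x\<bar> \<le> 2 * \<epsilon>" if "x \<in> ?K" for x
      using g(2)[OF that] pg[of x] cl[OF B(1), of x "g x"] unfolding h_def by linarith
    have far: "\<bar>f x - h x\<bar> \<le> 2 * B + 1" for x
      using pg[of x] B(1)[of x] cB[of "g x"] \<open>\<epsilon> \<le> 1\<close> unfolding h_def by linarith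
    have "\<bar>(\<integral>x. f x \<partial>\<kappa>) - (\<integral>x. h x \<partial>\<kappa>)\<bar> \<le> (2 + 2 * B + 1) * \<epsilon>"
      if \<kappa>: "prob_space \<kappa>" "sets \<kappa> = sets borel" "\<forall>r. (\<integral>\<^sup>+x. ennreal ((x r)\<^sup>2) \<partial>\<kappa>) \<le> ennreal (C r)" for \<kappa>
    proof -
      interpret prob_space \<kappa> by fact
      note [measurable_cong] = \<kappa>(2)
      have [measurable]: "f \<in> borel_measurable borel" "h \<in> borel_measurable borel"
        by (intro borel_measurable_continuous_onI f trig_poly_continuous h)+
      let ?N = "{x\<in>space \<kappa>. \<not> (\<forall>r. \<bar>x r\<bar> \<le> sqrt ((C r + 1) * 2 ^ Suc r / \<epsilon>))}"
      have N: "measure \<kappa> ?N \<le> \<epsilon>"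
        by (rule second_moments_tight) (use \<kappa> C \<open>0 < \<epsilon>\<close> in auto)
      have [measurable]: "?N \<in> sets \<kappa>" by measurable
      obtain E where E: "\<And>x. \<bar>h x\<bar> \<le> E" using trig_poly_bounded[OF h] by auto
      have i: "integrable \<kappa> f" "integrable \<kappa> h"
        using B(1) by (intro integrable_const_bound[where B=B]; simp)
          (use E in \<open>intro integrable_const_bound[where B=E]; simp\<close>)
      have "\<bar>(\<integral>x. f x \<partial>\<kappa>) - (\<integral>x. h x \<partial>\<kappa>)\<bar> = \<bar>\<integral>x. f x - h x \<partial>\<kappa>\<bar>"
        using i by simp
      also have "\<dots> \<le> (\<integral>x. \<bar>f x - h x\<bar> \<partial>\<kappa>)"
        by (rule integral_abs_bound)
      also have "\<dots> \<le> (\<integral>x. 2 * \<epsilon> + (2 * B + 1) * indicator ?N x \<partial>\<kappa>)"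
      proof (intro integral_mono)
        show "\<bar>f x - h x\<bar> \<le> 2 * \<epsilon> + (2 * B + 1) * indicator ?N x" if "x \<in> space \<kappa>" for x
          using near[of x] far[of x] that \<open>0 < \<epsilon>\<close> by (auto simp: indicator_def)
      qed (use i in \<open>auto intro!: integrable_real_indicator simp: emeasure_eq_measure\<close>)
      also have "\<dots> = 2 * \<epsilon> + (2 * B + 1) * measure \<kappa> ?N"
        by (subst Bochner_Integration.integral_add) (auto simp: prob_space emeasure_eq_measure)
      also have "\<dots> \<le> 2 * \<epsilon> + (2 * B + 1) * \<epsilon>"
        using N B(2) by (intro add_left_mono mult_left_mono) auto
      finally show ?thesis by (simp add: algebra_simps)
    qed
    with h show ?thesis by blast
  qed
  show "(\<lambda>n. \<integral>x. f x \<partial>\<mu> n) \<longlonglongrightarrow> (\<integral>x. f x \<partial>\<nu>)"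
  proof (rule LIMSEQ_I)
    fix r :: real assume "0 < r"
    define M where "M = 2 + 2 * B + 1"
    have M: "M \<ge> 5" using B(2) by (simp add: M_def)
    define \<epsilon> where "\<epsilon> = min 1 (r / (4 * M))"
    have \<epsilon>: "0 < \<epsilon>" "\<epsilon> \<le> 1" "M * \<epsilon> \<le> r / 4"
    proof -
      have "M * \<epsilon> \<le> M * (r / (4 * M))" using M by (intro mult_left_mono) (auto simp: \<epsilon>_def)
      then show "M * \<epsilon> \<le> r / 4" using M by simp
    qed (use M \<open>0 < r\<close> in \<open>auto simp: \<epsilon>_def\<close>)
    obtain g where g: "trig_poly g" "\<And>\<kappa>. prob_space \<kappa> \<Longrightarrow> sets \<kappa> = sets borel \<Longrightarrow> (\<And>r. (\<integral>\<^sup>+x. ennreal ((x r)\<^sup>2) \<partial>\<kappa>) \<le> ennreal (C r))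
      \<Longrightarrow> \<bar>(\<integral>x. f x \<partial>\<kappa>) - (\<integral>x. g x \<partial>\<kappa>)\<bar> \<le> M * \<epsilon>"
      using key[OF \<epsilon>(1,2)] unfolding M_def by blast
    have "(\<lambda>n. \<integral>x. g x \<partial>\<mu> n) \<longlonglongrightarrow> (\<integral>x. g x \<partial>\<nu>)"
      by (rule trig_poly_integral_convergent[OF P S P' S' char g(1)])
    from LIMSEQ_D[OF this, of "r/4"] \<open>0 < r\<close> obtain n0 where
      n0: "\<And>n. n \<ge> n0 \<Longrightarrow> norm ((\<integral>x. g x \<partial>\<mu> n) - (\<integral>x. g x \<partial>\<nu>)) < r / 4" by auto
    show "\<exists>n0. \<forall>n\<ge>n0. norm ((\<integral>x. f x \<partial>\<mu> n) - (\<integral>x. f x \<partial>\<nu>)) < r"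
    proof (intro exI[of _ n0] allI impI)
      fix n assume "n \<ge> n0"
      then show "norm ((\<integral>x. f x \<partial>\<mu> n) - (\<integral>x. f x \<partial>\<nu>)) < r"
        using n0[of n] g(2)[OF P S mom, of n] g(2)[OF P' S' mom'] \<epsilon>(3) \<open>0 < r\<close> unfolding real_norm_def by linarith
    qed
  qed
qed

section \<open>Weighted sums of independent variables\<close>

lemma measurable_pair_count_space:
  assumes I: "countable I" and f: "\<And>i. i \<in> I \<Longrightarrow> f i \<in> M \<rightarrow>\<^sub>M N"
  shows "(\<lambda>(x, i). f i x) \<in> M \<Otimes>\<^sub>M count_space I \<rightarrow>\<^sub>M N"
proof -
  have "(\<lambda>(i, x). f i x) \<in> count_space I \<Otimes>\<^sub>M M \<rightarrow>\<^sub>M N"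
    by (rule measurable_pair_measure_countable1[OF I]) (simp add: f)
  then show ?thesis
    by (subst (asm) measurable_pair_swap_iff) (simp add: split_beta')
qed

lemma borel_measurable_integral_count_space:
  fixes f :: "'i \<Rightarrow> 'a \<Rightarrow> real"
  assumes "countable I" "\<And>i. i \<in> I \<Longrightarrow> f i \<in> borel_measurable M"
  shows "(\<lambda>x. \<integral>i. f i x \<partial>count_space I) \<in> borel_measurable M"
  by (rule sigma_finite_measure.borel_measurable_lebesgue_integral
      [OF sigma_finite_measure_count_space_countable measurable_pair_count_space]) (use assms in auto)

lemma borel_measurable_nn_integral_count_space:
  fixes f :: "'i \<Rightarrow> 'a \<Rightarrow> ennreal"
  assumes "countable I" "\<And>i. i \<in> I \<Longrightarrow> f i \<in> borel_measurable M"
  shows "(\<lambda>x. \<integral>\<^sup>+i. f i x \<partial>count_space I) \<in> borel_measurable M"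
  by (rule sigma_finite_measure.borel_measurable_nn_integral
      [OF sigma_finite_measure_count_space_countable measurable_pair_count_space]) (use assms in auto)

text \<open>Products of expectations and of characteristic functions are available for finitely many
  independent factors. Identities for countable sums are proved on these finite sets and passed to
  the limit.\<close>

definition initial :: "'i::countable set \<Rightarrow> nat \<Rightarrow> 'i set" where
  "initial I n = {i\<in>I. to_nat i < n}"

lemma finite_initial [simp]: "finite (initial I n)"
proof -
  have "finite (to_nat -` {..<n} :: 'a set)" by (rule finite_vimageI) auto
  then show ?thesis by (rule finite_subset[rotated]) (auto simp: initial_def)
qed

lemma initial_subset: "initial I n \<subseteq> I" by (auto simp: initial_def)

lemma integral_count_space_tendsto:
  fixes f :: "'i::countable \<Rightarrow> real"
  assumes f: "integrable (count_space I) f"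
  shows "(\<lambda>n. sum f (initial I n)) \<longlonglongrightarrow> (\<integral>i. f i \<partial>count_space I)"
proof -
  have "(\<lambda>n. \<integral>i. f i * indicator (initial I n) i \<partial>count_space I) \<longlonglongrightarrow> (\<integral>i. f i \<partial>count_space I)"
  proof (rule integral_dominated_convergence[where w="\<lambda>i. \<bar>f i\<bar>"])
    show "AE i in count_space I. (\<lambda>n. f i * indicator (initial I n) i) \<longlonglongrightarrow> f i"
    proof (rule AE_I2)
      fix i assume "i \<in> space (count_space I)"
      then have "\<forall>\<^sub>F n in sequentially. f i * indicator (initial I n) i = f i"
        unfolding eventually_sequentially by (intro exI[of _ "Suc (to_nat i)"]) (auto simp: initial_def)
      then show "(\<lambda>n. f i * indicator (initial I n) i) \<longlonglongrightarrow> f i"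
        by (rule tendsto_eventually)
    qed
  qed (use f in \<open>auto simp: indicator_def\<close>)
  moreover have "(\<integral>i. f i * indicator (initial I n) i \<partial>count_space I) = sum f (initial I n)" for n
  proof -
    have "finite {i\<in>I. f i * indicator (initial I n) i \<noteq> 0}"
      by (rule finite_subset[OF _ finite_initial[of I n]]) (auto simp: indicator_def)
    then show ?thesis
      by (subst lebesgue_integral_count_space_finite_support, assumption)
         (rule sum.mono_neutral_cong_left[OF finite_initial], auto simp: indicator_def initial_def)
  qed
  ultimately show ?thesis by simp
qed

lemma sum_initial_le:
  fixes f :: "'i::countable \<Rightarrow> real"
  assumes f: "integrable (count_space I) f" and nn: "\<And>i. i \<in> I \<Longrightarrow> 0 \<le> f i"
  shows "sum f (initial I n) \<le> (\<integral>i. f i \<partial>count_space I)"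
proof (rule LIMSEQ_le_const[OF integral_count_space_tendsto[OF f]], intro exI allI impI)
  fix m assume "n \<le> m"
  then show "sum f (initial I n) \<le> sum f (initial I m)"
    by (intro sum_mono2 finite_initial) (auto simp: initial_def nn)
qed

lemma le_integral_count_space:
  fixes f :: "'i::countable \<Rightarrow> real"
  assumes f: "integrable (count_space I) f" and nn: "\<And>i. i \<in> I \<Longrightarrow> 0 \<le> f i" and "j \<in> I"
  shows "f j \<le> (\<integral>i. f i \<partial>count_space I)"
proof -
  have "f j \<le> sum f (initial I (Suc (to_nat j)))"
    by (rule member_le_sum[OF _ _ finite_initial]) (use assms in \<open>auto simp: initial_def\<close>)
  then show ?thesis using sum_initial_le[OF f nn, of "Suc (to_nat j)"] by simp
qed

text \<open>An entry of a nonnegative summable family is at most the total, hence its square is at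
  most the total times the entry.\<close>

lemma integrable_count_space_square:
  fixes b :: "'i::countable \<Rightarrow> real"
  assumes b: "integrable (count_space I) b" and nn: "\<And>i. i \<in> I \<Longrightarrow> 0 \<le> b i"
  shows "integrable (count_space I) (\<lambda>i. (b i)\<^sup>2)"
proof (rule Bochner_Integration.integrable_bound[where f="\<lambda>i. (\<integral>i. b i \<partial>count_space I) * b i"])
  show "AE i in count_space I. norm ((b i)\<^sup>2) \<le> norm ((\<integral>i. b i \<partial>count_space I) * b i)"
    using le_integral_count_space[OF b nn] nn
    by (intro AE_I2) (auto simp: power2_eq_square abs_mult intro!: mult_right_mono order_trans[OF _ abs_ge_self])
qed (use b in auto)

text \<open>The situation once the past is frozen: deterministic coefficients and independent
  centred terms. Summability of \<open>b\<close> itself, and not only of its squares, makes the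
  series absolutely convergent almost surely, so that it can be written as an integral over the
  counting measure.\<close>

locale weighted_sum = prob_space M for M :: "'a measure" +
  fixes I :: "'i::countable set" and b :: "'i \<Rightarrow> real" and \<zeta> :: "'i \<Rightarrow> 'a \<Rightarrow> real" and s :: real
  assumes indep: "indep_vars (\<lambda>_. borel) \<zeta> I"
    and square_integrable: "\<And>i. i \<in> I \<Longrightarrow> integrable M (\<lambda>x. (\<zeta> i x)\<^sup>2)"
    and mean_zero: "\<And>i. i \<in> I \<Longrightarrow> expectation (\<zeta> i) = 0"
    and second_moment: "\<And>i. i \<in> I \<Longrightarrow> expectation (\<lambda>x. (\<zeta> i x)\<^sup>2) = s"
    and nonneg: "\<And>i. i \<in> I \<Longrightarrow> 0 \<le> b i"
    and summable: "integrable (count_space I) b"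
begin

lemma measurable_terms [measurable (raw)]: "i \<in> I \<Longrightarrow> \<zeta> i \<in> borel_measurable M"
  using indep by (auto simp: indep_vars_def)

lemma integrable_terms: "i \<in> I \<Longrightarrow> integrable M (\<zeta> i)"
  using square_integrable_imp_integrable[OF measurable_terms square_integrable] .

lemma measurable_total [measurable]: "(\<lambda>x. \<integral>i. b i * \<zeta> i x \<partial>count_space I) \<in> borel_measurable M"
  by (intro borel_measurable_integral_count_space) auto

text \<open>This series of finite mean is the dominating function for everything that follows: it
  controls the absolute sums, and by Cauchy-Schwarz also the squares of all partial sums.\<close>

lemma weighted_squares:
  shows AE_weighted_squares: "AE x in M. integrable (count_space I) (\<lambda>i. b i * (\<zeta> i x)\<^sup>2)"
    and integrable_weighted_squares: "integrable M (\<lambda>x. \<integral>i. b i * (\<zeta> i x)\<^sup>2 \<partial>count_space I)"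
proof -
  have "(\<integral>\<^sup>+x. \<integral>\<^sup>+i. ennreal (b i * (\<zeta> i x)\<^sup>2) \<partial>count_space I \<partial>M)
      = (\<integral>\<^sup>+i. \<integral>\<^sup>+x. ennreal (b i * (\<zeta> i x)\<^sup>2) \<partial>M \<partial>count_space I)"
    by (intro nn_integral_count_space_nn_integral) auto
  also have "\<dots> = (\<integral>\<^sup>+i. ennreal (s * b i) \<partial>count_space I)"
    using square_integrable second_moment nonneg
    by (intro nn_integral_cong) (auto simp: nn_integral_eq_integral mult.commute)
  also have "\<dots> < \<infinity>"
    using integrableD(2)[of "count_space I" "\<lambda>i. s * b i"] summable by (simp add: less_top)
  finally have fin: "(\<integral>\<^sup>+x. \<integral>\<^sup>+i. ennreal (b i * (\<zeta> i x)\<^sup>2) \<partial>count_space I \<partial>M) < \<infinity>" .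
  have mm: "(\<lambda>x. \<integral>\<^sup>+i. ennreal (b i * (\<zeta> i x)\<^sup>2) \<partial>count_space I) \<in> borel_measurable M"
    by (intro borel_measurable_nn_integral_count_space) auto
  from fin have "AE x in M. (\<integral>\<^sup>+i. ennreal (b i * (\<zeta> i x)\<^sup>2) \<partial>count_space I) \<noteq> \<infinity>"
    by (intro nn_integral_PInf_AE mm) auto
  then show ae: "AE x in M. integrable (count_space I) (\<lambda>i. b i * (\<zeta> i x)\<^sup>2)"
    by eventually_elim (auto simp: nonneg less_top intro!: integrableI_nonneg AE_I2)
  have "(\<integral>\<^sup>+x. ennreal (\<integral>i. b i * (\<zeta> i x)\<^sup>2 \<partial>count_space I) \<partial>M)
      = (\<integral>\<^sup>+x. \<integral>\<^sup>+i. ennreal (b i * (\<zeta> i x)\<^sup>2) \<partial>count_space I \<partial>M)"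
  proof (rule nn_integral_cong_AE, use ae in eventually_elim)
    case (elim x)
    then show ?case
      by (intro nn_integral_eq_integral[symmetric] AE_I2) (auto simp: nonneg)
  qed
  with fin show "integrable M (\<lambda>x. \<integral>i. b i * (\<zeta> i x)\<^sup>2 \<partial>count_space I)"
    by (intro integrableI_nonneg borel_measurable_integral_count_space AE_I2 integral_nonneg_AE)
       (auto simp: nonneg intro!: AE_I2)
qed

lemma AE_summable: "AE x in M. integrable (count_space I) (\<lambda>i. b i * \<zeta> i x)"
  using AE_weighted_squares
proof eventually_elim
  case (elim x)
  show ?case
  proof (rule Bochner_Integration.integrable_bound[OF Bochner_Integration.integrable_add[OF summable elim]])
    have "\<bar>y\<bar> \<le> 1 + y\<^sup>2" for y :: real
      using zero_le_power2[of "\<bar>y\<bar> - 1/2"] by (simp add: power2_eq_square algebra_simps)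
    then have "b i * \<bar>\<zeta> i x\<bar> \<le> b i + b i * (\<zeta> i x)\<^sup>2" if "i \<in> I" for i
      using mult_left_mono[OF _ nonneg[OF that], of "\<bar>\<zeta> i x\<bar>" "1 + (\<zeta> i x)\<^sup>2"] by (simp add: algebra_simps)
    then show "AE i in count_space I. norm (b i * \<zeta> i x) \<le> norm (b i + b i * (\<zeta> i x)\<^sup>2)"
      by (intro AE_I2) (auto simp: abs_mult nonneg)
  qed auto
qed

text \<open>\<open>a\<close> stands for a quantity already known when the terms are drawn. Centred
  independent terms are orthogonal, so only the diagonal survives.\<close>

lemma finite_sum_moment:
  assumes F: "finite F" "F \<subseteq> I"
  shows "expectation (\<lambda>x. (a + (\<Sum>i\<in>F. b i * \<zeta> i x))\<^sup>2) = a\<^sup>2 + s * (\<Sum>i\<in>F. (b i)\<^sup>2)"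
    and "integrable M (\<lambda>x. (a + (\<Sum>i\<in>F. b i * \<zeta> i x))\<^sup>2)"
proof -
  have prod: "integrable M (\<lambda>x. \<zeta> i x * \<zeta> j x) \<and>
      expectation (\<lambda>x. \<zeta> i x * \<zeta> j x) = (if i = j then s else 0)" if "i \<in> I" "j \<in> I" for i j
  proof (cases "i = j")
    case True
    then show ?thesis using that square_integrable[of i] second_moment[of i] by (simp add: power2_eq_square)
  next
    case False
    have iv: "indep_vars (\<lambda>_. borel) \<zeta> {i, j}"
      by (rule indep_vars_subset[OF indep]) (use that in auto)
    have "integrable M (\<lambda>x. \<Prod>k\<in>{i,j}. \<zeta> k x)"
      by (rule indep_vars_integrable[OF _ iv]) (use that integrable_terms in auto)
    moreover have "expectation (\<lambda>x. \<Prod>k\<in>{i,j}. \<zeta> k x) = (\<Prod>k\<in>{i,j}. expectation (\<zeta> k))"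
      by (rule indep_vars_lebesgue_integral[OF _ iv]) (use that integrable_terms in auto)
    ultimately show ?thesis using False that mean_zero by simp
  qed
  have eq: "(a + (\<Sum>i\<in>F. b i * \<zeta> i x))\<^sup>2 =
      a\<^sup>2 + (\<Sum>i\<in>F. 2 * a * b i * \<zeta> i x) + (\<Sum>i\<in>F. \<Sum>j\<in>F. (b i * b j) * (\<zeta> i x * \<zeta> j x))" for x
    by (simp add: power2_eq_square algebra_simps sum_product sum_distrib_left)
  have i1: "integrable M (\<lambda>x. \<Sum>i\<in>F. 2 * a * b i * \<zeta> i x)"
    using F integrable_terms by (intro Bochner_Integration.integrable_sum) auto
  have i2: "integrable M (\<lambda>x. \<Sum>i\<in>F. \<Sum>j\<in>F. (b i * b j) * (\<zeta> i x * \<zeta> j x))"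
    using F prod by (intro Bochner_Integration.integrable_sum integrable_mult_right) auto
  show "integrable M (\<lambda>x. (a + (\<Sum>i\<in>F. b i * \<zeta> i x))\<^sup>2)"
    unfolding eq using i1 i2 by (intro Bochner_Integration.integrable_add) auto
  have e1: "expectation (\<lambda>x. \<Sum>i\<in>F. 2 * a * b i * \<zeta> i x) = 0"
    using F integrable_terms mean_zero by (subst Bochner_Integration.integral_sum) (auto intro!: sum.neutral)
  have "expectation (\<lambda>x. \<Sum>i\<in>F. \<Sum>j\<in>F. (b i * b j) * (\<zeta> i x * \<zeta> j x))
      = (\<Sum>i\<in>F. expectation (\<lambda>x. \<Sum>j\<in>F. (b i * b j) * (\<zeta> i x * \<zeta> j x)))"
    using F prod by (intro Bochner_Integration.integral_sum Bochner_Integration.integrable_sum integrable_mult_right) auto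
  also have "\<dots> = (\<Sum>i\<in>F. \<Sum>j\<in>F. expectation (\<lambda>x. (b i * b j) * (\<zeta> i x * \<zeta> j x)))"
    using F prod by (intro sum.cong refl Bochner_Integration.integral_sum integrable_mult_right) auto
  also have "\<dots> = (\<Sum>i\<in>F. \<Sum>j\<in>F. if i = j then s * (b i)\<^sup>2 else 0)"
    using F prod by (intro sum.cong refl) (auto simp: subset_eq power2_eq_square)
  also have "\<dots> = s * (\<Sum>i\<in>F. (b i)\<^sup>2)"
    using F by (simp add: sum_distrib_left)
  finally have e2: "expectation (\<lambda>x. \<Sum>i\<in>F. \<Sum>j\<in>F. (b i * b j) * (\<zeta> i x * \<zeta> j x)) = s * (\<Sum>i\<in>F. (b i)\<^sup>2)" .
  show "expectation (\<lambda>x. (a + (\<Sum>i\<in>F. b i * \<zeta> i x))\<^sup>2) = a\<^sup>2 + s * (\<Sum>i\<in>F. (b i)\<^sup>2)"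
    unfolding eq using i1 i2 by (simp add: e1 e2 prob_space)
qed

lemma total_moment:
  shows "expectation (\<lambda>x. (a + (\<integral>i. b i * \<zeta> i x \<partial>count_space I))\<^sup>2) = a\<^sup>2 + s * (\<integral>i. (b i)\<^sup>2 \<partial>count_space I)"
    and "integrable M (\<lambda>x. (a + (\<integral>i. b i * \<zeta> i x \<partial>count_space I))\<^sup>2)"
proof -
  let ?F = "initial I"
  let ?w = "\<lambda>x. 2 * a\<^sup>2 + 2 * ((\<integral>i. b i \<partial>count_space I) * (\<integral>i. b i * (\<zeta> i x)\<^sup>2 \<partial>count_space I))"
  have lim: "AE x in M. (\<lambda>n. (a + (\<Sum>i\<in>?F n. b i * \<zeta> i x))\<^sup>2) \<longlonglongrightarrow> (a + (\<integral>i. b i * \<zeta> i x \<partial>count_space I))\<^sup>2"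
    using AE_summable by eventually_elim (intro tendsto_intros integral_count_space_tendsto)
  have w: "integrable M ?w"
    using integrable_weighted_squares by simp
  have dom: "AE x in M. norm ((a + (\<Sum>i\<in>?F n. b i * \<zeta> i x))\<^sup>2) \<le> ?w x" for n
    using AE_weighted_squares
  proof eventually_elim
    case (elim x)
    \<comment> \<open>Splitting \<open>b i\<close> into two square roots makes Cauchy-Schwarz return
      the two sums that are known to converge, that of \<open>b i\<close> and that of
      \<open>b i * (\<zeta> i x)\<^sup>2\<close>.\<close>
    have "(\<Sum>i\<in>?F n. b i * \<zeta> i x) = (\<Sum>i\<in>?F n. sqrt (b i) * (sqrt (b i) * \<zeta> i x))"
      using nonneg by (intro sum.cong) (auto simp: initial_def simp flip: mult.assoc)
    then have "(\<Sum>i\<in>?F n. b i * \<zeta> i x)\<^sup>2 \<le> (\<Sum>i\<in>?F n. (sqrt (b i))\<^sup>2) * (\<Sum>i\<in>?F n. (sqrt (b i) * \<zeta> i x)\<^sup>2)"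
      using Cauchy_Schwarz_ineq_sum[of "\<lambda>i. sqrt (b i)" "\<lambda>i. sqrt (b i) * \<zeta> i x" "?F n"] by simp
    also have "\<dots> = (\<Sum>i\<in>?F n. b i) * (\<Sum>i\<in>?F n. b i * (\<zeta> i x)\<^sup>2)"
      using nonneg by (intro arg_cong2[where f="(*)"] sum.cong) (auto simp: initial_def power_mult_distrib)
    also have "\<dots> \<le> (\<integral>i. b i \<partial>count_space I) * (\<integral>i. b i * (\<zeta> i x)\<^sup>2 \<partial>count_space I)"
      using nonneg by (intro mult_mono sum_initial_le summable elim sum_nonneg integral_nonneg_AE AE_I2)
        (auto simp: initial_def)
    finally have "(\<Sum>i\<in>?F n. b i * \<zeta> i x)\<^sup>2 \<le> (\<integral>i. b i \<partial>count_space I) * (\<integral>i. b i * (\<zeta> i x)\<^sup>2 \<partial>count_space I)" .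
    moreover have "(a + y)\<^sup>2 \<le> 2 * a\<^sup>2 + 2 * y\<^sup>2" for y
      using zero_le_power2[of "a - y"] by (simp add: power2_eq_square algebra_simps)
    ultimately show ?case by (smt (verit) real_norm_def zero_le_power2)
  qed
  have m: "(\<lambda>x. (a + (\<Sum>i\<in>?F n. b i * \<zeta> i x))\<^sup>2) \<in> borel_measurable M" for n
    using finite_sum_moment(2)[OF finite_initial initial_subset] by (rule borel_measurable_integrable)
  have mt: "(\<lambda>x. (a + (\<integral>i. b i * \<zeta> i x \<partial>count_space I))\<^sup>2) \<in> borel_measurable M" by measurable
  show "integrable M (\<lambda>x. (a + (\<integral>i. b i * \<zeta> i x \<partial>count_space I))\<^sup>2)"
    by (rule integrable_dominated_convergence[OF mt m w lim dom])
  have "(\<lambda>n. expectation (\<lambda>x. (a + (\<Sum>i\<in>?F n. b i * \<zeta> i x))\<^sup>2)) \<longlonglongrightarrow>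
      expectation (\<lambda>x. (a + (\<integral>i. b i * \<zeta> i x \<partial>count_space I))\<^sup>2)"
    by (rule integral_dominated_convergence[OF mt m w lim dom])
  moreover have "(\<lambda>n. expectation (\<lambda>x. (a + (\<Sum>i\<in>?F n. b i * \<zeta> i x))\<^sup>2)) \<longlonglongrightarrow>
      a\<^sup>2 + s * (\<integral>i. (b i)\<^sup>2 \<partial>count_space I)"
    unfolding finite_sum_moment(1)[OF finite_initial initial_subset]
    by (intro tendsto_intros integral_count_space_tendsto integrable_count_space_square summable nonneg)
  ultimately show "expectation (\<lambda>x. (a + (\<integral>i. b i * \<zeta> i x \<partial>count_space I))\<^sup>2) = a\<^sup>2 + s * (\<integral>i. (b i)\<^sup>2 \<partial>count_space I)"
    by (rule LIMSEQ_unique)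
qed

end

text \<open>Two errors, each divided by \<open>t\<^sup>2\<close>: the Taylor remainder of the
  characteristic function, truncated so that a second moment suffices, and the distance from
  \<open>1 - y\<close> to \<open>exp (- y)\<close> at \<open>y = s * t\<^sup>2 / 2\<close>, which is
  at most \<open>y\<^sup>2 / 2\<close> and yields the 8.\<close>

definition char_remainder :: "real measure \<Rightarrow> real \<Rightarrow> real \<Rightarrow> real" where
  "char_remainder D s t = (\<integral>x. min (6 * x\<^sup>2) (\<bar>t\<bar> * \<bar>x\<bar> ^ 3) \<partial>D) / 6 + s\<^sup>2 * t\<^sup>2 / 8"

lemma (in real_distribution) char_gaussian_approx:
  assumes "integrable M (\<lambda>x. x)" "expectation (\<lambda>x. x) = 0" "integrable M (\<lambda>x. x\<^sup>2)"
    and s: "expectation (\<lambda>x. x\<^sup>2) = s"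
  shows "cmod (char M t - exp (- (s * t\<^sup>2 / 2))) \<le> t\<^sup>2 * char_remainder M s t"
proof -
  have s0: "0 \<le> s" unfolding s[symmetric] by (rule integral_nonneg_AE) simp
  have var: "variance (\<lambda>x. x) = s" using assms by simp
  have "cmod (char M t - (1 - t\<^sup>2 * s / 2)) \<le> (t\<^sup>2 / 6) * expectation (\<lambda>x. min (6 * x\<^sup>2) (\<bar>t\<bar> * \<bar>x\<bar> ^ 3))"
    using assms var by (intro char_approx3) auto
  moreover have "\<bar>(1 - y) - exp (- y)\<bar> \<le> y\<^sup>2 / 2" if "0 \<le> y" for y :: real
  proof -
    have "1 - y \<le> exp (- y)" using exp_ge_add_one_self[of "- y"] by simp
    moreover have "exp (- y) \<le> 1 - y + y\<^sup>2 / 2"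
    proof -
      have "DERIV (\<lambda>y. 1 - y + y\<^sup>2 / 2 - exp (- y)) z :> - 1 + z + exp (- z)" for z :: real
        by (auto intro!: derivative_eq_intros)
      moreover have "- 1 + z + exp (- z) \<ge> 0" for z :: real
        using exp_ge_add_one_self[of "- z"] by simp
      ultimately have "1 - 0 + 0\<^sup>2 / 2 - exp (- 0) \<le> 1 - y + y\<^sup>2 / 2 - exp (- y)"
        by (intro DERIV_nonneg_imp_nondecreasing[OF that]) blast
      then show ?thesis by simp
    qed
    ultimately show ?thesis by (simp add: abs_le_iff)
  qed
  from this[of "s * t\<^sup>2 / 2"] have "cmod (complex_of_real (1 - t\<^sup>2 * s / 2) - complex_of_real (exp (- (s * t\<^sup>2 / 2)))) \<le> (s * t\<^sup>2 / 2)\<^sup>2 / 2"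
    using s0 unfolding of_real_diff[symmetric] norm_of_real by (simp add: mult.commute)
  ultimately have "cmod (char M t - exp (- (s * t\<^sup>2 / 2))) \<le>
      (t\<^sup>2 / 6) * expectation (\<lambda>x. min (6 * x\<^sup>2) (\<bar>t\<bar> * \<bar>x\<bar> ^ 3)) + (s * t\<^sup>2 / 2)\<^sup>2 / 2"
    using norm_triangle_ineq[of "char M t - (1 - t\<^sup>2 * s / 2)" "complex_of_real (1 - t\<^sup>2 * s / 2) - complex_of_real (exp (- (s * t\<^sup>2 / 2)))"]
    by simp
  also have "\<dots> = t\<^sup>2 * char_remainder M s t"
    by (simp add: char_remainder_def field_simps power2_eq_square)
  finally show ?thesis .
qed

lemma (in real_distribution) char_remainder_mono:
  assumes "integrable M (\<lambda>x. x\<^sup>2)" "0 \<le> t" "t \<le> t'"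
  shows "char_remainder M s t \<le> char_remainder M s t'"
proof -
  have i: "integrable M (\<lambda>x. min (6 * x\<^sup>2) (\<bar>t\<bar> * \<bar>x\<bar> ^ 3))" for t
    by (rule Bochner_Integration.integrable_bound[where f="\<lambda>x. 6 * x\<^sup>2"]) (use assms(1) in \<open>auto simp: min_def\<close>)
  have "expectation (\<lambda>x. min (6 * x\<^sup>2) (\<bar>t\<bar> * \<bar>x\<bar> ^ 3)) \<le> expectation (\<lambda>x. min (6 * x\<^sup>2) (\<bar>t'\<bar> * \<bar>x\<bar> ^ 3))"
    by (intro integral_mono i min.mono mult_right_mono) (use assms in auto)
  moreover have "s\<^sup>2 * t\<^sup>2 \<le> s\<^sup>2 * t'\<^sup>2"
    by (intro mult_left_mono power_mono) (use assms in auto)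
  ultimately show ?thesis by (simp add: char_remainder_def)
qed

lemma (in real_distribution) char_remainder_tendsto_0:
  assumes "integrable M (\<lambda>x. x\<^sup>2)" and t: "t \<longlonglongrightarrow> 0"
  shows "(\<lambda>n. char_remainder M s (t n)) \<longlonglongrightarrow> 0"
proof -
  have "(\<lambda>n. expectation (\<lambda>x. min (6 * x\<^sup>2) (\<bar>t n\<bar> * \<bar>x\<bar> ^ 3))) \<longlonglongrightarrow> expectation (\<lambda>x. 0)"
  proof (rule integral_dominated_convergence[where w="\<lambda>x. 6 * x\<^sup>2"])
    show "AE x in M. (\<lambda>n. min (6 * x\<^sup>2) (\<bar>t n\<bar> * \<bar>x\<bar> ^ 3)) \<longlonglongrightarrow> 0"
    proof (rule AE_I2)
      fix x
      have "(\<lambda>n. min (6 * x\<^sup>2) (\<bar>t n\<bar> * \<bar>x\<bar> ^ 3)) \<longlonglongrightarrow> min (6 * x\<^sup>2) (\<bar>0\<bar> * \<bar>x\<bar> ^ 3)"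
        by (intro tendsto_intros t)
      then show "(\<lambda>n. min (6 * x\<^sup>2) (\<bar>t n\<bar> * \<bar>x\<bar> ^ 3)) \<longlonglongrightarrow> 0" by simp
    qed
  qed (use assms in \<open>auto simp: min_def\<close>)
  then have "(\<lambda>n. char_remainder M s (t n)) \<longlonglongrightarrow> expectation (\<lambda>x. 0) / 6 + s\<^sup>2 * 0\<^sup>2 / 8"
    unfolding char_remainder_def by (intro tendsto_intros t) auto
  then show ?thesis by simp
qed

text \<open>All factors have modulus at most 1, so the difference of the two products is at most the
  sum of the differences of factors. The remainder increases with its argument; evaluating it at the
  bound \<open>\<beta>\<close> leaves the sum of squared coefficients as a common factor.\<close>

lemma (in weighted_sum) char_total_approx:
  assumes law: "\<And>i. i \<in> I \<Longrightarrow> distr M borel (\<zeta> i) = D"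
    and le: "\<And>i. i \<in> I \<Longrightarrow> b i \<le> \<beta>"
  shows "cmod ((CLINT x|M. iexp (\<integral>i. b i * \<zeta> i x \<partial>count_space I)) - exp (- (s * (\<integral>i. (b i)\<^sup>2 \<partial>count_space I) / 2)))
    \<le> (\<integral>i. (b i)\<^sup>2 \<partial>count_space I) * char_remainder D s \<beta>"
\<comment> \<open>For empty \<open>I\<close> nothing is known about \<open>D\<close>, but both sides
  vanish.\<close>
proof (cases "I = {}")
  case True
  then show ?thesis by (simp add: lebesgue_integral_count_space_finite prob_space)
next
  case False
  then obtain i0 where i0: "i0 \<in> I" by auto
  have D: "D = distr M borel (\<zeta> i0)" using law[OF i0] by simp
  interpret D: real_distribution D
    unfolding D by (rule real_distribution_distr) (use i0 in auto)
  have D2: "integrable D (\<lambda>x. x\<^sup>2)"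
    unfolding D using i0 square_integrable[OF i0] by (simp add: integrable_distr_eq)
  have Dm: "integrable D (\<lambda>x. x)" "D.expectation (\<lambda>x. x) = 0" "D.expectation (\<lambda>x. x\<^sup>2) = s"
    unfolding D using i0 integrable_terms[OF i0] mean_zero[OF i0] second_moment[OF i0]
    by (simp_all add: integrable_distr_eq integral_distr)
  let ?F = "initial I" and ?e = "\<lambda>i. complex_of_real (exp (- (s * (b i)\<^sup>2 / 2)))"
  have s0: "0 \<le> s" unfolding Dm(3)[symmetric] by (rule integral_nonneg_AE) simp
  have fin: "cmod ((CLINT x|M. iexp (\<Sum>i\<in>?F n. b i * \<zeta> i x)) - exp (- (s * (\<Sum>i\<in>?F n. (b i)\<^sup>2) / 2)))
    \<le> (\<Sum>i\<in>?F n. (b i)\<^sup>2) * char_remainder D s \<beta>" for n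
  proof -
    have iv: "indep_vars (\<lambda>_. borel) (\<lambda>i x. b i * \<zeta> i x) (?F n)"
      by (rule indep_vars_compose2[where X=\<zeta> and M'="\<lambda>_. borel"]) (auto intro: indep_vars_subset[OF indep initial_subset])
    have "(CLINT x|M. iexp (\<Sum>i\<in>?F n. b i * \<zeta> i x)) = char (distr M borel (\<lambda>x. \<Sum>i\<in>?F n. b i * \<zeta> i x)) 1"
      unfolding char_def by (subst integral_distr) (auto simp: initial_def)
    also have "\<dots> = (\<Prod>i\<in>?F n. char (distr M borel (\<lambda>x. b i * \<zeta> i x)) 1)"
      by (rule char_distr_sum[OF iv])
    also have "\<dots> = (\<Prod>i\<in>?F n. char D (b i))"
    proof (intro prod.cong refl)
      fix i assume "i \<in> ?F n"
      then have i: "i \<in> I" by (auto simp: initial_def)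
      show "char (distr M borel (\<lambda>x. b i * \<zeta> i x)) 1 = char D (b i)"
        unfolding law[OF i, symmetric] char_def using i by (simp add: integral_distr)
    qed
    finally have e1: "(CLINT x|M. iexp (\<Sum>i\<in>?F n. b i * \<zeta> i x)) = (\<Prod>i\<in>?F n. char D (b i))" .
    have e2: "exp (- (s * (\<Sum>i\<in>?F n. (b i)\<^sup>2) / 2)) = (\<Prod>i\<in>?F n. exp (- (s * (b i)\<^sup>2 / 2)))"
      by (simp add: exp_sum[symmetric] sum_negf sum_distrib_left sum_divide_distrib)
    have "cmod ((\<Prod>i\<in>?F n. char D (b i)) - (\<Prod>i\<in>?F n. ?e i)) \<le> (\<Sum>i\<in>?F n. cmod (char D (b i) - ?e i))"
      using s0 by (intro norm_prod_diff D.cmod_char_le_1) (simp add: norm_of_real del: of_real_exp)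
    also have "\<dots> \<le> (\<Sum>i\<in>?F n. (b i)\<^sup>2 * char_remainder D s \<beta>)"
    proof (intro sum_mono)
      fix i assume "i \<in> ?F n"
      then have i: "i \<in> I" by (auto simp: initial_def)
      have "cmod (char D (b i) - ?e i) \<le> (b i)\<^sup>2 * char_remainder D s (b i)"
        using D.char_gaussian_approx[OF Dm(1,2) D2 Dm(3), of "b i"] by simp
      also have "\<dots> \<le> (b i)\<^sup>2 * char_remainder D s \<beta>"
        using D.char_remainder_mono[OF D2 nonneg[OF i] le[OF i]] by (intro mult_left_mono) auto
      finally show "cmod (char D (b i) - ?e i) \<le> (b i)\<^sup>2 * char_remainder D s \<beta>" .
    qed
    finally show ?thesis unfolding e1 e2 by (simp add: sum_distrib_right)
  qed
  have l1: "(\<lambda>n. CLINT x|M. iexp (\<Sum>i\<in>?F n. b i * \<zeta> i x)) \<longlonglongrightarrow> (CLINT x|M. iexp (\<integral>i. b i * \<zeta> i x \<partial>count_space I))"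
  proof (rule integral_dominated_convergence[where w="\<lambda>_. 1"])
    show "AE x in M. (\<lambda>n. iexp (\<Sum>i\<in>?F n. b i * \<zeta> i x)) \<longlonglongrightarrow> iexp (\<integral>i. b i * \<zeta> i x \<partial>count_space I)"
      using AE_summable by eventually_elim (intro tendsto_intros integral_count_space_tendsto)
    show "(\<lambda>x. iexp (\<Sum>i\<in>?F n. b i * \<zeta> i x)) \<in> borel_measurable M" for n
    proof -
      have [measurable]: "(\<lambda>x. \<Sum>i\<in>?F n. b i * \<zeta> i x) \<in> borel_measurable M"
        by (intro borel_measurable_sum borel_measurable_times) (auto simp: initial_def)
      show ?thesis by measurable
    qed
  qed auto
  have b2: "(\<lambda>n. \<Sum>i\<in>?F n. (b i)\<^sup>2) \<longlonglongrightarrow> (\<integral>i. (b i)\<^sup>2 \<partial>count_space I)"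
    by (intro integral_count_space_tendsto integrable_count_space_square summable nonneg)
  show ?thesis
  proof (rule LIMSEQ_le)
    show "(\<lambda>n. cmod ((CLINT x|M. iexp (\<Sum>i\<in>?F n. b i * \<zeta> i x)) - exp (- (s * (\<Sum>i\<in>?F n. (b i)\<^sup>2) / 2)))) \<longlonglongrightarrow>
      cmod ((CLINT x|M. iexp (\<integral>i. b i * \<zeta> i x \<partial>count_space I)) - exp (- (s * (\<integral>i. (b i)\<^sup>2 \<partial>count_space I) / 2)))"
      by (intro tendsto_intros l1 b2) simp
    show "(\<lambda>n. (\<Sum>i\<in>?F n. (b i)\<^sup>2) * char_remainder D s \<beta>) \<longlonglongrightarrow> (\<integral>i. (b i)\<^sup>2 \<partial>count_space I) * char_remainder D s \<beta>"
      by (intro tendsto_intros b2)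
  qed (use fin in auto)
qed

text \<open>By Jensen's inequality every factor
  \<open>exp (p i) * expectation (\<lambda>x. exp (- (p i * X i x)))\<close> is at least 1, so all
  factors outside \<open>J\<close> may be dropped. Empty \<open>J\<close> gives the submartingale
  inequality; a singleton keeps the gain of one chosen index.\<close>

lemma (in prob_space) laplace_weighted_sum_ge:
  fixes I :: "'i::countable set" and X :: "'i \<Rightarrow> 'a \<Rightarrow> real"
  assumes indep: "indep_vars (\<lambda>_. borel) X I"
    and X0: "\<And>i x. i \<in> I \<Longrightarrow> 0 \<le> X i x" and int: "\<And>i. i \<in> I \<Longrightarrow> integrable M (X i)"
    and mean: "\<And>i. i \<in> I \<Longrightarrow> expectation (X i) = 1"
    and p0: "\<And>i. i \<in> I \<Longrightarrow> 0 \<le> p i" and p: "integrable (count_space I) p"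
    and J: "J \<subseteq> I" "finite J"
  shows "(\<Prod>j\<in>J. exp (p j) * expectation (\<lambda>x. exp (- (p j * X j x)))) * exp (- (\<integral>i. p i \<partial>count_space I))
    \<le> expectation (\<lambda>x. exp (- (\<integral>i. p i * X i x \<partial>count_space I)))"
proof -
  let ?F = "initial I" and ?f = "\<lambda>i. exp (p i) * expectation (\<lambda>x. exp (- (p i * X i x)))"
  have meas[measurable (raw)]: "i \<in> I \<Longrightarrow> X i \<in> borel_measurable M" for i
    using int by auto
  have lam: "integrable M (\<lambda>x. exp (- (p i * X i x)))" if "i \<in> I" for i
    by (rule integrable_const_bound[where B=1]) (use that p0 X0 in auto)
  have jensen: "1 \<le> ?f i" if i: "i \<in> I" for i
  proof -
    \<comment> \<open>Jensen's inequality, by integrating the tangent line of the exponential at the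
      mean 1.\<close>
    have "expectation (\<lambda>x. exp (- p i) * (1 - p i * (X i x - 1))) \<le> expectation (\<lambda>x. exp (- (p i * X i x)))"
    proof (intro integral_mono lam i)
      fix x
      have "exp (- p i) * (1 + (- (p i * (X i x - 1)))) \<le> exp (- p i) * exp (- (p i * (X i x - 1)))"
        by (intro mult_left_mono exp_ge_add_one_self) auto
      then show "exp (- p i) * (1 - p i * (X i x - 1)) \<le> exp (- (p i * X i x))"
        by (simp add: exp_add[symmetric] algebra_simps)
    qed (use int i in auto)
    moreover have "expectation (\<lambda>x. exp (- p i) * (1 - p i * (X i x - 1))) = exp (- p i)"
      using int[OF i] mean[OF i] by (simp add: prob_space)
    ultimately show ?thesis by (simp add: exp_minus field_simps)
  qed
  have step: "(\<Prod>j\<in>J. ?f j) * exp (- (\<Sum>i\<in>?F n. p i)) \<le> expectation (\<lambda>x. exp (- (\<Sum>i\<in>?F n. p i * X i x)))"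
    if n: "J \<subseteq> ?F n" for n
  proof -
    have iv: "indep_vars (\<lambda>_. borel) (\<lambda>i x. exp (- (p i * X i x))) (?F n)"
      by (rule indep_vars_compose2[where X=X and M'="\<lambda>_. borel"]) (auto intro: indep_vars_subset[OF indep initial_subset])
    have "expectation (\<lambda>x. exp (- (\<Sum>i\<in>?F n. p i * X i x))) = expectation (\<lambda>x. \<Prod>i\<in>?F n. exp (- (p i * X i x)))"
      by (simp add: exp_sum[symmetric] sum_negf)
    also have "\<dots> = (\<Prod>i\<in>?F n. expectation (\<lambda>x. exp (- (p i * X i x))))"
      by (rule indep_vars_lebesgue_integral[OF finite_initial iv]) (auto intro!: lam simp: initial_def)
    also have "\<dots> = (\<Prod>i\<in>?F n. exp (- p i) * ?f i)"
      by (simp add: exp_minus field_simps)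
    also have "\<dots> = (\<Prod>i\<in>?F n. ?f i) * exp (- (\<Sum>i\<in>?F n. p i))"
      by (simp add: prod.distrib exp_sum[symmetric] sum_negf mult.commute)
    finally have eq: "expectation (\<lambda>x. exp (- (\<Sum>i\<in>?F n. p i * X i x))) = (\<Prod>i\<in>?F n. ?f i) * exp (- (\<Sum>i\<in>?F n. p i))" .
    have "(\<Prod>j\<in>J. ?f j) \<le> (\<Prod>i\<in>?F n. ?f i)"
    proof (rule prod_mono2)
      show "1 \<le> ?f i" if "i \<in> ?F n - J" for i using jensen that by (auto simp: initial_def)
      show "0 \<le> ?f i" if "i \<in> J" for i using jensen[of i] that J by auto
    qed (use n in auto)
    then show ?thesis unfolding eq by (intro mult_right_mono) auto
  qed
  have "AE x in M. integrable (count_space I) (\<lambda>i. p i * X i x)"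
  proof -
    have "(\<integral>\<^sup>+x. \<integral>\<^sup>+i. ennreal (p i * X i x) \<partial>count_space I \<partial>M)
        = (\<integral>\<^sup>+i. \<integral>\<^sup>+x. ennreal (p i * X i x) \<partial>M \<partial>count_space I)"
      by (intro nn_integral_count_space_nn_integral) auto
    also have "\<dots> = (\<integral>\<^sup>+i. ennreal (p i) \<partial>count_space I)"
      using int mean p0 X0 by (intro nn_integral_cong) (auto simp: nn_integral_eq_integral)
    also have "\<dots> < \<infinity>"
      using integrableD(2)[OF p] by (simp add: less_top)
    finally have "AE x in M. (\<integral>\<^sup>+i. ennreal (p i * X i x) \<partial>count_space I) \<noteq> \<infinity>"
      by (intro nn_integral_PInf_AE borel_measurable_nn_integral_count_space) auto
    then show ?thesis
      by eventually_elim (auto simp: p0 X0 less_top intro!: integrableI_nonneg AE_I2)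
  qed
  then have "AE x in M. (\<lambda>n. exp (- (\<Sum>i\<in>?F n. p i * X i x))) \<longlonglongrightarrow> exp (- (\<integral>i. p i * X i x \<partial>count_space I))"
    by eventually_elim (intro tendsto_intros integral_count_space_tendsto)
  then have "(\<lambda>n. expectation (\<lambda>x. exp (- (\<Sum>i\<in>?F n. p i * X i x)))) \<longlonglongrightarrow> expectation (\<lambda>x. exp (- (\<integral>i. p i * X i x \<partial>count_space I)))"
  proof (intro integral_dominated_convergence[where w="\<lambda>_. 1"])
    show "(\<lambda>x. exp (- (\<Sum>i\<in>?F n. p i * X i x))) \<in> borel_measurable M" for n
    proof -
      have [measurable]: "(\<lambda>x. \<Sum>i\<in>?F n. p i * X i x) \<in> borel_measurable M"
        by (intro borel_measurable_sum borel_measurable_times) (auto simp: initial_def)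
      show ?thesis by measurable
    qed
    have [measurable]: "(\<lambda>x. \<integral>i. p i * X i x \<partial>count_space I) \<in> borel_measurable M"
      by (intro borel_measurable_integral_count_space) auto
    show "(\<lambda>x. exp (- (\<integral>i. p i * X i x \<partial>count_space I))) \<in> borel_measurable M" by measurable
    show "AE x in M. norm (exp (- (\<Sum>i\<in>?F n. p i * X i x))) \<le> 1" for n
      using p0 X0 by (auto intro!: sum_nonneg simp: initial_def)
  qed auto
  moreover have "(\<lambda>n. (\<Prod>j\<in>J. ?f j) * exp (- (\<Sum>i\<in>?F n. p i))) \<longlonglongrightarrow> (\<Prod>j\<in>J. ?f j) * exp (- (\<integral>i. p i \<partial>count_space I))"
    by (intro tendsto_intros integral_count_space_tendsto p)
  moreover have "\<exists>n0. \<forall>n\<ge>n0. (\<Prod>j\<in>J. ?f j) * exp (- (\<Sum>i\<in>?F n. p i)) \<le> expectation (\<lambda>x. exp (- (\<Sum>i\<in>?F n. p i * X i x)))"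
  proof (intro exI[of _ "Suc (Max (insert 0 (to_nat ` J)))"] allI impI step subsetI)
    fix n j assume "Suc (Max (insert 0 (to_nat ` J))) \<le> n" "j \<in> J"
    moreover have "to_nat j \<le> Max (insert 0 (to_nat ` J))" using \<open>j \<in> J\<close> J by (intro Max_ge) auto
    ultimately have "to_nat j < n" by linarith
    then show "j \<in> ?F n" using J \<open>j \<in> J\<close> by (auto simp: initial_def)
  qed
  ultimately show ?thesis by (intro LIMSEQ_le) auto
qed

section \<open>Uniqueness of conditional laws\<close>

text \<open>Finite intersections of a countable base. A conditional probability is fixed for each
  event only up to a null set; countability keeps the union of these null sets null, and stability
  under intersections makes the events determine a measure.\<close>

lemma countable_Int_stable_generator:
  "\<exists>E :: 'e::second_countable_topology set set.
     countable E \<and> Int_stable E \<and> UNIV \<in> E \<and> E \<subseteq> sets borel \<and> sets borel = sigma_sets UNIV E"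
proof -
  obtain B :: "'e set set" where B: "countable B" "topological_basis B"
    using ex_countable_basis by blast
  let ?E = "{\<Inter>F | F. finite F \<and> F \<subseteq> B}"
  have cnt: "countable ?E"
  proof -
    have "?E = Inter ` {F. finite F \<and> F \<subseteq> B}" by auto
    then show ?thesis using countable_Collect_finite_subset[OF B(1)] by simp
  qed
  have sB: "sets borel = sigma_sets UNIV B"
    by (subst borel_eq_countable_basis[OF B]) (simp add: sets_measure_of)
  have sub: "?E \<subseteq> sets borel"
  proof safe
    fix F assume F: "finite F" "F \<subseteq> B"
    show "\<Inter>F \<in> sets borel"
      using F topological_basis_open[OF B(2)] by (intro borel_open open_Inter) auto
  qed
  have "Int_stable ?E"
  proof (rule Int_stableI)
    fix a b assume "a \<in> ?E" "b \<in> ?E"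
    then obtain F G where "a = \<Inter>F" "finite F" "F \<subseteq> B" "b = \<Inter>G" "finite G" "G \<subseteq> B" by auto
    then show "a \<inter> b \<in> ?E" by (intro CollectI exI[of _ "F \<union> G"]) auto
  qed
  moreover have "UNIV \<in> ?E" by (intro CollectI exI[of _ "{}"]) auto
  moreover have "sets borel = sigma_sets UNIV ?E"
  proof
    have "B \<subseteq> ?E"
    proof
      fix b assume "b \<in> B" then show "b \<in> ?E" by (intro CollectI exI[of _ "{b}"]) auto
    qed
    then show "sets borel \<subseteq> sigma_sets UNIV ?E"
      unfolding sB by (rule sigma_sets_mono')
    show "sigma_sets UNIV ?E \<subseteq> sets borel"
      using sub sets.sigma_sets_subset[of ?E borel] by simp
  qed
  ultimately show ?thesis using cnt sub by blast
qed

text \<open>On each generating event both kernels are versions of the same conditional expectation.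
  This allows an unspecified conditional law to be replaced by an explicit one.\<close>

lemma conditional_law_unique:
  fixes \<xi> :: "'w \<Rightarrow> 'e::polish_space"
  assumes "prob_space M" and G: "subalgebra M G" and \<xi>: "\<xi> \<in> borel_measurable M"
    and L: "is_conditional_law M G \<xi> L" and K: "is_conditional_law M G \<xi> K"
  shows "AE \<omega> in M. L \<omega> = K \<omega>"
proof -
  interpret prob_space M by fact
  interpret G: finite_measure_subalgebra M G
    using G by unfold_locales
  have spG: "space G = space M" using G by (simp add: subalgebra_def)
  obtain E :: "'e set set" where E: "countable E" "Int_stable E" "UNIV \<in> E" "E \<subseteq> sets borel"
     "sets borel = sigma_sets UNIV E"
    using countable_Int_stable_generator by blast
  have sL: "sets (L \<omega>) = sets borel" "prob_space (L \<omega>)" if "is_conditional_law M G \<xi> L" "\<omega> \<in> space M" for \<omega> L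
    using measurable_space[of L G "prob_algebra borel" \<omega>] that
    by (auto simp: is_conditional_law_def spG space_prob_algebra)
  have ver: "AE \<omega> in M. real_cond_exp M G (\<lambda>\<omega>. indicator B (\<xi> \<omega>)) \<omega> = measure (L \<omega>) B"
    if L: "is_conditional_law M G \<xi> L" and B: "B \<in> E" for L B
  proof (rule G.real_cond_exp_charact)
    have Bb: "B \<in> sets borel" using B E by auto
    have [measurable]: "L \<in> G \<rightarrow>\<^sub>M subprob_algebra borel"
      using L by (auto simp: is_conditional_law_def intro: measurable_prob_algebraD)
    show m: "(\<lambda>\<omega>. measure (L \<omega>) B) \<in> borel_measurable G"
      by (rule measurable_compose[OF _ measurable_measure_subprob_algebra[OF Bb]]) measurable
    have "(\<lambda>\<omega>. measure (L \<omega>) B) \<in> borel_measurable M"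
      using measurable_from_subalg[OF G m] .
    moreover have "measure (L \<omega>) B \<le> 1" if "\<omega> \<in> space M" for \<omega>
      using prob_space.prob_le_1[OF sL(2)[OF L that]] .
    ultimately show "integrable M (\<lambda>\<omega>. measure (L \<omega>) B)"
      by (intro integrable_const_bound[where B=1]) auto
    show "integrable M (\<lambda>\<omega>. indicator B (\<xi> \<omega>) :: real)"
      using Bb \<xi> by (intro integrable_const_bound[where B=1]) auto
    fix A assume A: "A \<in> sets G"
    have "(LINT \<omega>:A|M. indicator B (\<xi> \<omega>)) = (LINT \<omega>:A|M. (\<integral>x. indicat_real B x \<partial>L \<omega>))"
    proof -
      have "bounded (range (indicat_real B))" by (auto simp: bounded_iff indicator_def intro!: exI[of _ 1])
      moreover have "indicat_real B \<in> borel_measurable borel" using Bb by simp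
      ultimately show ?thesis using L A unfolding is_conditional_law_def by blast
    qed
    also have "\<dots> = (LINT \<omega>:A|M. measure (L \<omega>) B)"
      unfolding set_lebesgue_integral_def
      by (intro Bochner_Integration.integral_cong refl) (auto simp: sL[OF L] sets_eq_imp_space_eq[OF sL(1)[OF L]])
    finally show "(LINT \<omega>:A|M. indicator B (\<xi> \<omega>)) = (LINT \<omega>:A|M. measure (L \<omega>) B)" .
  qed
  have "AE \<omega> in M. \<forall>B\<in>E. measure (L \<omega>) B = measure (K \<omega>) B"
  proof (subst AE_ball_countable[OF E(1)], intro ballI)
    fix B assume "B \<in> E"
    from ver[OF L this] ver[OF K this] show "AE \<omega> in M. measure (L \<omega>) B = measure (K \<omega>) B"
      by eventually_elim simp
  qed
  then show ?thesis
  proof (rule AE_mp, intro AE_I2 impI)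
    fix \<omega> assume \<omega>: "\<omega> \<in> space M" and eq: "\<forall>B\<in>E. measure (L \<omega>) B = measure (K \<omega>) B"
    interpret L: prob_space "L \<omega>" using sL(2)[OF L \<omega>] .
    interpret K: prob_space "K \<omega>" using sL(2)[OF K \<omega>] .
    show "L \<omega> = K \<omega>"
      by (rule measure_eqI_generator_eq[where E=E and \<Omega>=UNIV and A="\<lambda>_. UNIV"])
         (use E eq sL(1)[OF L \<omega>] sL(1)[OF K \<omega>] in \<open>auto simp: L.emeasure_eq_measure K.emeasure_eq_measure\<close>)
  qed
qed

section \<open>Arrays of reproduction laws\<close>

type_synonym repro_array = "nat list \<Rightarrow> enat \<times> (nat \<Rightarrow> real)"

text \<open>An absent child has weight 0, so a word off the tree has product weight 0, and a
  generation may be summed over all words of its length. The index set of every sum is thus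
  deterministic.\<close>

definition wgt :: "real \<Rightarrow> nat \<Rightarrow> enat \<times> (nat \<Rightarrow> real) \<Rightarrow> real" where
  "wgt \<theta> i s = (if enat i < fst s then exp (- \<theta> * snd s i) else 0)"

definition weight :: "real \<Rightarrow> nat list \<Rightarrow> repro_array \<Rightarrow> real" where
  "weight \<theta> u R = (\<Prod>k<length u. wgt \<theta> (u ! k) (R (take k u)))"

definition words :: "nat \<Rightarrow> nat list set" where
  "words n = {u. length u = n}"

definition total :: "real \<Rightarrow> nat \<Rightarrow> repro_array \<Rightarrow> ennreal" where
  "total \<theta> n R = (\<integral>\<^sup>+u. ennreal (weight \<theta> u R) \<partial>count_space (words n))"

definition shift :: "'i list \<Rightarrow> ('i list \<Rightarrow> 's) \<Rightarrow> 'i list \<Rightarrow> 's" where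
  "shift u R = (\<lambda>v. R (u @ v))"

text \<open>
  Resampling all individuals from generation \<open>n\<close> on: integrating out the second argument of
  \<open>mix n\<close> is conditioning on the first \<open>n\<close> generations, and measurability with respect to the
  past becomes invariance under \<open>mix n\<close>.
\<close>

definition mix :: "nat \<Rightarrow> ('i list \<Rightarrow> 's) \<Rightarrow> ('i list \<Rightarrow> 's) \<Rightarrow> 'i list \<Rightarrow> 's" where
  "mix n R R' = (\<lambda>v. if length v < n then R v else R' v)"

section \<open>Branching identities for weights and generation sums\<close>

lemma wgt_nonneg: "0 \<le> wgt \<theta> i s"
  by (simp add: wgt_def)

lemma weight_nonneg [simp]: "0 \<le> weight \<theta> u R"
  by (auto simp: weight_def wgt_nonneg intro: prod_nonneg)

lemma weight_Nil [simp]: "weight \<theta> [] R = 1"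
  by (simp add: weight_def)

lemma weight_snoc: "weight \<theta> (u @ [i]) R = weight \<theta> u R * wgt \<theta> i (R u)"
  by (simp add: weight_def nth_append)

lemma weight_append: "weight \<theta> (u @ v) R = weight \<theta> u R * weight \<theta> v (shift u R)"
proof (induction v rule: rev_induct)
  case (snoc i v)
  then show ?case
    using weight_snoc[of \<theta> "u @ v" i R] weight_snoc[of \<theta> v i "shift u R"] by (simp add: shift_def)
qed simp

lemma weight_power: "weight (real k * \<theta>) u R = weight \<theta> u R ^ k" if "k > 0"
proof -
  have "wgt (real k * \<theta>) i s = wgt \<theta> i s ^ k" for i s
    using that by (simp add: wgt_def exp_of_nat_mult[symmetric] mult.assoc)
  then show ?thesis by (simp add: weight_def prod_power_distrib)
qed

lemma weight_mix: "length u \<le> n \<Longrightarrow> weight \<theta> u (mix n R R') = weight \<theta> u R"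
  by (auto simp: weight_def mix_def intro!: prod.cong)

lemma shift_mix: "length u = n \<Longrightarrow> shift u (mix n R R') = shift u R'"
  by (auto simp: shift_def mix_def)

lemma mix_mix [simp]: "mix n (mix n R R') R'' = mix n R R''"
  by (auto simp: mix_def)

lemma mix_mix_le: "m \<le> n \<Longrightarrow> mix m (mix n R R') R'' = mix m R R''"
  by (auto simp: mix_def)

lemma countable_words [simp]: "countable (words n)"
  by (rule countableI_type)

lemma total_mix: "m \<le> n \<Longrightarrow> total \<theta> m (mix n R R') = total \<theta> m R"
  by (auto simp: total_def words_def weight_mix intro!: nn_integral_cong)

lemma words_add: "bij_betw (\<lambda>(u, v). u @ v) (words n \<times> words k) (words (n + k))"
proof (rule bij_betwI[where g="\<lambda>w. (take n w, drop n w)"])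
qed (auto simp: words_def)

text \<open>Words of length \<open>n + k\<close> are cut at \<open>n\<close>. With values in
  \<open>ennreal\<close>, the double sum needs no finiteness.\<close>

lemma total_add:
  "total \<theta> (n + k) R = (\<integral>\<^sup>+u. ennreal (weight \<theta> u R) * total \<theta> k (shift u R) \<partial>count_space (words n))"
proof -
  interpret k: sigma_finite_measure "count_space (words k)"
    by (rule sigma_finite_measure_count_space_countable) simp
  have "total \<theta> (n + k) R = (\<integral>\<^sup>+w. ennreal (weight \<theta> (case w of (u, v) \<Rightarrow> u @ v) R) \<partial>count_space (words n \<times> words k))"
    unfolding total_def using nn_integral_bij_count_space[OF words_add[of n k], where f="\<lambda>w. ennreal (weight \<theta> w R)"] by simp
  also have "\<dots> = (\<integral>\<^sup>+u. \<integral>\<^sup>+v. ennreal (weight \<theta> (u @ v) R) \<partial>count_space (words k) \<partial>count_space (words n))"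
    by (subst pair_measure_countable[symmetric, OF countable_words countable_words], subst k.nn_integral_fst[symmetric])
       (auto simp: pair_measure_countable)
  also have "\<dots> = (\<integral>\<^sup>+u. ennreal (weight \<theta> u R) * total \<theta> k (shift u R) \<partial>count_space (words n))"
    unfolding total_def by (intro nn_integral_cong) (simp add: weight_append ennreal_mult nn_integral_cmult)
  finally show ?thesis .
qed

lemma words_0: "words 0 = {[]}" by (auto simp: words_def)

lemma words_1: "bij_betw (\<lambda>i. [i]) UNIV (words 1)"
  by (rule bij_betwI[where g=hd]) (auto simp: words_def length_Suc_conv)

lemma total_0 [simp]: "total \<theta> 0 R = 1"
  by (simp add: total_def words_0 nn_integral_count_space_finite)

lemma total_1: "total \<theta> 1 R = (\<integral>\<^sup>+i. ennreal (wgt \<theta> i (R [])) \<partial>count_space UNIV)"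
proof -
  have "weight \<theta> [i] R = wgt \<theta> i (R [])" for i
    using weight_snoc[of \<theta> "[]" i R] by simp
  then show ?thesis
    unfolding total_def using nn_integral_bij_count_space[OF words_1, where f="\<lambda>w. ennreal (weight \<theta> w R)"] by simp
qed

text \<open>The canonical model carries one independent pair of law \<nu> per word. A second sample
  of the same product space serves as the resampled future, so conditioning becomes integration over
  that sample.\<close>

locale cascade = base: prob_space \<nu> for \<nu> :: "(enat \<times> (nat \<Rightarrow> real)) measure" +
  assumes sets_base [measurable_cong]: "sets \<nu> = sets repro_space"
begin

definition Q :: "repro_array measure" where
  "Q = PiM UNIV (\<lambda>_. \<nu>)"

sublocale prod: product_prob_space "\<lambda>_. \<nu>" "UNIV :: nat list set"
  by unfold_locales

sublocale Q: prob_space Q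
  unfolding Q_def by (rule prob_space_PiM) unfold_locales

lemma space_base: "space \<nu> = UNIV"
  using sets_eq_imp_space_eq[OF sets_base] by (simp add: repro_space_def space_pair_measure)

lemma space_Q [simp]: "space Q = UNIV"
  by (auto simp: Q_def space_PiM space_base)

lemma measurable_Q_component [measurable (raw)]: "(\<lambda>R. R u) \<in> Q \<rightarrow>\<^sub>M \<nu>"
  unfolding Q_def by (rule measurable_component_singleton) simp

lemma measurable_into_Q:
  "(\<And>u. (\<lambda>x. f x u) \<in> N \<rightarrow>\<^sub>M \<nu>) \<Longrightarrow> f \<in> N \<rightarrow>\<^sub>M Q"
  unfolding Q_def by (rule measurable_PiM_single') (auto simp: space_base)

lemma measurable_wgt [measurable]: "wgt \<theta> i \<in> borel_measurable \<nu>"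
proof -
  have 1: "fst \<in> repro_space \<rightarrow>\<^sub>M count_space UNIV" unfolding repro_space_def by measurable
  have [measurable]: "Measurable.pred repro_space (\<lambda>s. enat i < fst s)"
    by (rule measurable_compose[OF 1]) simp
  have 2: "snd \<in> repro_space \<rightarrow>\<^sub>M borel" unfolding repro_space_def by measurable
  have [measurable]: "(\<lambda>s. snd s i) \<in> borel_measurable repro_space"
    by (rule measurable_compose[OF 2 measurable_coordinate_sequence])
  have "wgt \<theta> i \<in> borel_measurable repro_space"
    unfolding wgt_def[abs_def] by measurable
  then show ?thesis by (simp add: measurable_cong_sets[OF sets_base refl])
qed

lemma measurable_weight [measurable]: "weight \<theta> u \<in> borel_measurable Q"
  unfolding weight_def[abs_def] by measurable

lemma measurable_total [measurable]: "total \<theta> n \<in> borel_measurable Q"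
  unfolding total_def[abs_def] by (intro borel_measurable_nn_integral_count_space) auto

lemma measurable_shift [measurable]: "shift u \<in> Q \<rightarrow>\<^sub>M Q"
  by (rule measurable_into_Q) (simp add: shift_def measurable_Q_component)

lemma measurable_mix [measurable (raw)]:
  assumes [measurable]: "f \<in> N \<rightarrow>\<^sub>M Q" "g \<in> N \<rightarrow>\<^sub>M Q"
  shows "(\<lambda>x. mix n (f x) (g x)) \<in> N \<rightarrow>\<^sub>M Q"
proof (rule measurable_into_Q)
  fix u
  show "(\<lambda>x. mix n (f x) (g x) u) \<in> N \<rightarrow>\<^sub>M \<nu>"
    by (cases "length u < n") (simp_all add: mix_def measurable_compose[OF _ measurable_Q_component])
qed

section \<open>Invariance under shifting and resampling\<close>

lemma distr_shift: "distr Q Q (shift u) = Q"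
  using distr_PiM_reindex[of UNIV "\<lambda>_. \<nu>" "\<lambda>v. u @ v" UNIV] base.prob_space_axioms
  by (simp add: Q_def shift_def[abs_def] inj_on_def restrict_def)

lemma emeasure_Q_cylinder:
  assumes "finite J" "\<And>u. u \<in> J \<Longrightarrow> A u \<in> sets \<nu>"
  shows "emeasure Q {R. \<forall>u\<in>J. R u \<in> A u} = (\<Prod>u\<in>J. emeasure \<nu> (A u))"
  using prod.emeasure_PiM_Collect[of J A] assms space_Q by (simp add: Q_def)

text \<open>On a cylinder, the constraints at words shorter than \<open>n\<close> concern only the
  first sample and the others only the second, so the probability is the same product as for a
  single sample.\<close>

lemma distr_mix: "distr (Q \<Otimes>\<^sub>M Q) Q (\<lambda>(R, R'). mix n R R') = Q"
proof -
  interpret QQ: pair_prob_space Q Q by unfold_locales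
  have "Q = distr (Q \<Otimes>\<^sub>M Q) Q (\<lambda>(R, R'). mix n R R')"
  proof (rule measure_eqI_PiM_infinite[where I=UNIV and M="\<lambda>_. \<nu>"])
    fix A J assume J: "finite J" "J \<subseteq> (UNIV :: nat list set)" and A: "\<And>i. i \<in> J \<Longrightarrow> A i \<in> sets \<nu>"
    let ?c = "prod_emb UNIV (\<lambda>_. \<nu>) J (PiE J A)"
    let ?J1 = "{u\<in>J. length u < n}" and ?J2 = "{u\<in>J. \<not> length u < n}"
    have c: "?c = {R. \<forall>u\<in>J. R u \<in> A u}"
      by (auto simp: prod_emb_def space_base PiE_def extensional_def Pi_def restrict_def)
    have mc: "?c \<in> sets Q"
      unfolding Q_def using J A by (intro sets_PiM_I) auto
    have cyl: "{R. \<forall>u\<in>K. R u \<in> A u} \<in> sets Q" if "K \<subseteq> J" for K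
    proof -
      have "{R\<in>space Q. \<forall>u\<in>K. R u \<in> A u} \<in> sets Q"
        using finite_subset[OF that J(1)] that A
        by (intro sets.sets_Collect_finite_All)
           (auto simp: vimage_def subset_eq intro: measurable_sets[OF measurable_Q_component, unfolded space_Q Int_UNIV_right vimage_def])
      then show ?thesis by simp
    qed
    have pre: "(\<lambda>(R, R'). mix n R R') -` ?c \<inter> space (Q \<Otimes>\<^sub>M Q) =
        {R. \<forall>u\<in>?J1. R u \<in> A u} \<times> {R. \<forall>u\<in>?J2. R u \<in> A u}"
      unfolding c by (auto simp: mix_def space_pair_measure)
    have "emeasure (distr (Q \<Otimes>\<^sub>M Q) Q (\<lambda>(R, R'). mix n R R')) ?c
        = emeasure Q {R. \<forall>u\<in>?J1. R u \<in> A u} * emeasure Q {R. \<forall>u\<in>?J2. R u \<in> A u}"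
    proof (subst emeasure_distr[OF _ mc])
      show "(\<lambda>(R, R'). mix n R R') \<in> Q \<Otimes>\<^sub>M Q \<rightarrow>\<^sub>M Q" by (simp add: split_beta')
      show "emeasure (Q \<Otimes>\<^sub>M Q) ((\<lambda>(R, R'). mix n R R') -` ?c \<inter> space (Q \<Otimes>\<^sub>M Q))
        = emeasure Q {R. \<forall>u\<in>?J1. R u \<in> A u} * emeasure Q {R. \<forall>u\<in>?J2. R u \<in> A u}"
        unfolding pre by (intro Q.emeasure_pair_measure_Times cyl) auto
    qed
    also have "\<dots> = (\<Prod>u\<in>?J1. emeasure \<nu> (A u)) * (\<Prod>u\<in>?J2. emeasure \<nu> (A u))"
      using J A by (subst (1 2) emeasure_Q_cylinder) auto
    also have "\<dots> = (\<Prod>u\<in>?J1 \<union> ?J2. emeasure \<nu> (A u))"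
      using J by (intro prod.union_disjoint[symmetric]) auto
    also have "?J1 \<union> ?J2 = J" by auto
    also have "(\<Prod>u\<in>J. emeasure \<nu> (A u)) = emeasure Q ?c"
      unfolding c using J A by (subst emeasure_Q_cylinder) auto
    finally show "emeasure Q ?c = emeasure (distr (Q \<Otimes>\<^sub>M Q) Q (\<lambda>(R, R'). mix n R R')) ?c" ..
  qed (simp_all add: Q_def Q.finite_measure_axioms[unfolded Q_def])
  then show ?thesis ..
qed

lemma nn_integral_mix:
  assumes [measurable]: "F \<in> borel_measurable Q"
  shows "(\<integral>\<^sup>+R. F R \<partial>Q) = (\<integral>\<^sup>+R. \<integral>\<^sup>+R'. F (mix n R R') \<partial>Q \<partial>Q)"
proof -
  have "(\<integral>\<^sup>+R. F R \<partial>Q) = (\<integral>\<^sup>+x. F (case x of (R, R') \<Rightarrow> mix n R R') \<partial>(Q \<Otimes>\<^sub>M Q))"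
    by (subst distr_mix[of n, symmetric], subst nn_integral_distr) (auto simp: split_beta')
  also have "\<dots> = (\<integral>\<^sup>+R. \<integral>\<^sup>+R'. F (mix n R R') \<partial>Q \<partial>Q)"
    by (subst Q.nn_integral_fst[symmetric]) (auto simp: split_beta')
  finally show ?thesis .
qed

text \<open>Fubini; through it an almost sure identity for the whole array becomes usable with the
  past held fixed.\<close>

lemma AE_mix:
  assumes "AE R in Q. P R"
  shows "AE R in Q. AE R' in Q. P (mix n R R')"
proof -
  interpret QQ: pair_prob_space Q Q by unfold_locales
  have "AE x in Q \<Otimes>\<^sub>M Q. P (case x of (R, R') \<Rightarrow> mix n R R')"
  proof (rule AE_distrD[where M'=Q and f="\<lambda>(R, R'). mix n R R'"])
    show "AE x in distr (Q \<Otimes>\<^sub>M Q) Q (\<lambda>(R, R'). mix n R R'). P x"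
      unfolding distr_mix by (rule assms)
  qed (simp add: split_beta')
  from QQ.AE_pair[OF this] show ?thesis by simp
qed

lemma AE_shift: "AE R in Q. P R \<Longrightarrow> AE R in Q. P (shift u R)"
  using AE_distrD[OF measurable_shift[of u], of P] unfolding distr_shift .

lemma AE_shift_all:
  assumes "AE R in Q. P R" shows "AE R in Q. \<forall>u. P (shift u R)"
  using AE_shift[OF assms] by (simp add: AE_all_countable)

lemma nn_integral_shift:
  "F \<in> borel_measurable Q \<Longrightarrow> (\<integral>\<^sup>+R. F (shift u R) \<partial>Q) = (\<integral>\<^sup>+R. F R \<partial>Q)"
  by (subst (2) distr_shift[of u, symmetric], subst nn_integral_distr) auto

lemma integral_shift:
  fixes F :: "_ \<Rightarrow> real"
  shows "F \<in> borel_measurable Q \<Longrightarrow> (\<integral>R. F (shift u R) \<partial>Q) = (\<integral>R. F R \<partial>Q)"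
  by (subst (2) distr_shift[of u, symmetric], subst integral_distr) auto

lemma integrable_shift:
  fixes F :: "_ \<Rightarrow> real"
  shows "integrable Q F \<Longrightarrow> integrable Q (\<lambda>R. F (shift u R))"
  using integrable_distr[of "shift u" Q Q F] by (simp add: distr_shift)

lemma distr_component: "distr Q \<nu> (\<lambda>R. R u) = \<nu>"
  using distr_PiM_component[of UNIV "\<lambda>_. \<nu>" u] base.prob_space_axioms by (simp add: Q_def)

lemma indep_vars_components: "Q.indep_vars (\<lambda>_. \<nu>) (\<lambda>u R. R u) UNIV"
proof (subst Q.indep_vars_iff_distr_eq_PiM)
  show "distr Q (PiM UNIV (\<lambda>_. \<nu>)) (\<lambda>x. \<lambda>i\<in>UNIV. x i) = PiM UNIV (\<lambda>i. distr Q \<nu> (\<lambda>R. R i))"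
    by (simp add: restrict_def Q_def[symmetric] distr_id distr_component)
qed (auto simp: measurable_Q_component)

text \<open>Subtrees rooted at distinct words of equal length read disjoint sets of coordinates,
  since neither root is a prefix of the other.\<close>

lemma indep_vars_shift:
  fixes F :: "_ \<Rightarrow> real"
  assumes [measurable]: "F \<in> borel_measurable Q"
  shows "Q.indep_vars (\<lambda>_. borel) (\<lambda>u R. F (shift u R)) (words n)"
proof -
  let ?K = "\<lambda>u::nat list. {u @ v | v. True}"
  have "disjoint_family_on ?K (words n)"
    by (auto simp: disjoint_family_on_def words_def)
  then have "Q.indep_vars (\<lambda>u. PiM (?K u) (\<lambda>_. \<nu>)) (\<lambda>u R. restrict (\<lambda>v. R v) (?K u)) (words n)"
    by (intro Q.indep_vars_restrict[OF indep_vars_components]) auto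
  then have "Q.indep_vars (\<lambda>_. borel) (\<lambda>u R. (\<lambda>S. F (shift u S)) (restrict (\<lambda>v. R v) (?K u))) (words n)"
  proof (rule Q.indep_vars_compose2)
    fix u
    have "shift u \<in> PiM (?K u) (\<lambda>_. \<nu>) \<rightarrow>\<^sub>M Q"
      by (rule measurable_into_Q) (auto simp: shift_def intro!: measurable_component_singleton)
    then show "(\<lambda>S. F (shift u S)) \<in> PiM (?K u) (\<lambda>_. \<nu>) \<rightarrow>\<^sub>M borel"
      by measurable
  qed
  moreover have "shift u (restrict (\<lambda>v. R v) (?K u)) = shift u R" for u and R :: repro_array
    by (auto simp: shift_def)
  ultimately show ?thesis by simp
qed

section \<open>Expected generation sums\<close>

definition mom :: "real \<Rightarrow> ennreal" where
  "mom \<theta> = (\<integral>\<^sup>+s. \<integral>\<^sup>+i. ennreal (wgt \<theta> i s) \<partial>count_space UNIV \<partial>\<nu>)"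

text \<open>After resampling, the weights depend only on the first sample and the subtrees only on
  the second, so the expectations factor.\<close>

lemma nn_integral_weighted_shift:
  assumes [measurable]: "G \<in> borel_measurable Q"
  shows "(\<integral>\<^sup>+R. \<integral>\<^sup>+u. ennreal (weight \<theta> u R) * G (shift u R) \<partial>count_space (words n) \<partial>Q)
    = (\<integral>\<^sup>+R. total \<theta> n R \<partial>Q) * (\<integral>\<^sup>+R. G R \<partial>Q)"
proof -
  have m: "(\<lambda>R. \<integral>\<^sup>+u. ennreal (weight \<theta> u R) * G (shift u R) \<partial>count_space (words n)) \<in> borel_measurable Q"
    by (intro borel_measurable_nn_integral_count_space) auto
  have "(\<integral>\<^sup>+R. \<integral>\<^sup>+u. ennreal (weight \<theta> u R) * G (shift u R) \<partial>count_space (words n) \<partial>Q)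
     = (\<integral>\<^sup>+R. \<integral>\<^sup>+R'. \<integral>\<^sup>+u. ennreal (weight \<theta> u R) * G (shift u R') \<partial>count_space (words n) \<partial>Q \<partial>Q)"
    by (subst nn_integral_mix[OF m, of n]) (auto intro!: nn_integral_cong simp: words_def weight_mix shift_mix)
  also have "\<dots> = (\<integral>\<^sup>+R. \<integral>\<^sup>+u. ennreal (weight \<theta> u R) * (\<integral>\<^sup>+R. G R \<partial>Q) \<partial>count_space (words n) \<partial>Q)"
    by (intro nn_integral_cong, subst nn_integral_count_space_nn_integral)
       (auto simp: nn_integral_cmult nn_integral_shift)
  also have "\<dots> = (\<integral>\<^sup>+R. total \<theta> n R * (\<integral>\<^sup>+R. G R \<partial>Q) \<partial>Q)"
    by (simp add: nn_integral_multc total_def)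
  also have "\<dots> = (\<integral>\<^sup>+R. total \<theta> n R \<partial>Q) * (\<integral>\<^sup>+R. G R \<partial>Q)"
    by (rule nn_integral_multc) measurable
  finally show ?thesis .
qed

lemma nn_integral_root:
  assumes "f \<in> borel_measurable \<nu>"
  shows "(\<integral>\<^sup>+R. f (R u) \<partial>Q) = (\<integral>\<^sup>+s. f s \<partial>\<nu>)"
  using nn_integral_distr[OF measurable_Q_component, of f u] assms by (simp add: distr_component)

lemma nn_integral_total: "(\<integral>\<^sup>+R. total \<theta> n R \<partial>Q) = mom \<theta> ^ n"
proof (induction n)
  case 0
  then show ?case using Q.emeasure_space_1 by simp
next
  case (Suc n)
  have one: "(\<integral>\<^sup>+R. total \<theta> 1 R \<partial>Q) = mom \<theta>"
    unfolding total_1 mom_def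
    by (rule nn_integral_root[of "\<lambda>s. \<integral>\<^sup>+i. ennreal (wgt \<theta> i s) \<partial>count_space UNIV"])
       (intro borel_measurable_nn_integral_count_space, auto)
  have "(\<integral>\<^sup>+R. total \<theta> (n + 1) R \<partial>Q) = mom \<theta> ^ n * mom \<theta>"
    unfolding total_add using nn_integral_weighted_shift[of "total \<theta> 1" n \<theta>] Suc one by simp
  then show ?case by (simp add: mult.commute)
qed

end

section \<open>Square-integrable Biggins martingales\<close>

lemma weight_2: "weight 2 u R = (weight 1 u R)\<^sup>2"
  using weight_power[of 2 1 u R] by simp

locale cascade_L2 = cascade \<nu> for \<nu> :: "(enat \<times> (nat \<Rightarrow> real)) measure" +
  fixes q :: real
  assumes mom_1: "mom 1 = 1" and mom_2: "mom 2 = ennreal q" and q_pos: "0 < q" and q_less: "q < 1"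
    and square: "(\<integral>\<^sup>+R. (total 1 1 R)\<^sup>2 \<partial>Q) < \<infinity>"
begin

definition W :: "nat \<Rightarrow> repro_array \<Rightarrow> real" where
  "W k R = (\<integral>u. weight 1 u R \<partial>count_space (words k))"

text \<open>A difference of two martingale values from generation \<open>n\<close> on has this
  shape, with \<open>\<zeta>\<close> the same difference taken inside one subtree. A single moment
  identity therefore covers finite increments and tails alike.\<close>

definition incr :: "nat \<Rightarrow> (repro_array \<Rightarrow> real) \<Rightarrow> repro_array \<Rightarrow> real" where
  "incr n \<zeta> R = (\<integral>u. weight 1 u R * \<zeta> (shift u R) \<partial>count_space (words n))"

lemma W_eq: "W k R = enn2real (total 1 k R)"
  unfolding W_def total_def by (rule integral_eq_nn_integral) auto

lemma measurable_W [measurable]: "W k \<in> borel_measurable Q"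
  unfolding W_def[abs_def] by (intro borel_measurable_integral_count_space) auto

lemma measurable_incr [measurable]: "\<zeta> \<in> borel_measurable Q \<Longrightarrow> incr n \<zeta> \<in> borel_measurable Q"
  unfolding incr_def[abs_def] by (intro borel_measurable_integral_count_space) auto

lemma W_nonneg: "0 \<le> W k R"
  by (simp add: W_eq)

lemma W_0 [simp]: "W 0 R = 1"
  by (simp add: W_eq)

lemma W_mix: "m \<le> n \<Longrightarrow> W m (mix n R R') = W m R"
  by (simp add: W_eq total_mix)

lemma incr_mix: "incr n \<zeta> (mix n R R') = (\<integral>u. weight 1 u R * \<zeta> (shift u R') \<partial>count_space (words n))"
  unfolding incr_def by (intro Bochner_Integration.integral_cong refl) (auto simp: words_def weight_mix shift_mix)

lemma AE_total_finite: "AE R in Q. \<forall>u n. total 1 n (shift u R) < \<infinity>"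
proof -
  have "AE R in Q. total 1 n R \<noteq> \<infinity>" for n
    by (rule nn_integral_PInf_AE) (simp_all add: nn_integral_total mom_1)
  then have "AE R in Q. \<forall>n. total 1 n R < \<infinity>"
    by (simp add: AE_all_countable less_top)
  from AE_shift_all[OF this] show ?thesis .
qed

lemma shift_Nil [simp]: "shift [] R = R"
  by (simp add: shift_def)

lemma integrable_weight:
  assumes "total 1 n R < \<infinity>" shows "integrable (count_space (words n)) (\<lambda>u. weight 1 u R)"
  using assms unfolding total_def by (intro integrableI_nonneg) auto

lemma ennreal_W: "total 1 n R < \<infinity> \<Longrightarrow> ennreal (W n R) = total 1 n R"
  by (simp add: W_eq less_top)

lemma W_add:
  assumes fin: "\<forall>u n. total 1 n (shift u R) < \<infinity>"
  shows "W (n + k) R = incr n (W k) R"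
    and "integrable (count_space (words n)) (\<lambda>u. weight 1 u R * W k (shift u R))"
proof -
  have *: "total 1 (n + k) R = (\<integral>\<^sup>+u. ennreal (weight 1 u R * W k (shift u R)) \<partial>count_space (words n))"
    unfolding total_add using fin by (intro nn_integral_cong) (simp add: ennreal_mult W_nonneg ennreal_W)
  show "W (n + k) R = incr n (W k) R"
    unfolding W_eq[of "n + k"] * incr_def by (rule integral_eq_nn_integral[symmetric]) (auto simp: W_nonneg)
  show "integrable (count_space (words n)) (\<lambda>u. weight 1 u R * W k (shift u R))"
    using fin[rule_format, of "n + k" "[]"] by (intro integrableI_nonneg) (auto simp: * W_nonneg)
qed

lemma weighted_sum_words:
  assumes fin: "total 1 n R < \<infinity>" and c: "0 \<le> c"
    and [measurable]: "\<zeta> \<in> borel_measurable Q" and sq: "integrable Q (\<lambda>R. (\<zeta> R)\<^sup>2)"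
    and mean: "(\<integral>R. \<zeta> R \<partial>Q) = 0" and s: "(\<integral>R. (\<zeta> R)\<^sup>2 \<partial>Q) = s"
  shows "weighted_sum Q (words n) (\<lambda>u. c * weight 1 u R) (\<lambda>u R'. \<zeta> (shift u R')) s"
proof unfold_locales
  show "Q.indep_vars (\<lambda>_. borel) (\<lambda>u R'. \<zeta> (shift u R')) (words n)"
    by (rule indep_vars_shift) measurable
  show "integrable Q (\<lambda>x. (\<zeta> (shift i x))\<^sup>2)" for i
    by (rule integrable_shift[OF sq])
  show "(\<integral>R. \<zeta> (shift i R) \<partial>Q) = 0" for i
    by (simp add: integral_shift mean)
  show "(\<integral>R. (\<zeta> (shift i R))\<^sup>2 \<partial>Q) = s" for i
    using integral_shift[of "\<lambda>R. (\<zeta> R)\<^sup>2" i] s by simp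
  show "integrable (count_space (words n)) (\<lambda>u. c * weight 1 u R)"
    using integrable_weight[OF fin] by simp
qed (use c in auto)

lemma integral_square_weight: "(\<integral>u. (weight 1 u R)\<^sup>2 \<partial>count_space (words n)) = enn2real (total 2 n R)"
  unfolding total_def weight_2 by (rule integral_eq_nn_integral) auto

lemma total_2_finite:
  assumes "total 1 n R < \<infinity>" shows "total 2 n R < \<infinity>"
proof -
  have "integrable (count_space (words n)) (\<lambda>u. (weight 1 u R)\<^sup>2)"
    by (intro integrable_count_space_square integrable_weight assms) auto
  then show ?thesis
    unfolding total_def weight_2 using integrableD(2)[of "count_space (words n)" "\<lambda>u. (weight 1 u R)\<^sup>2"] by (simp add: less_top)
qed

text \<open>Given the first \<open>n\<close> generations, the increment is centred with variance
  \<open>s * total 2 n R\<close>, whose mean is \<open>s * q ^ n\<close>, while \<open>a\<close> is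
  already known; Pythagoras applies. In terms of nonnegative integrals the identity also serves
  where square integrability of \<open>a\<close> is itself the goal.\<close>

lemma martingale_moment:
  assumes [measurable]: "\<zeta> \<in> borel_measurable Q" and sq: "integrable Q (\<lambda>R. (\<zeta> R)\<^sup>2)"
    and mean: "(\<integral>R. \<zeta> R \<partial>Q) = 0" and s: "(\<integral>R. (\<zeta> R)\<^sup>2 \<partial>Q) = s"
    and [measurable]: "a \<in> borel_measurable Q" and a: "\<And>R R'. a (mix n R R') = a R"
  shows "(\<integral>\<^sup>+R. ennreal ((a R + incr n \<zeta> R)\<^sup>2) \<partial>Q) = (\<integral>\<^sup>+R. ennreal ((a R)\<^sup>2) \<partial>Q) + ennreal (s * q ^ n)"
proof -
  have s0: "0 \<le> s" unfolding s[symmetric] by simp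
  have "(\<integral>\<^sup>+R. ennreal ((a R + incr n \<zeta> R)\<^sup>2) \<partial>Q)
      = (\<integral>\<^sup>+R. \<integral>\<^sup>+R'. ennreal ((a R + (\<integral>u. weight 1 u R * \<zeta> (shift u R') \<partial>count_space (words n)))\<^sup>2) \<partial>Q \<partial>Q)"
    by (subst nn_integral_mix[of _ n]) (auto simp: a incr_mix)
  also have "\<dots> = (\<integral>\<^sup>+R. (ennreal ((a R)\<^sup>2) + ennreal s * total 2 n R) \<partial>Q)"
  proof (rule nn_integral_cong_AE, use AE_total_finite in eventually_elim)
    case (elim R)
    then have fin: "total 1 n R < \<infinity>" by (metis shift_Nil)
    interpret S: weighted_sum Q "words n" "\<lambda>u. 1 * weight 1 u R" "\<lambda>u R'. \<zeta> (shift u R')" s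
      by (rule weighted_sum_words[OF fin _ _ sq mean s]) auto
    have "(\<integral>\<^sup>+R'. ennreal ((a R + (\<integral>u. weight 1 u R * \<zeta> (shift u R') \<partial>count_space (words n)))\<^sup>2) \<partial>Q)
      = ennreal ((a R)\<^sup>2 + s * enn2real (total 2 n R))"
      using S.total_moment[of "a R"] by (subst nn_integral_eq_integral) (auto simp: integral_square_weight)
    also have "\<dots> = ennreal ((a R)\<^sup>2) + ennreal s * total 2 n R"
      using s0 total_2_finite[OF fin] by (simp add: ennreal_plus ennreal_mult less_top)
    finally show ?case .
  qed
  also have "\<dots> = (\<integral>\<^sup>+R. ennreal ((a R)\<^sup>2) \<partial>Q) + ennreal s * (\<integral>\<^sup>+R. total 2 n R \<partial>Q)"
    by (simp add: nn_integral_add nn_integral_cmult)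
  also have "ennreal s * (\<integral>\<^sup>+R. total 2 n R \<partial>Q) = ennreal (s * q ^ n)"
    using s0 q_pos by (simp add: nn_integral_total mom_2 ennreal_mult ennreal_power)
  finally show ?thesis .
qed

lemma
  shows integrable_W: "integrable Q (W k)" and expectation_W: "(\<integral>R. W k R \<partial>Q) = 1"
proof -
  have "AE R in Q. ennreal (W k R) = total 1 k R"
    using AE_total_finite by eventually_elim (metis ennreal_W shift_Nil)
  then have *: "(\<integral>\<^sup>+R. ennreal (W k R) \<partial>Q) = 1"
    by (subst nn_integral_cong_AE, assumption) (simp add: nn_integral_total mom_1)
  then show "integrable Q (W k)"
    by (intro integrableI_nonneg) (auto simp: W_nonneg)
  show "(\<integral>R. W k R \<partial>Q) = 1"
    by (subst integral_eq_nn_integral) (auto simp: W_nonneg *)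
qed

lemma expectation_W_diff: "(\<integral>R. W k R - 1 \<partial>Q) = 0"
  using integrable_W[of k] expectation_W[of k] Q.prob_space by simp

section \<open>Boundedness in mean square\<close>

definition \<sigma>2 :: real where "\<sigma>2 = (\<integral>R. (W 1 R - 1)\<^sup>2 \<partial>Q)"

lemma \<sigma>2_nonneg: "0 \<le> \<sigma>2" by (simp add: \<sigma>2_def)

lemma integrable_W1_square: "integrable Q (\<lambda>R. (W 1 R - 1)\<^sup>2)"
proof -
  have "AE R in Q. ennreal ((W 1 R)\<^sup>2) = (total 1 1 R)\<^sup>2"
    using AE_total_finite
  proof eventually_elim
    case (elim R)
    then have "ennreal (W 1 R) = total 1 1 R" by (metis ennreal_W shift_Nil)
    then show ?case by (simp add: ennreal_power[symmetric] W_nonneg)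
  qed
  then have "(\<integral>\<^sup>+R. ennreal ((W 1 R)\<^sup>2) \<partial>Q) < \<infinity>"
    using square by (simp only: nn_integral_cong_AE)
  then have "integrable Q (\<lambda>R. (W 1 R)\<^sup>2)"
    by (intro integrableI_nonneg) auto
  then have "integrable Q (\<lambda>R. (W 1 R)\<^sup>2 - 2 * W 1 R + 1)"
    using integrable_W[of 1] by simp
  then show ?thesis by (simp add: power2_eq_square algebra_simps)
qed

lemma integrable_nn_real:
  fixes f :: "_ \<Rightarrow> real"
  assumes "f \<in> borel_measurable Q" "\<And>R. 0 \<le> f R" "(\<integral>\<^sup>+R. ennreal (f R) \<partial>Q) = ennreal c" "0 \<le> c"
  shows "integrable Q f" "(\<integral>R. f R \<partial>Q) = c"
  using assms by (auto intro!: integrableI_nonneg simp: integral_eq_nn_integral)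

lemma W_add_diff:
  assumes fin: "\<forall>u n. total 1 n (shift u R) < \<infinity>"
  shows "W (n + k) R - W (n + r) R = incr n (\<lambda>S. W k S - W r S) R"
  using W_add[OF fin, of n k] W_add[OF fin, of n r]
  by (simp add: incr_def right_diff_distrib)

text \<open>Splitting at the first generation, each variance is \<open>\<sigma>2\<close> plus
  \<open>q\<close> times the previous one, and \<open>\<sigma>2 / (1 - q)\<close> is the fixed point
  of this recursion.\<close>

lemma W_square:
  "integrable Q (\<lambda>R. (W k R - 1)\<^sup>2) \<and> (\<integral>R. (W k R - 1)\<^sup>2 \<partial>Q) \<le> \<sigma>2 / (1 - q)"
proof (induction k)
  case 0
  show ?case using \<sigma>2_nonneg q_less by simp
next
  case (Suc k)
  let ?v = "\<integral>R. (W k R - 1)\<^sup>2 \<partial>Q"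
  have "(\<integral>\<^sup>+R. ennreal ((W (1 + k) R - 1)\<^sup>2) \<partial>Q)
      = (\<integral>\<^sup>+R. ennreal (((W 1 R - 1) + incr 1 (\<lambda>R. W k R - 1) R)\<^sup>2) \<partial>Q)"
  proof (rule nn_integral_cong_AE, use AE_total_finite in eventually_elim)
    case (elim R)
    from W_add_diff[OF elim, of 1 k 0] show ?case by (simp add: algebra_simps)
  qed
  also have "\<dots> = (\<integral>\<^sup>+R. ennreal ((W 1 R - 1)\<^sup>2) \<partial>Q) + ennreal (?v * q ^ 1)"
    by (rule martingale_moment) (use Suc in \<open>auto simp: W_mix expectation_W_diff\<close>)
  also have "\<dots> = ennreal (\<sigma>2 + ?v * q)"
    using integrable_W1_square q_pos by (simp add: nn_integral_eq_integral \<sigma>2_def ennreal_plus)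
  finally have eq: "(\<integral>\<^sup>+R. ennreal ((W (Suc k) R - 1)\<^sup>2) \<partial>Q) = ennreal (\<sigma>2 + ?v * q)" by simp
  have "\<sigma>2 + ?v * q \<le> \<sigma>2 + \<sigma>2 / (1 - q) * q"
    using Suc q_pos by (intro add_left_mono mult_right_mono) auto
  also have "\<dots> = \<sigma>2 / (1 - q)" using q_less by (simp add: field_simps)
  finally show ?case
    using integrable_nn_real[OF _ _ eq] q_pos \<sigma>2_nonneg by auto
qed

text \<open>One plus the variation of the path, a substitute for a maximal function. The second
  moments of the increments decay like \<open>q ^ k\<close>, so it has finite mean; it yields almost
  sure convergence and an integrable bound at the same time.\<close>

definition Wsup :: "repro_array \<Rightarrow> ennreal" where
  "Wsup R = 1 + (\<Sum>k. ennreal \<bar>W (Suc k) R - W k R\<bar>)"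

lemma measurable_Wsup [measurable]: "Wsup \<in> borel_measurable Q"
  unfolding Wsup_def[abs_def] by measurable

lemma nn_integral_Wsup: "(\<integral>\<^sup>+R. Wsup R \<partial>Q) < \<infinity>"
proof -
  have one: "(\<integral>\<^sup>+R. ennreal \<bar>W (Suc k) R - W k R\<bar> \<partial>Q) \<le> ennreal ((\<sigma>2 + 1) * sqrt q ^ k)" for k
  proof -
    let ?c = "sqrt q ^ k"
    have c: "0 < ?c" "?c * ?c = q ^ k" using q_pos by (simp_all flip: power_mult_distrib)
    \<comment> \<open>A weighted arithmetic-geometric bound. The choice
      \<open>c = sqrt q ^ k\<close> balances the second moment \<open>\<sigma>2 * q ^ k\<close> and
      produces the summable bound \<open>(\<sigma>2 + 1) * sqrt q ^ k\<close>.\<close>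
    have "\<bar>x\<bar> \<le> x\<^sup>2 / c + c" if "0 < c" for x c :: real
    proof -
      have "0 \<le> (\<bar>x\<bar> - c)\<^sup>2 + \<bar>x\<bar> * c" using that by simp
      then have "\<bar>x\<bar> * c \<le> x\<^sup>2 + c * c" by (simp add: power2_eq_square algebra_simps)
      then have "\<bar>x\<bar> \<le> (x\<^sup>2 + c * c) / c" using that by (simp add: pos_le_divide_eq)
      then show ?thesis using that by (simp add: add_divide_distrib)
    qed
    from this[OF c(1)] have "\<bar>x\<bar> \<le> x\<^sup>2 / ?c + ?c" for x :: real .
    then have "(\<integral>\<^sup>+R. ennreal \<bar>W (Suc k) R - W k R\<bar> \<partial>Q) \<le> (\<integral>\<^sup>+R. ennreal (1 / ?c) * ennreal ((W (Suc k) R - W k R)\<^sup>2) + ennreal ?c \<partial>Q)"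
      using c(1) by (intro nn_integral_mono) (simp add: ennreal_plus[symmetric] ennreal_mult[symmetric] ennreal_leI del: ennreal_plus)
    also have "\<dots> = ennreal (1 / ?c) * (\<integral>\<^sup>+R. ennreal ((W (Suc k) R - W k R)\<^sup>2) \<partial>Q) + ennreal ?c"
      using Q.emeasure_space_1 by (simp add: nn_integral_add nn_integral_cmult)
    also have "(\<integral>\<^sup>+R. ennreal ((W (Suc k) R - W k R)\<^sup>2) \<partial>Q) = (\<integral>\<^sup>+R. ennreal ((0 + incr k (\<lambda>R. W 1 R - 1) R)\<^sup>2) \<partial>Q)"
    proof (rule nn_integral_cong_AE, use AE_total_finite in eventually_elim)
      case (elim R)
      from W_add_diff[OF elim, of k 1 0] show ?case by simp
    qed
    also have "\<dots> = ennreal (\<sigma>2 * q ^ k)"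
      by (subst martingale_moment[where s=\<sigma>2])
         (use integrable_W1_square expectation_W_diff[of 1] in \<open>auto simp: \<sigma>2_def\<close>)
    also have "ennreal (1 / ?c) * ennreal (\<sigma>2 * q ^ k) + ennreal ?c = ennreal ((\<sigma>2 + 1) * ?c)"
      using c \<sigma>2_nonneg q_pos by (simp add: ennreal_plus[symmetric] ennreal_mult[symmetric] c(2)[symmetric] field_simps del: ennreal_plus)
    finally show ?thesis .
  qed
  have sm: "summable (\<lambda>k. (\<sigma>2 + 1) * sqrt q ^ k)"
    using q_pos q_less by (intro summable_mult summable_geometric) auto
  have "(\<integral>\<^sup>+R. Wsup R \<partial>Q) = 1 + (\<Sum>k. \<integral>\<^sup>+R. ennreal \<bar>W (Suc k) R - W k R\<bar> \<partial>Q)"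
    unfolding Wsup_def using Q.emeasure_space_1 by (subst nn_integral_add) (auto simp: nn_integral_suminf)
  also have "\<dots> \<le> 1 + (\<Sum>k. ennreal ((\<sigma>2 + 1) * sqrt q ^ k))"
    by (intro add_left_mono suminf_le one) auto
  also have "\<dots> = 1 + ennreal (\<Sum>k. (\<sigma>2 + 1) * sqrt q ^ k)"
    using sm \<sigma>2_nonneg q_pos by (subst suminf_ennreal2) auto
  also have "\<dots> < \<infinity>" by (simp add: less_top)
  finally show ?thesis .
qed

lemma W_le_Wsup: "ennreal (W k R) \<le> Wsup R"
proof -
  have "W k R = 1 + (\<Sum>j<k. W (Suc j) R - W j R)"
    using sum_lessThan_telescope[of "\<lambda>j. W j R" k] by simp
  also have "\<dots> \<le> 1 + (\<Sum>j<k. \<bar>W (Suc j) R - W j R\<bar>)"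
    by (intro add_left_mono sum_mono) auto
  finally have "ennreal (W k R) \<le> ennreal (1 + (\<Sum>j<k. \<bar>W (Suc j) R - W j R\<bar>))"
    by (rule ennreal_leI)
  also have "\<dots> = 1 + (\<Sum>j<k. ennreal \<bar>W (Suc j) R - W j R\<bar>)"
    by (subst ennreal_plus) (auto simp: sum_nonneg sum_ennreal)
  also have "\<dots> \<le> Wsup R"
    unfolding Wsup_def by (intro add_left_mono sum_le_suminf) auto
  finally show ?thesis .
qed

lemma W_le_Wsup_real: "Wsup R < \<infinity> \<Longrightarrow> W k R \<le> enn2real (Wsup R)"
  using enn2real_mono[OF W_le_Wsup[of k R]] by (simp add: W_nonneg less_top)

section \<open>The limit and its decomposition over a generation\<close>

definition Winf :: "repro_array \<Rightarrow> real" where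
  "Winf R = lim (\<lambda>k. W k R)"

lemma measurable_Winf [measurable]: "Winf \<in> borel_measurable Q"
  unfolding Winf_def[abs_def] by measurable

lemma W_tendsto:
  assumes "Wsup R < \<infinity>" shows "(\<lambda>k. W k R) \<longlonglongrightarrow> Winf R"
proof -
  have "(\<Sum>k. ennreal \<bar>W (Suc k) R - W k R\<bar>) \<noteq> \<infinity>"
    using assms by (auto simp: Wsup_def)
  then have "summable (\<lambda>k. \<bar>W (Suc k) R - W k R\<bar>)"
    by (intro summable_suminf_not_top) auto
  then have "summable (\<lambda>k. W (Suc k) R - W k R)"
    by (rule summable_rabs_cancel)
  then have "convergent (\<lambda>n. \<Sum>k<n. W (Suc k) R - W k R)"
    by (simp add: summable_iff_convergent)
  then have "convergent (\<lambda>n. W n R)"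
    using sum_lessThan_telescope[of "\<lambda>j. W j R"] by (simp add: convergent_diff_const_right_iff)
  then show ?thesis unfolding Winf_def by (simp add: convergent_LIMSEQ_iff)
qed

lemma AE_Wsup_finite: "AE R in Q. \<forall>u. Wsup (shift u R) < \<infinity>"
proof -
  have "AE R in Q. Wsup R \<noteq> \<infinity>"
    by (rule nn_integral_PInf_AE) (use nn_integral_Wsup in auto)
  then have "AE R in Q. Wsup R < \<infinity>" by (simp add: less_top)
  from AE_shift_all[OF this] show ?thesis .
qed

lemma AE_W_tendsto: "AE R in Q. (\<lambda>k. W k R) \<longlonglongrightarrow> Winf R"
  using AE_Wsup_finite by eventually_elim (metis W_tendsto shift_Nil)

text \<open>The limit is taken inside an infinite sum over the generation. Twice the weighted
  \<open>Wsup\<close> of the subtrees dominates; the expected sum of these weighted variables is the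
  mean of \<open>Wsup\<close> again, because \<open>mom 1 = 1\<close>.\<close>

lemma Winf_decomposition:
  "AE R in Q. \<forall>n r. Winf R - W (n + r) R = incr n (\<lambda>S. Winf S - W r S) R"
proof -
  have "AE R in Q. (\<integral>\<^sup>+u. ennreal (weight 1 u R) * Wsup (shift u R) \<partial>count_space (words n)) \<noteq> \<infinity>" for n
  proof (rule nn_integral_PInf_AE)
    show "(\<lambda>R. \<integral>\<^sup>+u. ennreal (weight 1 u R) * Wsup (shift u R) \<partial>count_space (words n)) \<in> borel_measurable Q"
      by (intro borel_measurable_nn_integral_count_space) auto
    show "(\<integral>\<^sup>+R. \<integral>\<^sup>+u. ennreal (weight 1 u R) * Wsup (shift u R) \<partial>count_space (words n) \<partial>Q) \<noteq> \<infinity>"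
      by (subst nn_integral_weighted_shift) (use nn_integral_Wsup in \<open>auto simp: nn_integral_total mom_1\<close>)
  qed
  then have "AE R in Q. \<forall>n. (\<integral>\<^sup>+u. ennreal (weight 1 u R) * Wsup (shift u R) \<partial>count_space (words n)) \<noteq> \<infinity>"
    by (simp add: AE_all_countable)
  with AE_Wsup_finite AE_total_finite show ?thesis
  proof eventually_elim
    case (elim R)
    have supfin: "Wsup R < \<infinity>" using elim(1) by (metis shift_Nil)
    show ?case
    proof (intro allI)
      fix n r
      let ?w = "\<lambda>u. weight 1 u R * enn2real (Wsup (shift u R))"
      have "(\<integral>\<^sup>+u. ennreal (?w u) \<partial>count_space (words n)) = (\<integral>\<^sup>+u. ennreal (weight 1 u R) * Wsup (shift u R) \<partial>count_space (words n))"
        using elim(1) by (intro nn_integral_cong) (simp add: ennreal_mult less_top)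
      then have w: "integrable (count_space (words n)) ?w"
        using elim(3) by (intro integrableI_nonneg) (auto simp: less_top)
      have bnd: "\<bar>W k (shift u R)\<bar> \<le> enn2real (Wsup (shift u R))" for k u
        using W_le_Wsup_real[of "shift u R" k] elim(1) W_nonneg[of k "shift u R"] by auto
      have "(\<lambda>k. incr n (\<lambda>S. W k S - W r S) R) \<longlonglongrightarrow> incr n (\<lambda>S. Winf S - W r S) R"
        unfolding incr_def
      proof (rule integral_dominated_convergence[where w="\<lambda>u. 2 * ?w u"])
        show "AE u in count_space (words n). (\<lambda>k. weight 1 u R * (W k (shift u R) - W r (shift u R)))
            \<longlonglongrightarrow> weight 1 u R * (Winf (shift u R) - W r (shift u R))"
          using elim(1) by (intro AE_I2 tendsto_intros W_tendsto) auto
        show "AE u in count_space (words n). norm (weight 1 u R * (W k (shift u R) - W r (shift u R))) \<le> 2 * ?w u" for k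
        proof (rule AE_I2)
          fix u
          have "\<bar>W k (shift u R) - W r (shift u R)\<bar> \<le> 2 * enn2real (Wsup (shift u R))"
            using bnd[of k u] bnd[of r u] by linarith
          then show "norm (weight 1 u R * (W k (shift u R) - W r (shift u R))) \<le> 2 * ?w u"
            using mult_left_mono[OF _ weight_nonneg[of 1 u R]] by (fastforce simp: abs_mult)
        qed
      qed (use w in auto)
      moreover have "(\<lambda>k. incr n (\<lambda>S. W k S - W r S) R) \<longlonglongrightarrow> Winf R - W (n + r) R"
      proof -
        have "(\<lambda>k. W (k + n) R - W (n + r) R) \<longlonglongrightarrow> Winf R - W (n + r) R"
          by (intro tendsto_intros LIMSEQ_ignore_initial_segment W_tendsto supfin)
        then show ?thesis
          by (simp add: W_add_diff[OF elim(2), symmetric] add.commute)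
      qed
      ultimately show "Winf R - W (n + r) R = incr n (\<lambda>S. Winf S - W r S) R"
        by (rule LIMSEQ_unique[rotated])
    qed
  qed
qed

lemma
  shows integrable_Winf: "integrable Q Winf" and expectation_Winf: "(\<integral>R. Winf R \<partial>Q) = 1"
proof -
  have w: "integrable Q (\<lambda>R. enn2real (Wsup R))"
  proof (rule integrableI_nonneg)
    have "(\<integral>\<^sup>+R. ennreal (enn2real (Wsup R)) \<partial>Q) \<le> (\<integral>\<^sup>+R. Wsup R \<partial>Q)"
      by (intro nn_integral_mono) (metis ennreal_enn2real_if order_refl zero_le)
    then show "(\<integral>\<^sup>+R. ennreal (enn2real (Wsup R)) \<partial>Q) < \<infinity>"
      using nn_integral_Wsup by (rule le_less_trans)
  qed auto
  have dom: "AE R in Q. norm (W k R) \<le> enn2real (Wsup R)" for k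
    using AE_Wsup_finite
  proof eventually_elim
    case (elim R)
    then have "Wsup R < \<infinity>" by (metis shift_Nil)
    then show ?case using W_le_Wsup_real[of R k] W_nonneg[of k R] by simp
  qed
  show "integrable Q Winf"
    by (rule integrable_dominated_convergence[OF measurable_Winf measurable_W w AE_W_tendsto dom])
  have "(\<lambda>k. \<integral>R. W k R \<partial>Q) \<longlonglongrightarrow> (\<integral>R. Winf R \<partial>Q)"
    by (rule integral_dominated_convergence[OF measurable_Winf measurable_W w AE_W_tendsto dom])
  then show "(\<integral>R. Winf R \<partial>Q) = 1"
    unfolding expectation_W by (simp add: LIMSEQ_const_iff)
qed

lemma integrable_Winf_square: "integrable Q (\<lambda>R. (Winf R - 1)\<^sup>2)"
proof (rule integrableI_nonneg)
  have "(\<integral>\<^sup>+R. ennreal ((Winf R - 1)\<^sup>2) \<partial>Q) \<le> (\<integral>\<^sup>+R. liminf (\<lambda>k. ennreal ((W k R - 1)\<^sup>2)) \<partial>Q)"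
  proof (rule nn_integral_mono_AE, use AE_W_tendsto in eventually_elim)
    case (elim R)
    then have "(\<lambda>k. ennreal ((W k R - 1)\<^sup>2)) \<longlonglongrightarrow> ennreal ((Winf R - 1)\<^sup>2)"
      by (intro tendsto_intros)
    from lim_imp_Liminf[OF sequentially_bot this] show ?case by simp
  qed
  also have "\<dots> \<le> liminf (\<lambda>k. \<integral>\<^sup>+R. ennreal ((W k R - 1)\<^sup>2) \<partial>Q)"
    by (rule nn_integral_liminf) auto
  also have "\<dots> \<le> ennreal (\<sigma>2 / (1 - q))"
    by (intro Liminf_le always_eventually allI) (auto simp: W_square nn_integral_eq_integral intro!: ennreal_leI)
  finally show "(\<integral>\<^sup>+R. ennreal ((Winf R - 1)\<^sup>2) \<partial>Q) < \<infinity>"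
    by (auto simp: top_unique less_top[symmetric])
qed auto

section \<open>Variance and covariances of the tails\<close>

definition V :: real where "V = (\<integral>R. (Winf R - 1)\<^sup>2 \<partial>Q)"

lemma V_nonneg: "0 \<le> V" by (simp add: V_def)

lemma expectation_Winf_diff: "(\<integral>R. Winf R - 1 \<partial>Q) = 0"
  using integrable_Winf expectation_Winf Q.prob_space by simp

lemma Winf_moment:
  assumes [measurable]: "a \<in> borel_measurable Q" and a: "\<And>R R'. a (mix n R R') = a R"
  shows "(\<integral>\<^sup>+R. ennreal ((a R + (Winf R - W n R))\<^sup>2) \<partial>Q) = (\<integral>\<^sup>+R. ennreal ((a R)\<^sup>2) \<partial>Q) + ennreal (V * q ^ n)"
proof -
  have "(\<integral>\<^sup>+R. ennreal ((a R + (Winf R - W n R))\<^sup>2) \<partial>Q) = (\<integral>\<^sup>+R. ennreal ((a R + incr n (\<lambda>R. Winf R - 1) R)\<^sup>2) \<partial>Q)"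
  proof (rule nn_integral_cong_AE, use Winf_decomposition in eventually_elim)
    case (elim R)
    from elim[rule_format, of n 0] show ?case by simp
  qed
  also have "\<dots> = (\<integral>\<^sup>+R. ennreal ((a R)\<^sup>2) \<partial>Q) + ennreal (V * q ^ n)"
    by (rule martingale_moment) (auto simp: integrable_Winf_square expectation_Winf_diff V_def a)
  finally show ?thesis .
qed

text \<open>Splitting at the first generation gives the equation
  \<open>V = \<sigma>2 + V * q\<close>.\<close>

lemma V_eq: "V = \<sigma>2 / (1 - q)"
proof -
  have "ennreal V = (\<integral>\<^sup>+R. ennreal (((W 1 R - 1) + (Winf R - W 1 R))\<^sup>2) \<partial>Q)"
    unfolding V_def using integrable_Winf_square by (subst nn_integral_eq_integral[symmetric]) (auto simp: algebra_simps)
  also have "\<dots> = (\<integral>\<^sup>+R. ennreal ((W 1 R - 1)\<^sup>2) \<partial>Q) + ennreal (V * q ^ 1)"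
    by (rule Winf_moment) (auto simp: W_mix)
  also have "\<dots> = ennreal (\<sigma>2 + V * q)"
    using integrable_W1_square V_nonneg q_pos by (simp add: nn_integral_eq_integral \<sigma>2_def ennreal_plus)
  finally have "V = \<sigma>2 + V * q"
    using V_nonneg \<sigma>2_nonneg q_pos by (subst (asm) ennreal_inj) auto
  then show ?thesis using q_less by (simp add: field_simps)
qed

lemma Winf_increment_square:
  shows "integrable Q (\<lambda>R. (Winf R - W n R)\<^sup>2)" and "(\<integral>R. (Winf R - W n R)\<^sup>2 \<partial>Q) = V * q ^ n"
proof -
  have "(\<integral>\<^sup>+R. ennreal ((Winf R - W n R)\<^sup>2) \<partial>Q) = ennreal (V * q ^ n)"
    using Winf_moment[of "\<lambda>_. 0" n] by simp
  from integrable_nn_real[OF _ _ this] V_nonneg q_pos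
  show "integrable Q (\<lambda>R. (Winf R - W n R)\<^sup>2)" "(\<integral>R. (Winf R - W n R)\<^sup>2 \<partial>Q) = V * q ^ n" by auto
qed

text \<open>Polarisation: the product is expressed through the squares of the two tails and of their
  difference \<open>W s - W r\<close>. Orthogonality of the later tail to that difference gives the
  latter the second moment \<open>V * q ^ r - V * q ^ s\<close>.\<close>

lemma Winf_covariance_le:
  assumes "r \<le> s"
  shows "integrable Q (\<lambda>R. (Winf R - W r R) * (Winf R - W s R)) \<and>
    (\<integral>R. (Winf R - W r R) * (Winf R - W s R) \<partial>Q) = V * q ^ s"
proof -
  let ?A = "\<lambda>R. (W s R - W r R)\<^sup>2"
  have nn: "ennreal (V * q ^ r) = (\<integral>\<^sup>+R. ennreal (?A R) \<partial>Q) + ennreal (V * q ^ s)"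
  proof -
    have "ennreal (V * q ^ r) = (\<integral>\<^sup>+R. ennreal ((W s R - W r R + (Winf R - W s R))\<^sup>2) \<partial>Q)"
      using Winf_increment_square[of r] by (simp add: nn_integral_eq_integral)
    also have "\<dots> = (\<integral>\<^sup>+R. ennreal (?A R) \<partial>Q) + ennreal (V * q ^ s)"
      by (rule Winf_moment) (use assms in \<open>auto simp: W_mix\<close>)
    finally show ?thesis .
  qed
  have "(\<integral>\<^sup>+R. ennreal (?A R) \<partial>Q) \<le> ennreal (V * q ^ r)"
    unfolding nn by simp
  then have "(\<integral>\<^sup>+R. ennreal (?A R) \<partial>Q) < \<infinity>"
    by (rule le_less_trans) simp
  then have iA: "integrable Q ?A" by (intro integrableI_nonneg) auto
  with nn have "ennreal (V * q ^ r) = ennreal ((\<integral>R. ?A R \<partial>Q) + V * q ^ s)"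
    using V_nonneg q_pos by (simp add: nn_integral_eq_integral ennreal_plus)
  then have A: "(\<integral>R. ?A R \<partial>Q) = V * q ^ r - V * q ^ s"
    using V_nonneg q_pos by (subst (asm) ennreal_inj) auto
  have eq: "(Winf R - W r R) * (Winf R - W s R) = ((Winf R - W r R)\<^sup>2 - ?A R + (Winf R - W s R)\<^sup>2) / 2" for R
    by (simp add: power2_eq_square algebra_simps)
  show ?thesis
    unfolding eq using iA Winf_increment_square[of r] Winf_increment_square[of s] A by simp
qed

lemma Winf_covariance:
  shows "integrable Q (\<lambda>R. (Winf R - W r R) * (Winf R - W s R))"
    and "(\<integral>R. (Winf R - W r R) * (Winf R - W s R) \<partial>Q) = V * q ^ max r s"
  using Winf_covariance_le[of r s] Winf_covariance_le[of s r]
  by (cases "r \<le> s"; simp add: max_def mult.commute)+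

text \<open>The contribution of one subtree to a linear functional of the fluctuations. The part of
  the normalisation that depends on \<open>n\<close> is common to all coordinates and is left to the
  coefficients.\<close>

definition tail_comb :: "nat \<Rightarrow> (nat \<Rightarrow> real) \<Rightarrow> repro_array \<Rightarrow> real" where
  "tail_comb k t R = (\<Sum>r<k. t r * ((Winf R - W r R) / q powr (real r / 2)))"

lemma measurable_tail_comb [measurable]: "tail_comb k t \<in> borel_measurable Q"
  unfolding tail_comb_def[abs_def] by measurable

lemma tail_comb_mean: "(\<integral>R. tail_comb k t R \<partial>Q) = 0"
  unfolding tail_comb_def using integrable_Winf integrable_W expectation_Winf expectation_W
  by (subst Bochner_Integration.integral_sum) auto

lemma tail_comb_square:
  shows "integrable Q (\<lambda>R. (tail_comb k t R)\<^sup>2)"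
    and "(\<integral>R. (tail_comb k t R)\<^sup>2 \<partial>Q) = V * (\<Sum>r<k. \<Sum>s<k. t r * t s * q powr (\<bar>real r - real s\<bar> / 2))"
proof -
  let ?c = "\<lambda>r s. t r * t s / (q powr (real r / 2) * q powr (real s / 2))"
  have eq: "(tail_comb k t R)\<^sup>2 = (\<Sum>r<k. \<Sum>s<k. ?c r s * ((Winf R - W r R) * (Winf R - W s R)))" for R
    by (simp add: tail_comb_def power2_eq_square sum_product mult_ac)
  show "integrable Q (\<lambda>R. (tail_comb k t R)\<^sup>2)"
    unfolding eq by (intro Bochner_Integration.integrable_sum integrable_mult_right Winf_covariance)
  \<comment> \<open>The source of the limiting covariance: the maximum of \<open>r\<close> and
    \<open>s\<close> exceeds their average by half their distance.\<close>
  have pw: "q ^ max r s / (q powr (real r / 2) * q powr (real s / 2)) = q powr (\<bar>real r - real s\<bar> / 2)" for r s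
  proof -
    have "q ^ max r s = q powr real (max r s)" using q_pos by (simp add: powr_realpow)
    then have "q ^ max r s / (q powr (real r / 2) * q powr (real s / 2)) = q powr (real (max r s) - (real r / 2 + real s / 2))"
      by (simp add: powr_diff powr_add)
    also have "real (max r s) - (real r / 2 + real s / 2) = \<bar>real r - real s\<bar> / 2"
      by (auto simp: max_def field_simps)
    finally show ?thesis .
  qed
  have "(\<integral>R. (tail_comb k t R)\<^sup>2 \<partial>Q) = (\<Sum>r<k. \<Sum>s<k. ?c r s * (V * q ^ max r s))"
    unfolding eq by (simp add: Winf_covariance Bochner_Integration.integral_sum Bochner_Integration.integrable_sum)
  also have "\<dots> = (\<Sum>r<k. \<Sum>s<k. V * (t r * t s * q powr (\<bar>real r - real s\<bar> / 2)))"
    by (intro sum.cong refl) (simp add: pw[symmetric])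
  also have "\<dots> = V * (\<Sum>r<k. \<Sum>s<k. t r * t s * q powr (\<bar>real r - real s\<bar> / 2))"
    by (simp add: sum_distrib_left)
  finally show "(\<integral>R. (tail_comb k t R)\<^sup>2 \<partial>Q) = V * (\<Sum>r<k. \<Sum>s<k. t r * t s * q powr (\<bar>real r - real s\<bar> / 2))" .
qed

end

section \<open>The second moment martingale\<close>

text \<open>The remainder of the exponential grows with the scale for either sign of
  \<open>z\<close>. A gain computed at a threshold weight is thus a lower bound for all larger
  weights.\<close>

lemma exp_remainder_mono:
  fixes z :: real
  assumes "0 \<le> e" "e \<le> s"
  shows "exp (- (e * z)) - 1 + e * z \<le> exp (- (s * z)) - 1 + s * z"
proof -
  have "\<exists>y. DERIV (\<lambda>s. exp (- (s * z)) - 1 + s * z) x :> y \<and> 0 \<le> y" if "e \<le> x" "x \<le> s" for x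
  proof (intro exI conjI)
    show "DERIV (\<lambda>s. exp (- (s * z)) - 1 + s * z) x :> z * (1 - exp (- (x * z)))"
      by (auto intro!: derivative_eq_intros simp: algebra_simps)
    have "0 \<le> x" using assms that by simp
    then show "0 \<le> z * (1 - exp (- (x * z)))"
      by (cases "0 \<le> z") (auto simp: mult_nonneg_nonneg mult_nonpos_nonpos mult_nonneg_nonpos)
  qed
  then show ?thesis
    using DERIV_nonneg_imp_nondecreasing[OF assms(2), of "\<lambda>s. exp (- (s * z)) - 1 + s * z"] by blast
qed

lemma exp_remainder_eq_0:
  fixes z :: real
  assumes "exp (- z) - 1 + z = 0" shows "z = 0"
proof -
  have "ln (exp (- z)) = exp (- z) - 1" using assms by simp
  then have "exp (- z) = 1" by (intro ln_eq_minus_one) auto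
  then show ?thesis by simp
qed

text \<open>Every entry is at most \<open>q\<close>, so each square is at most
  \<open>q * x i\<close>, and index 0 alone accounts for the deficit \<open>x 0 * (q - x 0)\<close>.
  The second claim makes this deficit positive as soon as \<open>x 0\<close> and \<open>x 1\<close>
  are.\<close>

lemma sum_squares_count_space:
  fixes x :: "nat \<Rightarrow> real"
  assumes x: "integrable (count_space UNIV) x" and nn: "\<And>i. 0 \<le> x i"
    and q: "(\<integral>i. x i \<partial>count_space UNIV) = q"
  shows "(\<integral>i. (x i)\<^sup>2 \<partial>count_space UNIV) \<le> q\<^sup>2 - x 0 * (q - x 0)" and "x 0 + x 1 \<le> q"
proof -
  have le: "x i \<le> q" for i
    using le_integral_count_space[OF x nn, of i] q by simp
  have ind: "integrable (count_space UNIV) (\<lambda>i. c * indicator {j} i :: real)" for c and j :: nat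
    by (intro integrable_mult_right integrable_real_indicator) auto
  have iind: "(\<integral>i. c * indicator {j} i \<partial>count_space UNIV) = (c :: real)" for c and j :: nat
    by (subst Bochner_Integration.integral_mult_right) (auto simp: measure_count_space intro!: integrable_real_indicator)
  have "(\<integral>i. (x i)\<^sup>2 \<partial>count_space UNIV) \<le> (\<integral>i. q * x i - (x 0 * (q - x 0)) * indicator {0} i \<partial>count_space UNIV)"
  proof (rule integral_mono)
    show "integrable (count_space UNIV) (\<lambda>i. (x i)\<^sup>2)"
      by (rule integrable_count_space_square[OF x nn])
    show "integrable (count_space UNIV) (\<lambda>i. q * x i - (x 0 * (q - x 0)) * indicator {0} i)"
      using x ind by (intro Bochner_Integration.integrable_diff) auto
    show "(x i)\<^sup>2 \<le> q * x i - (x 0 * (q - x 0)) * indicator {0} i" for i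
      using mult_right_mono[OF le[of i] nn[of i]]
      by (cases "i = 0") (auto simp: power2_eq_square algebra_simps)
  qed
  also have "\<dots> = q * q - x 0 * (q - x 0)"
    using x q ind by (subst Bochner_Integration.integral_diff) (auto simp: iind)
  finally show "(\<integral>i. (x i)\<^sup>2 \<partial>count_space UNIV) \<le> q\<^sup>2 - x 0 * (q - x 0)"
    by (simp add: power2_eq_square)
  have "(\<integral>i. x 0 * indicator {0} i + x 1 * indicator {1::nat} i \<partial>count_space UNIV) \<le> (\<integral>i. x i \<partial>count_space UNIV)"
    by (rule integral_mono[OF Bochner_Integration.integrable_add[OF ind ind] x]) (use nn in \<open>auto simp: indicator_def\<close>)
  then show "x 0 + x 1 \<le> q"
    unfolding q by (subst (asm) Bochner_Integration.integral_add) (auto simp: iind intro!: ind)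
qed

locale supercritical_cascade = cascade_L2 +
  assumes supercrit: "(\<integral>\<^sup>+R. ennreal_of_enat (fst (R [])) \<partial>Q) > 1"
begin

definition Y :: "nat \<Rightarrow> repro_array \<Rightarrow> real" where
  "Y n R = enn2real (total 2 n R) / q ^ n"

text \<open>The pullback along overwriting everything from generation \<open>n\<close> on by a
  constant array. The filler is arbitrary; what matters is that membership in such events becomes
  invariant under \<open>mix n\<close>.\<close>

definition past :: "nat \<Rightarrow> repro_array measure" where
  "past n = vimage_algebra UNIV (\<lambda>R. mix n R (\<lambda>_. (0, \<lambda>_. 0))) Q"

lemma measurable_Y [measurable]: "Y n \<in> borel_measurable Q"
  unfolding Y_def[abs_def] by measurable

lemma Y_nonneg: "0 \<le> Y n R"
  using q_pos by (simp add: Y_def)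

lemma Y_mix: "m \<le> n \<Longrightarrow> Y m (mix n R R') = Y m R"
  by (simp add: Y_def total_mix)

lemma space_past [simp]: "space (past n) = UNIV"
  by (simp add: past_def)

lemma sets_past: "sets (past n) = {(\<lambda>R. mix n R (\<lambda>_. (0, \<lambda>_. 0))) -` A | A. A \<in> sets Q}"
  unfolding past_def by (subst sets_vimage_algebra2) auto

lemma past_sets_Q: "A \<in> sets (past n) \<Longrightarrow> A \<in> sets Q"
proof -
  have *: "(\<lambda>R. mix n R (\<lambda>_. (0, \<lambda>_. 0))) \<in> Q \<rightarrow>\<^sub>M Q" by (rule measurable_mix) auto
  assume "A \<in> sets (past n)"
  then show ?thesis using measurable_sets[OF *] by (auto simp: sets_past)
qed

lemma past_mix: "A \<in> sets (past n) \<Longrightarrow> mix n R R' \<in> A \<longleftrightarrow> R \<in> A"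
  by (auto simp: sets_past)

lemma sets_past_mono: "sets (past n) \<subseteq> sets (past (Suc n))"
proof
  fix A assume A: "A \<in> sets (past n)"
  let ?z = "\<lambda>_::nat list. (0::enat, \<lambda>_::nat. 0::real)"
  have "R \<in> A \<longleftrightarrow> mix (Suc n) R ?z \<in> A" for R
    using past_mix[OF A, of R ?z] past_mix[OF A, of "mix (Suc n) R ?z" ?z] by (simp add: mix_mix_le)
  then have "A = (\<lambda>R. mix (Suc n) R ?z) -` A" by auto
  with past_sets_Q[OF A] show "A \<in> sets (past (Suc n))" by (auto simp: sets_past)
qed

lemma measurable_past:
  fixes f :: "_ \<Rightarrow> real"
  assumes f: "f \<in> borel_measurable Q" and inv: "\<And>R R'. f (mix n R R') = f R"
  shows "f \<in> borel_measurable (past n)"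
proof -
  have "(\<lambda>R. mix n R (\<lambda>_. (0, \<lambda>_. 0))) \<in> past n \<rightarrow>\<^sub>M Q"
    unfolding past_def by (rule measurable_vimage_algebra1) auto
  from measurable_compose[OF this f] show ?thesis by (simp add: inv)
qed

lemma AE_total_2_finite: "AE R in Q. \<forall>u n. total 2 n (shift u R) < \<infinity>"
  using AE_total_finite by eventually_elim (intro allI total_2_finite, blast)

lemma ennreal_Y: "total 2 n R < \<infinity> \<Longrightarrow> ennreal (Y n R) = ennreal (1 / q ^ n) * total 2 n R"
  using q_pos by (simp add: Y_def ennreal_mult'[symmetric] less_top divide_inverse mult.commute ennreal_mult'')

text \<open>The martingale property: given generation \<open>n\<close>, each squared weight is
  multiplied by a sum over children of mean \<open>q\<close>, which the normalisation
  removes.\<close>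

lemma nn_integral_Y_past:
  assumes A: "A \<in> sets (past n)"
  shows "(\<integral>\<^sup>+R. indicator A R * ennreal (Y (Suc n) R) \<partial>Q) = (\<integral>\<^sup>+R. indicator A R * ennreal (Y n R) \<partial>Q)"
proof -
  have [measurable]: "A \<in> sets Q" by (rule past_sets_Q[OF A])
  have "(\<integral>\<^sup>+R. indicator A R * ennreal (Y (Suc n) R) \<partial>Q) = (\<integral>\<^sup>+R. indicator A R * (ennreal (1 / q ^ Suc n) * total 2 (n + 1) R) \<partial>Q)"
  proof (rule nn_integral_cong_AE, use AE_total_2_finite in eventually_elim)
    case (elim R)
    then have "total 2 (Suc n) R < \<infinity>" by (metis shift_Nil)
    then show ?case by (simp add: ennreal_Y del: power_Suc)
  qed
  also have "\<dots> = (\<integral>\<^sup>+R. \<integral>\<^sup>+R'. indicator A R * (ennreal (1 / q ^ Suc n) *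
      (\<integral>\<^sup>+u. ennreal (weight 2 u R) * total 2 1 (shift u R') \<partial>count_space (words n))) \<partial>Q \<partial>Q)"
  proof (subst nn_integral_mix[of _ n])
    show "(\<integral>\<^sup>+R. \<integral>\<^sup>+R'. indicator A (mix n R R') * (ennreal (1 / q ^ Suc n) * total 2 (n + 1) (mix n R R')) \<partial>Q \<partial>Q)
      = (\<integral>\<^sup>+R. \<integral>\<^sup>+R'. indicator A R * (ennreal (1 / q ^ Suc n) *
      (\<integral>\<^sup>+u. ennreal (weight 2 u R) * total 2 1 (shift u R') \<partial>count_space (words n))) \<partial>Q \<partial>Q)"
      unfolding total_add
      by (intro nn_integral_cong arg_cong2[where f="(*)"] refl)
         (auto simp: indicator_def past_mix[OF A] words_def weight_mix shift_mix)
  qed measurable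
  also have "\<dots> = (\<integral>\<^sup>+R. indicator A R * (ennreal (1 / q ^ Suc n) * (total 2 n R * ennreal q)) \<partial>Q)"
  proof (intro nn_integral_cong)
    fix R
    have m: "(\<lambda>R'. \<integral>\<^sup>+u. ennreal (weight 2 u R) * total 2 1 (shift u R') \<partial>count_space (words n)) \<in> borel_measurable Q"
      by (intro borel_measurable_nn_integral_count_space) auto
    have "(\<integral>\<^sup>+R'. total 2 1 R' \<partial>Q) = ennreal q"
      using nn_integral_total[of 2 1] by (simp add: mom_2)
    then have "(\<integral>\<^sup>+R'. \<integral>\<^sup>+u. ennreal (weight 2 u R) * total 2 1 (shift u R') \<partial>count_space (words n) \<partial>Q)
        = (\<integral>\<^sup>+u. ennreal (weight 2 u R) * ennreal q \<partial>count_space (words n))"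
      by (subst nn_integral_count_space_nn_integral) (auto simp: nn_integral_cmult nn_integral_shift)
    also have "\<dots> = total 2 n R * ennreal q"
      by (simp add: nn_integral_multc total_def)
    finally have "(\<integral>\<^sup>+R'. \<integral>\<^sup>+u. ennreal (weight 2 u R) * total 2 1 (shift u R') \<partial>count_space (words n) \<partial>Q) = total 2 n R * ennreal q" .
    then show "(\<integral>\<^sup>+R'. indicator A R * (ennreal (1 / q ^ Suc n) *
      (\<integral>\<^sup>+u. ennreal (weight 2 u R) * total 2 1 (shift u R') \<partial>count_space (words n))) \<partial>Q) =
      indicator A R * (ennreal (1 / q ^ Suc n) * (total 2 n R * ennreal q))"
      using m by (simp add: nn_integral_cmult)
  qed
  also have "\<dots> = (\<integral>\<^sup>+R. indicator A R * ennreal (Y n R) \<partial>Q)"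
  proof (rule nn_integral_cong_AE, use AE_total_2_finite in eventually_elim)
    case (elim R)
    then have *: "total 2 n R < \<infinity>" by (metis shift_Nil)
    have "ennreal (1 / q ^ Suc n) * (total 2 n R * ennreal q) = (ennreal (1 / q ^ Suc n) * ennreal q) * total 2 n R"
      by (simp add: mult_ac)
    also have "ennreal (1 / q ^ Suc n) * ennreal q = ennreal (1 / q ^ n)"
      using q_pos by (simp add: ennreal_mult[symmetric])
    finally show ?case using ennreal_Y[OF *] by simp
  qed
  finally show ?thesis .
qed

lemma nn_integral_Y: "(\<integral>\<^sup>+R. ennreal (Y n R) \<partial>Q) = 1"
proof (induction n)
  case 0
  then show ?case using Q.emeasure_space_1 by (simp add: Y_def)
next
  case (Suc n)
  then show ?case using nn_integral_Y_past[of UNIV n] sets.top[of "past n"] by simp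
qed

lemma integrable_Y: "integrable Q (Y n)"
  by (rule integrableI_nonneg) (auto simp: Y_nonneg nn_integral_Y)

lemma expectation_Y: "(\<integral>R. Y n R \<partial>Q) = 1"
  by (subst integral_eq_nn_integral) (auto simp: Y_nonneg nn_integral_Y)

lemma AE_Y_convergent: "AE R in Q. convergent (\<lambda>n. Y n R)"
proof (rule Q.nonneg_supermartingale_convergent[where F=past])
  show "subalgebra Q (past n)" for n
    by (auto simp: subalgebra_def past_sets_Q)
  show "Y n \<in> borel_measurable (past n)" for n
    by (rule measurable_past) (auto simp: Y_mix)
  show "(LINT R:A|Q. Y (Suc n) R) \<le> (LINT R:A|Q. Y n R)" if A: "A \<in> sets (past n)" for n A
  proof -
    have "(LINT R:A|Q. Y m R) = enn2real (\<integral>\<^sup>+R. indicator A R * ennreal (Y m R) \<partial>Q)" for m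
      unfolding set_lebesgue_integral_def
      using past_sets_Q[OF A]
      by (subst integral_eq_nn_integral) (auto simp: Y_nonneg indicator_def intro!: arg_cong[where f=enn2real] nn_integral_cong)
    then show ?thesis using nn_integral_Y_past[OF A] by simp
  qed
qed (auto simp: sets_past_mono integrable_Y Y_nonneg)

section \<open>Disappearance of the largest squared weight\<close>

definition large :: "nat \<Rightarrow> real \<Rightarrow> repro_array \<Rightarrow> bool" where
  "large n \<epsilon> R \<longleftrightarrow> (\<exists>u\<in>words n. \<epsilon> \<le> weight 2 u R / q ^ n)"

lemma measurable_large [measurable]: "Measurable.pred Q (large n \<epsilon>)"
proof -
  have "{R\<in>space Q. \<exists>u\<in>words n. \<epsilon> \<le> weight 2 u R / q ^ n} \<in> sets Q"
    by (intro sets.sets_Collect_countable_Ex'; (measurable | simp))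
  then show ?thesis by (simp add: pred_def large_def)
qed

lemma Y_Suc:
  assumes fin: "\<forall>u n. total 2 n (shift u R) < \<infinity>"
  shows "Y (Suc n) R = (\<integral>u. weight 2 u R / q ^ n * Y 1 (shift u R) \<partial>count_space (words n))"
proof -
  have "(\<integral>u. weight 2 u R * enn2real (total 2 1 (shift u R)) \<partial>count_space (words n)) = enn2real (total 2 (n + 1) R)"
    unfolding total_add using fin
    by (subst integral_eq_nn_integral) (auto simp: ennreal_mult less_top intro!: arg_cong[where f=enn2real] nn_integral_cong)
  moreover have "weight 2 u R / q ^ n * Y 1 (shift u R) = (weight 2 u R * enn2real (total 2 1 (shift u R))) / q ^ Suc n" for u
    using q_pos by (simp add: Y_def)
  ultimately show ?thesis by (simp add: Y_def)
qed

text \<open>Given the past, \<open>Y (Suc n)\<close> is a weighted sum of independent copies of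
  \<open>Y 1\<close>, and its Laplace transform is at least \<open>exp (- Y n)\<close> times any
  finite product of factors that are at least 1. One large individual supplies a factor of at least
  \<open>1 + c\<close>, with the same \<open>c\<close> for all weights from
  \<open>\<epsilon>\<close> on.\<close>

lemma laplace_Y_gain:
  assumes "0 \<le> \<epsilon>"
  defines "c \<equiv> (\<integral>R. exp (- (\<epsilon> * (Y 1 R - 1))) - 1 + \<epsilon> * (Y 1 R - 1) \<partial>Q)"
  shows "(\<integral>\<^sup>+R. ennreal (exp (- Y n R)) \<partial>Q) + (\<integral>\<^sup>+R. ennreal (c * exp (- Y n R)) * indicator {R. large n \<epsilon> R} R \<partial>Q)
    \<le> (\<integral>\<^sup>+R. ennreal (exp (- Y (Suc n) R)) \<partial>Q)"
proof -
  let ?E = "\<lambda>R. ennreal (exp (- (\<integral>u. weight 2 u R / q ^ n * Y 1 (shift u R) \<partial>count_space (words n))))"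
  have iexp: "integrable Q (\<lambda>R. exp (- (s * Y 1 R)))" if "0 \<le> s" for s
    by (rule Q.integrable_const_bound[where B=1]) (use that Y_nonneg in auto)
  have iexp': "integrable Q (\<lambda>R. exp (- (s * (Y 1 R - 1))))" if "0 \<le> s" for s
    using integrable_mult_right[OF iexp[OF that], of "exp s"] by (simp add: exp_add[symmetric] algebra_simps)
  have iY1: "integrable Q (Y 1)" by (rule integrable_Y)
  have c0: "0 \<le> c"
    unfolding c_def by (intro integral_nonneg_AE AE_I2) (use exp_remainder_mono[OF order_refl assms(1)] in simp)
  have gain: "1 + c \<le> exp s * (\<integral>R. exp (- (s * Y 1 R)) \<partial>Q)" if s: "\<epsilon> \<le> s" for s
  proof -
    have "c \<le> (\<integral>R. exp (- (s * (Y 1 R - 1))) - 1 + s * (Y 1 R - 1) \<partial>Q)"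
      unfolding c_def using iexp' s assms(1) iY1
      by (intro integral_mono exp_remainder_mono Bochner_Integration.integrable_add Bochner_Integration.integrable_diff integrable_mult_right) auto
    also have "\<dots> = (\<integral>R. exp (- (s * (Y 1 R - 1))) \<partial>Q) - 1"
      using iexp'[of s] s assms(1) iY1 expectation_Y[of 1] Q.prob_space by simp
    also have "(\<integral>R. exp (- (s * (Y 1 R - 1))) \<partial>Q) = (\<integral>R. exp s * exp (- (s * Y 1 R)) \<partial>Q)"
      by (simp add: exp_add[symmetric] algebra_simps)
    also have "\<dots> = exp s * (\<integral>R. exp (- (s * Y 1 R)) \<partial>Q)" by simp
    finally show ?thesis by simp
  qed
  have "(\<integral>\<^sup>+R. ennreal (exp (- Y n R)) \<partial>Q) + (\<integral>\<^sup>+R. ennreal (c * exp (- Y n R)) * indicator {R. large n \<epsilon> R} R \<partial>Q)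
      = (\<integral>\<^sup>+R. ennreal (exp (- Y n R)) + ennreal (c * exp (- Y n R)) * indicator {R. large n \<epsilon> R} R \<partial>Q)"
    by (rule nn_integral_add[symmetric]) (auto simp: pred_def[symmetric] intro!: borel_measurable_times borel_measurable_indicator measurable_large[unfolded pred_def space_Q, simplified])
  also have "\<dots> \<le> (\<integral>\<^sup>+R. \<integral>\<^sup>+R'. ennreal (exp (- (\<integral>u. weight 2 u R / q ^ n * Y 1 (shift u R') \<partial>count_space (words n)))) \<partial>Q \<partial>Q)"
  proof (rule nn_integral_mono_AE, use AE_total_2_finite in eventually_elim)
    case (elim R)
    then have fin: "total 2 n R < \<infinity>" by (metis shift_Nil)
    let ?p = "\<lambda>u. weight 2 u R / q ^ n"
    have p0: "0 \<le> ?p u" for u using q_pos by simp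
    have ip: "integrable (count_space (words n)) ?p"
      using fin unfolding total_def by (intro Bochner_Integration.integrable_divide integrableI_nonneg) auto
    have sp: "(\<integral>u. ?p u \<partial>count_space (words n)) = Y n R"
    proof -
      have "(\<integral>u. weight 2 u R \<partial>count_space (words n)) = enn2real (total 2 n R)"
        unfolding total_def by (rule integral_eq_nn_integral) auto
      then show ?thesis by (simp add: Y_def)
    qed
    have ge: "(\<Prod>j\<in>J. exp (?p j) * (\<integral>R'. exp (- (?p j * Y 1 (shift j R'))) \<partial>Q)) * exp (- Y n R)
        \<le> (\<integral>R'. exp (- (\<integral>u. ?p u * Y 1 (shift u R') \<partial>count_space (words n))) \<partial>Q)"
      if "J \<subseteq> words n" "finite J" for J
      unfolding sp[symmetric]
      by (rule Q.laplace_weighted_sum_ge[OF indep_vars_shift])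
         (use that p0 ip in \<open>auto simp: Y_nonneg integral_shift expectation_Y intro!: integrable_shift integrable_Y\<close>)
    have "exp (- Y n R) + (c * exp (- Y n R)) * indicator {R. large n \<epsilon> R} R
        \<le> (\<integral>R'. exp (- (\<integral>u. ?p u * Y 1 (shift u R') \<partial>count_space (words n))) \<partial>Q)"
    proof (cases "large n \<epsilon> R")
      case True
      then obtain u where u: "u \<in> words n" "\<epsilon> \<le> ?p u" by (auto simp: large_def)
      have "(1 + c) * exp (- Y n R) \<le> exp (?p u) * (\<integral>R'. exp (- (?p u * Y 1 (shift u R'))) \<partial>Q) * exp (- Y n R)"
        using gain[OF u(2)] integral_shift[of "\<lambda>R. exp (- (?p u * Y 1 R))" u]
        by (intro mult_right_mono) auto
      also have "\<dots> \<le> (\<integral>R'. exp (- (\<integral>u. ?p u * Y 1 (shift u R') \<partial>count_space (words n))) \<partial>Q)"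
        using ge[of "{u}"] u by simp
      finally show ?thesis using True by (simp add: algebra_simps)
    next
      case False
      then show ?thesis using ge[of "{}"] by simp
    qed
    moreover have "(\<integral>\<^sup>+R'. ennreal (exp (- (\<integral>u. ?p u * Y 1 (shift u R') \<partial>count_space (words n)))) \<partial>Q)
      = ennreal (\<integral>R'. exp (- (\<integral>u. ?p u * Y 1 (shift u R') \<partial>count_space (words n))) \<partial>Q)"
    proof (intro nn_integral_eq_integral Q.integrable_const_bound[where B=1] AE_I2)
      have [measurable]: "(\<lambda>R'. \<integral>u. ?p u * Y 1 (shift u R') \<partial>count_space (words n)) \<in> borel_measurable Q"
        by (intro borel_measurable_integral_count_space) auto
      show "(\<lambda>R'. exp (- (\<integral>u. ?p u * Y 1 (shift u R') \<partial>count_space (words n)))) \<in> borel_measurable Q"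
        by measurable
    qed (use q_pos in \<open>auto intro!: integral_nonneg_AE AE_I2 divide_nonneg_nonneg mult_nonneg_nonneg Y_nonneg\<close>)
    ultimately show ?case
      using c0 by (cases "large n \<epsilon> R") (auto simp: ennreal_plus[symmetric] simp del: ennreal_plus intro!: ennreal_leI)
  qed
  also have "\<dots> = (\<integral>\<^sup>+R. \<integral>\<^sup>+R'. ?E (mix n R R') \<partial>Q \<partial>Q)"
    by (intro nn_integral_cong arg_cong[where f="\<lambda>x. ennreal (exp (- x))"] Bochner_Integration.integral_cong refl)
       (auto simp: words_def weight_mix shift_mix)
  also have "\<dots> = (\<integral>\<^sup>+R. ?E R \<partial>Q)"
  proof (rule nn_integral_mix[symmetric])
    have [measurable]: "(\<lambda>R. \<integral>u. weight 2 u R / q ^ n * Y 1 (shift u R) \<partial>count_space (words n)) \<in> borel_measurable Q"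
      by (intro borel_measurable_integral_count_space) auto
    show "?E \<in> borel_measurable Q" by measurable
  qed
  also have "\<dots> = (\<integral>\<^sup>+R. ennreal (exp (- Y (Suc n) R)) \<partial>Q)"
  proof (rule nn_integral_cong_AE, use AE_total_2_finite in eventually_elim)
    case (elim R)
    from Y_Suc[OF this, of n] show ?case by simp
  qed
  finally show ?thesis .
qed

text \<open>
  The bounded submartingale \<open>exp (- Y n)\<close> gains at least \<open>c exp (- Y n)\<close> whenever some individual
  is large, so the sum of these gains is integrable.
\<close>

lemma AE_not_large_nonconstant:
  assumes nonconst: "\<not> (AE R in Q. Y 1 R = 1)" and \<epsilon>: "0 < \<epsilon>"
  shows "AE R in Q. \<forall>\<^sub>F n in sequentially. \<not> large n \<epsilon> R"
proof -
  let ?h = "\<lambda>R. exp (- (\<epsilon> * (Y 1 R - 1))) - 1 + \<epsilon> * (Y 1 R - 1)"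
  define c where "c = (\<integral>R. ?h R \<partial>Q)"
  have h0: "0 \<le> ?h R" for R
    using exp_ge_add_one_self[of "- (\<epsilon> * (Y 1 R - 1))"] by simp
  have ih: "integrable Q ?h"
  proof -
    have "integrable Q (\<lambda>R. exp (- (\<epsilon> * (Y 1 R - 1))))"
    proof (rule Q.integrable_const_bound[where B="exp \<epsilon>"])
      show "AE R in Q. norm (exp (- (\<epsilon> * (Y 1 R - 1)))) \<le> exp \<epsilon>"
        using \<epsilon> Y_nonneg by (intro AE_I2) (simp add: algebra_simps)
    qed measurable
    then show ?thesis
      using integrable_Y[of 1] by (intro Bochner_Integration.integrable_add Bochner_Integration.integrable_diff integrable_mult_right) auto
  qed
  \<comment> \<open>\<open>c\<close> is the mean of a nonnegative function that vanishes only where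
    \<open>Y 1 = 1\<close>.\<close>
  have "c \<noteq> 0"
  proof
    assume "c = 0"
    then have "AE R in Q. ?h R = 0"
      unfolding c_def using integral_nonneg_eq_0_iff_AE[OF ih] h0 by simp
    then have "AE R in Q. Y 1 R = 1"
    proof eventually_elim
      case (elim R)
      from exp_remainder_eq_0[OF this] \<epsilon> show ?case by simp
    qed
    with nonconst show False by simp
  qed
  moreover have "0 \<le> c" unfolding c_def using h0 by (intro integral_nonneg_AE AE_I2)
  ultimately have c: "0 < c" by simp
  define g where "g n = (\<integral>\<^sup>+R. ennreal (exp (- Y n R)) \<partial>Q)" for n
  define d where "d n = (\<lambda>R. ennreal (c * exp (- Y n R)) * indicator {R. large n \<epsilon> R} R)" for n
  have [measurable]: "d n \<in> borel_measurable Q" for n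
    unfolding d_def using measurable_large[of n \<epsilon>]
    by (intro borel_measurable_times_ennreal borel_measurable_indicator) (auto simp: pred_def)
  have step: "g n + (\<integral>\<^sup>+R. d n R \<partial>Q) \<le> g (Suc n)" for n
    using laplace_Y_gain[of \<epsilon> n] \<epsilon> unfolding g_def d_def c_def by simp
  have g1: "g n \<le> 1" for n
  proof -
    have "g n \<le> (\<integral>\<^sup>+R. 1 \<partial>Q)"
      unfolding g_def using Y_nonneg by (intro nn_integral_mono) (auto intro!: ennreal_leI simp flip: ennreal_1)
    then show ?thesis using Q.emeasure_space_1 by simp
  qed
  have "(\<Sum>k<n. \<integral>\<^sup>+R. d k R \<partial>Q) \<le> g n" for n
  proof (induction n)
    case (Suc n)
    then have "(\<Sum>k<Suc n. \<integral>\<^sup>+R. d k R \<partial>Q) \<le> g n + (\<integral>\<^sup>+R. d n R \<partial>Q)"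
      by (simp add: add_right_mono)
    with step[of n] show ?case by (rule order_trans[rotated])
  qed simp
  then have "(\<Sum>k<n. \<integral>\<^sup>+R. d k R \<partial>Q) \<le> 1" for n
    using g1 order_trans by blast
  then have "(\<Sum>k. \<integral>\<^sup>+R. d k R \<partial>Q) \<le> 1"
    by (intro suminf_le_const) auto
  then have "(\<integral>\<^sup>+R. (\<Sum>k. d k R) \<partial>Q) \<noteq> \<infinity>"
    by (subst nn_integral_suminf) (auto simp: top_unique)
  then have "AE R in Q. (\<Sum>k. d k R) \<noteq> \<infinity>"
    by (intro nn_integral_PInf_AE) auto
  with AE_Y_convergent show ?thesis
  proof eventually_elim
    case (elim R)
    define e where "e k = c * exp (- Y k R) * indicator {R. large k \<epsilon> R} R" for k
    have de: "d k R = ennreal (e k)" for k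
      using c by (auto simp: d_def e_def indicator_def)
    have e0: "0 \<le> e k" for k using c by (simp add: e_def)
    have "summable e"
      using elim(2) e0 unfolding de by (intro summable_suminf_not_top) auto
    then have lim: "e \<longlonglongrightarrow> 0" by (rule summable_LIMSEQ_zero)
    \<comment> \<open>Convergence to a finite limit keeps \<open>exp (- Y n R)\<close> away from 0,
      so summable gains leave only finitely many generations with a large individual.\<close>
    obtain y where y: "(\<lambda>n. Y n R) \<longlonglongrightarrow> y" using elim(1) by (auto simp: convergent_def)
    then have "(\<lambda>n. c * exp (- Y n R)) \<longlonglongrightarrow> c * exp (- y)" by (intro tendsto_intros)
    then have "\<forall>\<^sub>F n in sequentially. c * exp (- y) / 2 < c * exp (- Y n R)"
      by (rule order_tendstoD) (use c in auto)
    moreover have "\<forall>\<^sub>F n in sequentially. e n < c * exp (- y) / 2"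
      using lim by (rule order_tendstoD) (use c in auto)
    ultimately show ?case
      by eventually_elim (auto simp: e_def indicator_def split: if_splits)
  qed
qed

lemma weight_4: "weight 4 u R = (weight 2 u R)\<^sup>2"
  using weight_power[of 2 2 u R] by simp

text \<open>A sum of squares of nonnegative terms is at most the square of their sum, with equality
  only if one term carries everything. Equality in the mean would leave at most one child almost
  surely, against a mean offspring number above 1.\<close>

lemma mom_4_less:
  assumes const: "AE R in Q. Y 1 R = 1"
  shows "mom 4 < ennreal (q\<^sup>2)"
proof (rule ccontr)
  assume "\<not> ?thesis"
  then have ge: "ennreal (q\<^sup>2) \<le> mom 4" by simp
  have pt: "AE R in Q. total 4 1 R \<le> ennreal (q\<^sup>2) \<and> (total 4 1 R = ennreal (q\<^sup>2) \<longrightarrow> fst (R []) \<le> 1)"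
    using const AE_total_2_finite
  proof eventually_elim
    case (elim R)
    then have fin: "total 2 1 R < \<infinity>" by (metis shift_Nil)
    have q: "enn2real (total 2 1 R) = q" using elim(1) q_pos by (simp add: Y_def field_simps)
    let ?x = "\<lambda>i. wgt 2 i (R [])"
    have ix: "integrable (count_space UNIV) ?x"
      using fin unfolding total_1 by (intro integrableI_nonneg) (auto simp: wgt_nonneg)
    have sx: "(\<integral>i. ?x i \<partial>count_space UNIV) = q"
      unfolding q[symmetric] total_1 by (rule integral_eq_nn_integral) (auto simp: wgt_nonneg)
    note sq = sum_squares_count_space[OF ix wgt_nonneg sx]
    have w4: "wgt 4 i s = (wgt 2 i s)\<^sup>2" for i s
      by (simp add: wgt_def power2_eq_square exp_add[symmetric])
    have t4: "total 4 1 R = ennreal (\<integral>i. (?x i)\<^sup>2 \<partial>count_space UNIV)"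
      unfolding total_1 w4
      by (intro nn_integral_eq_integral integrable_count_space_square ix) (auto simp: wgt_nonneg)
    have nn: "0 \<le> ?x 0 * (q - ?x 0)"
      using sq(2) wgt_nonneg[of 2 0 "R []"] wgt_nonneg[of 2 1 "R []"] by (intro mult_nonneg_nonneg) auto
    have "fst (R []) \<le> 1" if eq: "total 4 1 R = ennreal (q\<^sup>2)"
    proof (rule ccontr)
      assume "\<not> fst (R []) \<le> 1"
      then have f1: "1 < fst (R [])" by simp
      \<comment> \<open>Children are numbered from 0, so two of them have exactly the indices 0 and
        1 that occur in the deficit bound.\<close>
      have e1: "enat 1 < fst (R [])" using f1 by (simp add: one_enat_def)
      have e0: "enat 0 < fst (R [])" using e1 by (rule less_trans[rotated]) simp
      have "0 < ?x 0" "0 < ?x 1" using e0 e1 by (simp_all add: wgt_def)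
      then have "0 < ?x 0 * (q - ?x 0)" using sq(2) by (intro mult_pos_pos) auto
      then have "(\<integral>i. (?x i)\<^sup>2 \<partial>count_space UNIV) < q\<^sup>2" using sq(1) by simp
      moreover have "(\<integral>i. (?x i)\<^sup>2 \<partial>count_space UNIV) = q\<^sup>2"
        using eq unfolding t4 by (subst (asm) ennreal_inj) auto
      ultimately show False by simp
    qed
    moreover have "total 4 1 R \<le> ennreal (q\<^sup>2)"
      unfolding t4 using sq(1) nn by (intro ennreal_leI) linarith
    ultimately show ?case by blast
  qed
  then have le: "AE R in Q. total 4 1 R \<le> ennreal (q\<^sup>2)" by eventually_elim simp
  have E4: "(\<integral>\<^sup>+R. total 4 1 R \<partial>Q) = mom 4" using nn_integral_total[of 4 1] by simp
  have "(\<integral>\<^sup>+R. total 4 1 R \<partial>Q) \<le> (\<integral>\<^sup>+R. ennreal (q\<^sup>2) \<partial>Q)"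
    by (rule nn_integral_mono_AE[OF le])
  then have fin4: "mom 4 \<le> ennreal (q\<^sup>2)" unfolding E4 using Q.emeasure_space_1 by simp
  \<comment> \<open>Under the assumption to be refuted, the deficit is nonnegative with mean 0,
    hence almost surely 0.\<close>
  have "(\<integral>\<^sup>+R. ennreal (q\<^sup>2) - total 4 1 R \<partial>Q) = ennreal (q\<^sup>2) - mom 4"
    using fin4 le E4 Q.emeasure_space_1 by (subst nn_integral_diff) (auto simp: top_unique)
  also have "\<dots> = 0" using ge by (rule diff_eq_0_ennreal[rotated]) (use fin4 in \<open>auto simp: less_top[symmetric] top_unique\<close>)
  finally have "AE R in Q. ennreal (q\<^sup>2) - total 4 1 R = 0"
    by (subst (asm) nn_integral_0_iff_AE) auto
  with pt have "AE R in Q. fst (R []) \<le> 1"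
  proof eventually_elim
    case (elim R)
    then have "ennreal (q\<^sup>2) \<le> total 4 1 R" by (simp add: diff_eq_0_iff_ennreal)
    with elim(1) show ?case by auto
  qed
  then have "(\<integral>\<^sup>+R. ennreal_of_enat (fst (R [])) \<partial>Q) \<le> (\<integral>\<^sup>+R. 1 \<partial>Q)"
  proof (intro nn_integral_mono_AE, eventually_elim)
    case (elim R)
    then obtain j where "fst (R []) = enat j" "j \<le> 1" by (cases "fst (R [])") (auto simp: one_enat_def)
    then show ?case by (cases j) (auto simp: zero_enat_def[symmetric])
  qed
  with supercrit Q.emeasure_space_1 show False by simp
qed

text \<open>
  If \<open>Y 1\<close> is constant, the normalised squared weights form a conservative cascade. Supercriticality
  makes their sum of squares contract geometrically in the mean.
\<close>

lemma AE_not_large_constant: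
  assumes const: "AE R in Q. Y 1 R = 1" and \<epsilon>: "0 < \<epsilon>"
  shows "AE R in Q. \<forall>\<^sub>F n in sequentially. \<not> large n \<epsilon> R"
proof -
  obtain b where b: "mom 4 = ennreal b" "0 \<le> b" "b < q\<^sup>2"
    using mom_4_less[OF const] by (cases "mom 4") (auto simp: ennreal_less_iff)
  have "(\<integral>\<^sup>+R. (\<Sum>n. ennreal (1 / (q\<^sup>2) ^ n) * total 4 n R) \<partial>Q) = (\<Sum>n. ennreal (1 / (q\<^sup>2) ^ n) * ennreal b ^ n)"
    by (subst nn_integral_suminf) (auto simp: nn_integral_cmult nn_integral_total b)
  also have "\<dots> = (\<Sum>n. ennreal ((b / q\<^sup>2) ^ n))"
    using b q_pos by (simp add: ennreal_power ennreal_mult[symmetric] power_divide)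
  also have "\<dots> = ennreal (\<Sum>n. (b / q\<^sup>2) ^ n)"
    using b q_pos by (intro suminf_ennreal2 summable_geometric) auto
  finally have "(\<integral>\<^sup>+R. (\<Sum>n. ennreal (1 / (q\<^sup>2) ^ n) * total 4 n R) \<partial>Q) \<noteq> \<infinity>" by simp
  then have "AE R in Q. (\<Sum>n. ennreal (1 / (q\<^sup>2) ^ n) * total 4 n R) \<noteq> \<infinity>"
    by (intro nn_integral_PInf_AE) auto
  then show ?thesis
  proof eventually_elim
    case (elim R)
    define e where "e n = enn2real (ennreal (1 / (q\<^sup>2) ^ n) * total 4 n R)" for n
    have fin: "ennreal (1 / (q\<^sup>2) ^ n) * total 4 n R \<noteq> \<infinity>" for n
    proof -
      have "(\<Sum>k<Suc n. ennreal (1 / (q\<^sup>2) ^ k) * total 4 k R) \<le> (\<Sum>n. ennreal (1 / (q\<^sup>2) ^ n) * total 4 n R)"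
        by (rule sum_le_suminf) auto
      then show ?thesis using elim by (auto simp: top_unique)
    qed
    have ee: "ennreal (e n) = ennreal (1 / (q\<^sup>2) ^ n) * total 4 n R" for n
      using fin[of n] by (simp add: e_def less_top)
    have "summable e"
      using elim unfolding ee[symmetric] by (intro summable_suminf_not_top) (auto simp: e_def)
    then have "e \<longlonglongrightarrow> 0" by (rule summable_LIMSEQ_zero)
    then have "\<forall>\<^sub>F n in sequentially. e n < \<epsilon>\<^sup>2" by (rule order_tendstoD) (use \<epsilon> in simp)
    then show ?case
    proof eventually_elim
      case (elim n)
      \<comment> \<open>The square of a single normalised weight is one term of the normalised sum
        of fourth powers, which tends to 0.\<close>
      have "weight 2 u R / q ^ n < \<epsilon>" if u: "u \<in> words n" for u
      proof -
        have "ennreal (weight 4 u R) \<le> total 4 n R"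
          unfolding total_def using u by (intro nn_integral_ge_point) auto
        then have "ennreal (1 / (q\<^sup>2) ^ n) * ennreal (weight 4 u R) \<le> ennreal (e n)"
          unfolding ee by (intro mult_left_mono) auto
        moreover have "ennreal (1 / (q\<^sup>2) ^ n) * ennreal (weight 4 u R) = ennreal ((weight 2 u R / q ^ n)\<^sup>2)"
          using q_pos by (simp add: ennreal_mult[symmetric] weight_4 power_divide power_mult[symmetric] mult.commute)
        ultimately have "(weight 2 u R / q ^ n)\<^sup>2 \<le> e n"
          by (simp add: e_def)
        with elim have "(weight 2 u R / q ^ n)\<^sup>2 < \<epsilon>\<^sup>2" by simp
        then show ?thesis using \<epsilon> by (intro power_less_imp_less_base[of _ 2 \<epsilon>]) auto
      qed
      then show ?case by (fastforce simp: large_def)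
    qed
  qed
qed

lemma AE_not_large: "AE R in Q. \<forall>\<epsilon>>0. \<forall>\<^sub>F n in sequentially. \<not> large n \<epsilon> R"
proof -
  have "AE R in Q. \<forall>j. \<forall>\<^sub>F n in sequentially. \<not> large n (1 / real (Suc j)) R"
    using AE_not_large_constant AE_not_large_nonconstant
    by (cases "AE R in Q. Y 1 R = 1") (simp_all add: AE_all_countable)
  then show ?thesis
  proof eventually_elim
    case (elim R)
    show ?case
    proof (intro allI impI)
      fix \<epsilon> :: real assume "0 < \<epsilon>"
      then obtain j where j: "1 / real (Suc j) < \<epsilon>"
        by (metis nat_approx_posE)
      from elim[rule_format, of j] show "\<forall>\<^sub>F n in sequentially. \<not> large n \<epsilon> R"
        by eventually_elim (use j in \<open>force simp: large_def\<close>)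
    qed
  qed
qed

end

section \<open>Conditional central limit theorem\<close>

text \<open>A trivial linear combination has no density, so point masses have to be covered; with
  mean 0 both cases give the same formula in terms of the second moment.\<close>

lemma (in prob_space) gaussian_char:
  assumes Z: "gaussian_variable M Z" and mean: "expectation Z = 0"
  shows "integrable M (\<lambda>x. (Z x)\<^sup>2)"
    and "(CLINT x|M. iexp (Z x)) = exp (- (expectation (\<lambda>x. (Z x)\<^sup>2) / 2))"
proof -
  have "integrable M (\<lambda>x. (Z x)\<^sup>2) \<and> (CLINT x|M. iexp (Z x)) = exp (- (expectation (\<lambda>x. (Z x)\<^sup>2) / 2))"
    using Z unfolding gaussian_variable_def
  proof (elim disjE exE conjE)
    fix \<mu> \<sigma> :: real assume \<sigma>: "0 < \<sigma>" and D: "distributed M lborel Z (normal_density \<mu> \<sigma>)"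
    have \<mu>: "\<mu> = 0" using normal_distributed_expectation[OF \<sigma> D] mean by simp
    have Zm [measurable]: "Z \<in> borel_measurable M"
      using distributed_measurable[OF D] by simp
    have sq: "expectation (\<lambda>x. (Z x)\<^sup>2) = \<sigma>\<^sup>2"
      using normal_distributed_variance[OF \<sigma> D] mean by simp
    have int: "integrable M (\<lambda>x. (Z x)\<^sup>2)"
      using distributed_integrable[OF D, of "\<lambda>x. x\<^sup>2"] integrable_normal_moment[OF \<sigma>, of \<mu> 2] \<sigma>
      by (simp add: \<mu> normal_density_nonneg)
    have "distributed M lborel (\<lambda>x. (Z x - \<mu>) / \<sigma>) std_normal_density"
      using D normal_standard_normal_convert[OF \<sigma>, of Z \<mu>] by simp
    then have "distr M borel (\<lambda>x. Z x / \<sigma>) = std_normal_distribution"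
      using \<mu> by (simp add: distributed_def cong: distr_cong)
    then have "char (distr M borel (\<lambda>x. Z x / \<sigma>)) \<sigma> = exp (- (\<sigma>\<^sup>2) / 2)"
      by (simp add: char_std_normal_distribution)
    moreover have "char (distr M borel (\<lambda>x. Z x / \<sigma>)) \<sigma> = (CLINT x|M. iexp (Z x))"
      unfolding char_def using \<sigma> by (subst integral_distr) auto
    ultimately show ?thesis using int sq by simp
  next
    fix \<mu> assume Zm [measurable]: "Z \<in> borel_measurable M" and ae: "AE x in M. Z x = \<mu>"
    have "expectation Z = expectation (\<lambda>_. \<mu>)"
      by (rule integral_cong_AE) (use ae in auto)
    then have "\<mu> = 0" using mean by (simp add: prob_space)
    with ae have z: "AE x in M. Z x = 0" by simp
    have "integrable M (\<lambda>x. (Z x)\<^sup>2) \<longleftrightarrow> integrable M (\<lambda>_. 0 :: real)"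
      by (rule integrable_cong_AE) (use z in auto)
    moreover have "expectation (\<lambda>x. (Z x)\<^sup>2) = expectation (\<lambda>_. 0)"
      by (rule integral_cong_AE) (use z in auto)
    moreover have "(CLINT x|M. iexp (Z x)) = (CLINT x|M. 1)"
      by (rule integral_cong_AE) (use z in auto)
    ultimately show ?thesis by (simp add: prob_space)
  qed
  then show "integrable M (\<lambda>x. (Z x)\<^sup>2)"
    and "(CLINT x|M. iexp (Z x)) = exp (- (expectation (\<lambda>x. (Z x)\<^sup>2) / 2))" by auto
qed

lemma gaussian_variable_measurable:
  assumes "gaussian_variable M Z" shows "Z \<in> borel_measurable M"
  using assms unfolding gaussian_variable_def
proof (elim disjE exE conjE)
  fix \<mu> \<sigma> :: real assume "distributed M lborel Z (normal_density \<mu> \<sigma>)"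
  from distributed_measurable[OF this] show ?thesis by simp
qed

text \<open>Gaussian single coordinates provide the second moments that make the covariances genuine
  integrals; the characteristic function of a linear combination is then fixed by its
  variance.\<close>

lemma (in prob_space) gaussian_sequence_law:
  assumes U: "gaussian_sequence M U" and mean: "\<And>r. expectation (U r) = 0"
  shows gaussian_sequence_measurable: "U r \<in> borel_measurable M"
    and gaussian_sequence_square: "integrable M (\<lambda>x. (U r x)\<^sup>2)"
    and gaussian_sequence_char: "(CLINT x|M. iexp (\<Sum>r<k. t r * U r x)) =
      exp (- ((\<Sum>r<k. \<Sum>s<k. t r * t s * covariance M (U r) (U s)) / 2))"
proof -
  have gv: "gaussian_variable M (U r)" for r
    using U[unfolded gaussian_sequence_def, rule_format, of "{r}" "\<lambda>_. 1"] by simp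
  then show meas: "U r \<in> borel_measurable M" for r
    by (rule gaussian_variable_measurable)
  show sq: "integrable M (\<lambda>x. (U r x)\<^sup>2)" for r
    using gaussian_char[OF gv mean] by simp
  have int: "integrable M (U r)" for r
    using square_integrable_imp_integrable[OF meas sq] .
  have prod: "integrable M (\<lambda>x. U r x * U s x)" for r s
  proof (rule Bochner_Integration.integrable_bound[OF Bochner_Integration.integrable_add[OF sq[of r] sq[of s]]])
    have "\<bar>a * b\<bar> \<le> a\<^sup>2 + b\<^sup>2" for a b :: real
    proof -
      have "2 * \<bar>a * b\<bar> \<le> a\<^sup>2 + b\<^sup>2"
        using zero_le_power2[of "\<bar>a\<bar> - \<bar>b\<bar>"] by (simp add: power2_eq_square algebra_simps abs_mult)
      then show ?thesis using sum_power2_ge_zero[of a b] by linarith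
    qed
    then show "AE x in M. norm (U r x * U s x) \<le> norm ((U r x)\<^sup>2 + (U s x)\<^sup>2)"
      by (intro AE_I2) simp
  qed (use meas in auto)
  let ?Z = "\<lambda>x. \<Sum>r<k. t r * U r x"
  have "gaussian_variable M ?Z"
    using U by (simp add: gaussian_sequence_def)
  moreover have "expectation ?Z = 0"
    using int mean by (simp add: Bochner_Integration.integral_sum)
  ultimately have "(CLINT x|M. iexp (?Z x)) = exp (- (expectation (\<lambda>x. (?Z x)\<^sup>2) / 2))"
    by (rule gaussian_char)
  also have "expectation (\<lambda>x. (?Z x)\<^sup>2) = expectation (\<lambda>x. \<Sum>r<k. \<Sum>s<k. (t r * t s) * (U r x * U s x))"
    by (simp add: power2_eq_square sum_product mult_ac)
  also have "\<dots> = (\<Sum>r<k. \<Sum>s<k. t r * t s * covariance M (U r) (U s))"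
    using prod mean by (simp add: Bochner_Integration.integral_sum Bochner_Integration.integrable_sum covariance_def)
  finally show "(CLINT x|M. iexp (\<Sum>r<k. t r * U r x)) =
      exp (- ((\<Sum>r<k. \<Sum>s<k. t r * t s * covariance M (U r) (U s)) / 2))" .
qed

context supercritical_cascade
begin

definition fluct :: "nat \<Rightarrow> repro_array \<Rightarrow> nat \<Rightarrow> real" where
  "fluct n R r = (Winf R - W (n + r) R) / q powr (real (n + r) / 2)"

text \<open>The explicit candidate for the conditional law: the past of \<open>R\<close> is kept and
  everything later is resampled. It is defined for every single \<open>R\<close>, so its convergence
  can be studied along one fixed past.\<close>

definition kernel :: "nat \<Rightarrow> repro_array \<Rightarrow> (nat \<Rightarrow> real) measure" where
  "kernel n R = distr Q borel (\<lambda>R'. fluct n (mix n R R'))"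

lemma measurable_fluct [measurable]: "fluct n \<in> borel_measurable Q"
  by (rule measurable_coordinatewise_then_product) (simp add: fluct_def)

lemma measurable_fluct_mix [measurable]: "(\<lambda>R'. fluct n (mix n R R')) \<in> borel_measurable Q"
  by (rule measurable_compose[OF _ measurable_fluct]) (rule measurable_mix; simp)

lemma prob_space_kernel: "prob_space (kernel n R)"
  unfolding kernel_def by (rule Q.prob_space_distr) measurable

lemma sets_kernel [simp, measurable_cong]: "sets (kernel n R) = sets borel"
  by (simp add: kernel_def)

definition limit_variance :: "nat \<Rightarrow> (nat \<Rightarrow> real) \<Rightarrow> real" where
  "limit_variance k t = V * (\<Sum>r<k. \<Sum>s<k. t r * t s * q powr (\<bar>real r - real s\<bar> / 2))"

text \<open>What one frozen past has to satisfy: a finite generation, which makes the coefficients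
  summable, and the decomposition into subtrees for almost every continuation.\<close>

definition regular :: "nat \<Rightarrow> repro_array \<Rightarrow> bool" where
  "regular n R \<longleftrightarrow> total 1 n R < \<infinity> \<and> (AE R' in Q. \<forall>r. Winf (mix n R R') - W (n + r) (mix n R R') =
      (\<integral>u. weight 1 u R * (Winf (shift u R') - W r (shift u R')) \<partial>count_space (words n)))"

lemma AE_regular: "AE R in Q. \<forall>n. regular n R"
proof -
  have "AE R in Q. regular n R" for n
    using AE_mix[OF Winf_decomposition, of n] AE_total_finite
  proof eventually_elim
    case (elim R)
    from elim(2) have "total 1 n R < \<infinity>" by (metis shift_Nil)
    moreover from elim(1) have "AE R' in Q. \<forall>r. Winf (mix n R R') - W (n + r) (mix n R R') =
      (\<integral>u. weight 1 u R * (Winf (shift u R') - W r (shift u R')) \<partial>count_space (words n))"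
      by eventually_elim (simp add: incr_mix)
    ultimately show ?case by (simp add: regular_def)
  qed
  then show ?thesis by (simp add: AE_all_countable)
qed

context
  fixes n R assumes reg: "regular n R"
begin

lemma regular_total: "total 1 n R < \<infinity>"
  using reg by (simp add: regular_def)

definition coeff :: "nat list \<Rightarrow> real" where
  "coeff u = 1 / q powr (real n / 2) * weight 1 u R"

lemma coeff_square: "(coeff u)\<^sup>2 = weight 2 u R / q ^ n"
proof -
  have "(q powr (real n / 2))\<^sup>2 = q ^ n"
    using q_pos by (simp add: powr_power powr_realpow)
  then show ?thesis by (simp add: coeff_def power_mult_distrib power_divide weight_2)
qed

lemma integral_coeff_square: "(\<integral>u. (coeff u)\<^sup>2 \<partial>count_space (words n)) = Y n R"
  by (simp add: coeff_square weight_2 integral_square_weight Y_def)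

lemma weighted_sum_tail:
  "weighted_sum Q (words n) coeff (\<lambda>u R'. tail_comb k t (shift u R')) (limit_variance k t)"
  unfolding coeff_def
  by (rule weighted_sum_words[OF regular_total])
     (auto simp: tail_comb_square tail_comb_mean limit_variance_def)

lemma fluct_comb:
  "AE R' in Q. (\<Sum>r<k. t r * fluct n (mix n R R') r) =
    (\<integral>u. coeff u * tail_comb k t (shift u R') \<partial>count_space (words n))"
proof -
  have "AE R' in Q. integrable (count_space (words n)) (\<lambda>u. weight 1 u R * (Winf (shift u R') - W r (shift u R')))" for r
  proof -
    interpret weighted_sum Q "words n" "\<lambda>u. 1 * weight 1 u R" "\<lambda>u R'. Winf (shift u R') - W r (shift u R')" "V * q ^ r"
      by (rule weighted_sum_words[OF regular_total, where \<zeta>="\<lambda>R. Winf R - W r R"])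
         (use integrable_Winf integrable_W expectation_Winf expectation_W in \<open>auto simp: Winf_increment_square\<close>)
    show ?thesis using AE_summable by simp
  qed
  then have "AE R' in Q. \<forall>r. integrable (count_space (words n)) (\<lambda>u. weight 1 u R * (Winf (shift u R') - W r (shift u R')))"
    by (simp add: AE_all_countable)
  moreover have "AE R' in Q. \<forall>r. Winf (mix n R R') - W (n + r) (mix n R R') =
      (\<integral>u. weight 1 u R * (Winf (shift u R') - W r (shift u R')) \<partial>count_space (words n))"
    using reg by (simp add: regular_def)
  ultimately show ?thesis
  proof eventually_elim
    case (elim R')
    let ?D = "\<lambda>r u. weight 1 u R * (Winf (shift u R') - W r (shift u R'))"
    let ?c = "\<lambda>r. t r / (q powr (real n / 2) * q powr (real r / 2))"
    have "(\<Sum>r<k. t r * fluct n (mix n R R') r) = (\<Sum>r<k. ?c r * (\<integral>u. ?D r u \<partial>count_space (words n)))"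
      using elim(2) by (simp add: fluct_def powr_add add_divide_distrib)
    also have "\<dots> = (\<integral>u. (\<Sum>r<k. ?c r * ?D r u) \<partial>count_space (words n))"
      using elim(1) by (simp add: Bochner_Integration.integral_sum)
    also have "\<dots> = (\<integral>u. coeff u * tail_comb k t (shift u R') \<partial>count_space (words n))"
      by (intro Bochner_Integration.integral_cong refl) (simp add: coeff_def tail_comb_def sum_distrib_left mult_ac)
    finally show ?case .
  qed
qed

text \<open>\<open>large\<close> refers to squared coefficients, hence the threshold
  \<open>\<epsilon>\<^sup>2\<close>. The coefficients are then at most \<open>\<epsilon>\<close>,
  their squares sum to \<open>Y n R\<close>, and all summands share the law of
  \<open>tail_comb k t\<close>.\<close>

lemma kernel_char_approx:
  assumes "0 < \<epsilon>" and small: "\<not> large n (\<epsilon>\<^sup>2) R"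
  shows "cmod ((CLINT x|kernel n R. iexp (\<Sum>r<k. t r * x r)) - exp (- (limit_variance k t * Y n R / 2)))
    \<le> Y n R * char_remainder (distr Q borel (tail_comb k t)) (limit_variance k t) \<epsilon>"
proof -
  interpret weighted_sum Q "words n" coeff "\<lambda>u R'. tail_comb k t (shift u R')" "limit_variance k t"
    by (rule weighted_sum_tail)
  have "(CLINT x|kernel n R. iexp (\<Sum>r<k. t r * x r)) = (CLINT R'|Q. iexp (\<Sum>r<k. t r * fluct n (mix n R R') r))"
  proof -
    have [measurable]: "(\<lambda>x::nat\<Rightarrow>real. \<Sum>r<k. t r * x r) \<in> borel_measurable borel" by measurable
    have "(\<lambda>x::nat\<Rightarrow>real. iexp (\<Sum>r<k. t r * x r)) \<in> borel_measurable borel" by measurable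
    then show ?thesis unfolding kernel_def by (rule integral_distr[OF measurable_fluct_mix])
  qed
  also have "\<dots> = (CLINT R'|Q. iexp (\<integral>u. coeff u * tail_comb k t (shift u R') \<partial>count_space (words n)))"
  proof (rule integral_cong_AE)
    have [measurable]: "(\<lambda>R'. fluct n (mix n R R') r) \<in> borel_measurable Q" for r
      by (rule measurable_product_then_coordinatewise[OF measurable_fluct_mix])
    have "(\<lambda>R'. \<Sum>r<k. t r * fluct n (mix n R R') r) \<in> borel_measurable Q" by measurable
    then show "(\<lambda>R'. iexp (\<Sum>r<k. t r * fluct n (mix n R R') r)) \<in> borel_measurable Q" by measurable
    show "AE R' in Q. iexp (\<Sum>r<k. t r * fluct n (mix n R R') r) =
        iexp (\<integral>u. coeff u * tail_comb k t (shift u R') \<partial>count_space (words n))"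
      using fluct_comb[of t k] by eventually_elim (simp only:)
  qed measurable
  finally have eq: "(CLINT x|kernel n R. iexp (\<Sum>r<k. t r * x r)) =
     (CLINT R'|Q. iexp (\<integral>u. coeff u * tail_comb k t (shift u R') \<partial>count_space (words n)))" .
  have law: "distr Q borel (\<lambda>R'. tail_comb k t (shift u R')) = distr Q borel (tail_comb k t)" for u
    using distr_distr[of "tail_comb k t" Q borel "shift u" Q] by (simp add: distr_shift comp_def)
  have "coeff u \<le> \<epsilon>" if "u \<in> words n" for u
  proof -
    have "(coeff u)\<^sup>2 < \<epsilon>\<^sup>2" using small that by (force simp: large_def coeff_square)
    from power2_less_imp_less[OF this] show ?thesis using \<open>0 < \<epsilon>\<close> by simp
  qed
  from char_total_approx[OF law this] show ?thesis
    unfolding eq integral_coeff_square .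
qed

text \<open>The source of tightness. The value is the same for all \<open>r\<close>, because the
  normalisation gives every coordinate of a subtree tail the variance \<open>V\<close>.\<close>

lemma kernel_second_moment: "(\<integral>\<^sup>+x. ennreal ((x r)\<^sup>2) \<partial>kernel n R) = ennreal (V * Y n R)"
proof -
  let ?t = "\<lambda>j. if j = r then 1 else 0 :: real"
  interpret weighted_sum Q "words n" coeff "\<lambda>u R'. tail_comb (Suc r) ?t (shift u R')" "limit_variance (Suc r) ?t"
    by (rule weighted_sum_tail)
  have v: "limit_variance (Suc r) ?t = V"
  proof -
    have "(\<Sum>i<Suc r. \<Sum>s<Suc r. ?t i * ?t s * q powr (\<bar>real i - real s\<bar> / 2)) = (\<Sum>i<Suc r. if i = r then 1 else 0)"
      using q_pos by (intro sum.cong refl) (auto simp: if_distrib[of "\<lambda>x. x * _"] sum.delta cong: if_cong)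
    then show ?thesis by (simp add: limit_variance_def)
  qed
  have "(\<integral>\<^sup>+x. ennreal ((x r)\<^sup>2) \<partial>kernel n R) = (\<integral>\<^sup>+R'. ennreal ((fluct n (mix n R R') r)\<^sup>2) \<partial>Q)"
    unfolding kernel_def by (subst nn_integral_distr) auto
  also have "\<dots> = (\<integral>\<^sup>+R'. ennreal ((0 + (\<integral>u. coeff u * tail_comb (Suc r) ?t (shift u R') \<partial>count_space (words n)))\<^sup>2) \<partial>Q)"
  proof (rule nn_integral_cong_AE, use fluct_comb[of ?t "Suc r"] in eventually_elim)
    case (elim R')
    have "(\<Sum>j<Suc r. ?t j * fluct n (mix n R R') j) = fluct n (mix n R R') r"
      by (simp add: if_distrib[of "\<lambda>x. x * _"] cong: if_cong)
    with elim show ?case by simp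
  qed
  also have "\<dots> = ennreal (V * Y n R)"
    using total_moment[of 0] by (subst nn_integral_eq_integral) (auto simp: v integral_coeff_square)
  finally show ?thesis .
qed

end

theorem kernel_converges_weakly:
  assumes reg: "\<forall>n. regular n R" and Y: "(\<lambda>n. Y n R) \<longlonglongrightarrow> y"
    and small: "\<forall>\<epsilon>>0. \<forall>\<^sub>F n in sequentially. \<not> large n \<epsilon> R"
    and G: "prob_space G" "sets G = sets borel"
    and char: "\<And>k t. (CLINT x|G. iexp (\<Sum>r<k. t r * x r)) = exp (- (limit_variance k t * y / 2))"
    and mom: "\<And>r. (\<integral>\<^sup>+x. ennreal ((x r)\<^sup>2) \<partial>G) < \<infinity>"
  shows "converges_weakly (\<lambda>n. kernel n R) G"
proof -
  have "Bseq (\<lambda>n. Y n R)" using Y by (rule convergent_imp_Bseq[OF convergentI])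
  then obtain B where B: "0 < B" "\<And>n. norm (Y n R) \<le> B" by (auto elim: BseqE)
  have YB: "Y n R \<le> B" for n using B(2)[of n] by simp
  \<comment> \<open>One bound has to cover all kernels as well as the limit law, about whose second
    moments only finiteness is known.\<close>
  let ?C = "\<lambda>r. max (V * B) (enn2real (\<integral>\<^sup>+x. ennreal ((x r)\<^sup>2) \<partial>G))"
  show ?thesis
  proof (rule converges_weakly_sequencesI[where C="?C"])
    fix k t
    let ?s = "limit_variance k t"
    let ?D = "distr Q borel (tail_comb k t)"
    interpret D: real_distribution ?D by (rule Q.real_distribution_distr) measurable
    have D2: "integrable ?D (\<lambda>x. x\<^sup>2)"
      using tail_comb_square(1)[of k t] by (subst integrable_distr_eq) auto
    have rem0: "0 \<le> char_remainder ?D ?s e" for e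
      by (auto simp: char_remainder_def intro!: add_nonneg_nonneg integral_nonneg_AE)
    have "(\<lambda>n. (CLINT x|kernel n R. iexp (\<Sum>r<k. t r * x r)) - exp (- (?s * Y n R / 2))) \<longlonglongrightarrow> 0"
    proof (rule tendstoI)
      fix e :: real assume "0 < e"
      have "(\<lambda>j. 1 / real (Suc j)) \<longlonglongrightarrow> 0"
        using LIMSEQ_inverse_real_of_nat by (simp add: inverse_eq_divide)
      from D.char_remainder_tendsto_0[OF D2 this, of ?s]
      have "(\<lambda>j. B * char_remainder ?D ?s (1 / real (Suc j))) \<longlonglongrightarrow> B * 0" by (intro tendsto_intros)
      then have "\<forall>\<^sub>F j in sequentially. B * char_remainder ?D ?s (1 / real (Suc j)) < e"
        by (rule order_tendstoD) (use \<open>0 < e\<close> in simp)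
      \<comment> \<open>The level of the remainder is fixed first; afterwards \<open>n\<close> is
        taken so large that no coefficient exceeds it.\<close>
      then obtain j where j: "B * char_remainder ?D ?s (1 / real (Suc j)) < e"
        by (auto simp: eventually_sequentially)
      have "\<forall>\<^sub>F n in sequentially. \<not> large n ((1 / real (Suc j))\<^sup>2) R"
        by (rule small[rule_format]) simp
      then show "\<forall>\<^sub>F n in sequentially. dist ((CLINT x|kernel n R. iexp (\<Sum>r<k. t r * x r)) - exp (- (?s * Y n R / 2))) 0 < e"
      proof eventually_elim
        case (elim n)
        have "cmod ((CLINT x|kernel n R. iexp (\<Sum>r<k. t r * x r)) - exp (- (?s * Y n R / 2)))
          \<le> Y n R * char_remainder ?D ?s (1 / real (Suc j))"
          by (rule kernel_char_approx[OF reg[rule_format] _ elim]) simp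
        also have "\<dots> \<le> B * char_remainder ?D ?s (1 / real (Suc j))"
          by (intro mult_right_mono YB rem0)
        finally show ?case using j by (simp add: dist_norm)
      qed
    qed
    moreover have "(\<lambda>n. complex_of_real (exp (- (?s * Y n R / 2)))) \<longlonglongrightarrow> complex_of_real (exp (- (?s * y / 2)))"
      by (intro tendsto_intros Y) simp
    ultimately have "(\<lambda>n. ((CLINT x|kernel n R. iexp (\<Sum>r<k. t r * x r)) - exp (- (?s * Y n R / 2))) + complex_of_real (exp (- (?s * Y n R / 2))))
      \<longlonglongrightarrow> 0 + complex_of_real (exp (- (?s * y / 2)))"
      by (rule tendsto_add)
    then show "(\<lambda>n. CLINT x|kernel n R. iexp (\<Sum>r<k. t r * x r)) \<longlonglongrightarrow> (CLINT x|G. iexp (\<Sum>r<k. t r * x r))"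
      unfolding char by simp
  next
    fix n r
    have "V * Y n R \<le> V * B" using YB V_nonneg by (intro mult_left_mono)
    then show "(\<integral>\<^sup>+x. ennreal ((x r)\<^sup>2) \<partial>kernel n R) \<le> ennreal (?C r)"
      unfolding kernel_second_moment[OF reg[rule_format]] by (intro ennreal_leI) auto
  next
    fix r
    have "(\<integral>\<^sup>+x. ennreal ((x r)\<^sup>2) \<partial>G) = ennreal (enn2real (\<integral>\<^sup>+x. ennreal ((x r)\<^sup>2) \<partial>G))"
      using mom[of r] by (simp add: less_top)
    also have "\<dots> \<le> ennreal (?C r)" by (intro ennreal_leI) auto
    finally show "(\<integral>\<^sup>+x. ennreal ((x r)\<^sup>2) \<partial>G) \<le> ennreal (?C r)" .
  qed (auto simp: prob_space_kernel G le_max_iff_disj)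
qed

end

section \<open>Transfer to the branching random walk\<close>

context cascade
begin

lemma integral_mix:
  fixes F :: "repro_array \<Rightarrow> real"
  assumes [measurable]: "F \<in> borel_measurable Q" and bounded: "\<And>R. \<bar>F R\<bar> \<le> B"
  shows "(\<integral>R. F R \<partial>Q) = (\<integral>R. (\<integral>R'. F (mix n R R') \<partial>Q) \<partial>Q)"
proof -
  interpret QQ: pair_prob_space Q Q by unfold_locales
  have m: "(\<lambda>(R, R'). mix n R R') \<in> Q \<Otimes>\<^sub>M Q \<rightarrow>\<^sub>M Q" by (simp add: split_beta')
  have "(\<integral>R. F R \<partial>Q) = (\<integral>x. F (case x of (R, R') \<Rightarrow> mix n R R') \<partial>(Q \<Otimes>\<^sub>M Q))"
    using integral_distr[OF m assms(1)] by (simp add: distr_mix)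
  also have "\<dots> = (\<integral>R. (\<integral>R'. F (mix n R R') \<partial>Q) \<partial>Q)"
  proof (subst QQ.integral_fst'[symmetric])
    have "(\<lambda>x. F (case x of (R, R') \<Rightarrow> mix n R R')) \<in> borel_measurable (Q \<Otimes>\<^sub>M Q)"
      by (rule measurable_compose[OF m assms(1)])
    then show "integrable (Q \<Otimes>\<^sub>M Q) (\<lambda>x. F (case x of (R, R') \<Rightarrow> mix n R R'))"
      by (intro QQ.P.integrable_const_bound[where B=B]) (auto simp: bounded)
  qed simp
  finally show ?thesis .
qed

end

context branching_random_walk
begin

text \<open>The point of the canonical space realised by an outcome. Its law is \<open>Q\<close>, so
  almost sure statements and integrals are carried over by taking images.\<close>

definition array :: "'w \<Rightarrow> nat list \<Rightarrow> enat \<times> (nat \<Rightarrow> real)" where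
  "array \<omega> u = repro J X u \<omega>"

definition repro_law :: "(enat \<times> (nat \<Rightarrow> real)) measure" where
  "repro_law = distr M repro_space (repro J X [])"

lemma measurable_repro [measurable]: "repro J X u \<in> M \<rightarrow>\<^sub>M repro_space"
  using indep_repro by (auto simp: indep_vars_def)

sublocale cascade repro_law
proof (rule cascade.intro)
  show "prob_space repro_law"
    unfolding repro_law_def by (rule prob_space_distr) measurable
  show "cascade_axioms repro_law"
    by (rule cascade_axioms.intro) (simp add: repro_law_def)
qed

lemma measurable_array [measurable]: "array \<in> M \<rightarrow>\<^sub>M Q"
  by (rule measurable_into_Q) (simp add: array_def measurable_cong_sets[OF refl sets_base])

lemma distr_array: "distr M Q array = Q"
proof -
  have "distr M (PiM UNIV (\<lambda>_. repro_space)) (\<lambda>\<omega>. \<lambda>u\<in>UNIV. repro J X u \<omega>) = PiM UNIV (\<lambda>u. distr M repro_space (repro J X u))"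
    using indep_repro by (subst (asm) indep_vars_iff_distr_eq_PiM) auto
  moreover have "distr M repro_space (repro J X u) = repro_law" for u
    using ident_repro[of u] by (simp add: repro_law_def)
  moreover have "distr M (PiM UNIV (\<lambda>_. repro_space)) array = distr M Q array"
    by (rule distr_cong) (auto simp: Q_def intro!: sets_PiM_cong simp: sets_base)
  moreover have "(\<lambda>\<omega>. \<lambda>u\<in>UNIV. repro J X u \<omega>) = array"
    by (auto simp: array_def fun_eq_iff)
  ultimately show ?thesis by (simp add: Q_def)
qed

lemma AE_array: "AE R in Q. P R \<Longrightarrow> AE \<omega> in M. P (array \<omega>)"
  using AE_distrD[OF measurable_array, of P] unfolding distr_array .

lemma nn_integral_array: "f \<in> borel_measurable Q \<Longrightarrow> (\<integral>\<^sup>+\<omega>. f (array \<omega>) \<partial>M) = (\<integral>\<^sup>+R. f R \<partial>Q)"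
  using nn_integral_distr[OF measurable_array, of f] by (simp add: distr_array)

lemma integral_array:
  fixes f :: "_ \<Rightarrow> real"
  shows "f \<in> borel_measurable Q \<Longrightarrow> (\<integral>\<omega>. f (array \<omega>) \<partial>M) = (\<integral>R. f R \<partial>Q)"
  using integral_distr[OF measurable_array, of f] by (simp add: distr_array)

lemma integrable_array:
  fixes f :: "_ \<Rightarrow> real"
  shows "f \<in> borel_measurable Q \<Longrightarrow> integrable M (\<lambda>\<omega>. f (array \<omega>)) \<longleftrightarrow> integrable Q f"
  using integrable_distr_eq[OF measurable_array, of f] by (simp add: distr_array)

lemma weight_array: "weight \<theta> u (array \<omega>) = (if alive J u \<omega> then exp (- \<theta> * position X u \<omega>) else 0)"
proof (induction u rule: rev_induct)
  case (snoc i u)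
  then show ?case
    by (simp add: weight_snoc alive_snoc position_snoc wgt_def array_def repro_def exp_add[symmetric] algebra_simps)
qed simp

lemma total_array: "total \<theta> n (array \<omega>) = (\<integral>\<^sup>+u. ennreal (exp (- \<theta> * position X u \<omega>)) \<partial>count_space (generation J n \<omega>))"
  unfolding total_def words_def generation_def
  by (subst (1 2) nn_integral_count_space_indicator)
     (auto simp: weight_array indicator_def intro!: nn_integral_cong)

lemma laplace_eq_mom: "laplace M J X \<theta> = mom \<theta>"
proof -
  have "mom \<theta> = (\<integral>\<^sup>+R. total \<theta> 1 R \<partial>Q)" using nn_integral_total[of \<theta> 1] by simp
  also have "\<dots> = (\<integral>\<^sup>+\<omega>. total \<theta> 1 (array \<omega>) \<partial>M)"
    by (rule nn_integral_array[symmetric]) measurable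
  also have "\<dots> = laplace M J X \<theta>"
    unfolding laplace_def total_1
    by (intro nn_integral_cong, subst (2) nn_integral_count_space_indicator)
       (auto simp: wgt_def array_def repro_def indicator_def intro!: nn_integral_cong)
  finally show ?thesis ..
qed

lemma biggins_array: "biggins M J X \<theta> n \<omega> = enn2real (total \<theta> n (array \<omega>)) / enn2real (laplace M J X \<theta>) ^ n"
  by (simp add: biggins_def total_array)

lemma space_filtration [simp]: "space (brw_filtration M J X n) = space M"
  unfolding brw_filtration_def by (rule space_measure_of) auto

lemma sets_filtration: "sets (brw_filtration M J X n) =
    sigma_sets (space M) {repro J X u -` A \<inter> space M | u A. length u < n \<and> A \<in> sets repro_space}"
  unfolding brw_filtration_def by (rule sets_measure_of) auto

lemma subalgebra_filtration: "subalgebra M (brw_filtration M J X n)"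
  unfolding subalgebra_def sets_filtration
  by (auto intro!: sets.sigma_sets_subset measurable_sets[OF measurable_repro])

text \<open>The source of adaptedness: a measurable function that is invariant under
  \<open>mix n\<close> may be evaluated at this truncated array, which involves only the first
  \<open>n\<close> generations.\<close>

lemma measurable_mix_array:
  "(\<lambda>\<omega>. mix n (array \<omega>) (\<lambda>_. (0, \<lambda>_. 0))) \<in> brw_filtration M J X n \<rightarrow>\<^sub>M Q"
proof (rule measurable_into_Q)
  fix u
  show "(\<lambda>\<omega>. mix n (array \<omega>) (\<lambda>_. (0, \<lambda>_. 0)) u) \<in> brw_filtration M J X n \<rightarrow>\<^sub>M repro_law"
  proof (cases "length u < n")
    case True
    have "repro J X u \<in> brw_filtration M J X n \<rightarrow>\<^sub>M repro_space"
    proof (rule measurableI)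
      fix A assume "A \<in> sets repro_space"
      with True show "repro J X u -` A \<inter> space (brw_filtration M J X n) \<in> sets (brw_filtration M J X n)"
        unfolding sets_filtration space_filtration by (intro sigma_sets.Basic) auto
    qed (auto simp: repro_space_def space_pair_measure)
    with True show ?thesis by (simp add: mix_def array_def measurable_cong_sets[OF refl sets_base])
  next
    case False
    then show ?thesis by (simp add: mix_def space_base)
  qed
qed

end

locale supercritical_brw = branching_random_walk +
  fixes q :: real
  assumes super: "supercritical M J"
    and laplace_1: "laplace M J X 1 = 1"
    and finite_var: "finite_variance M (biggins M J X 1 1)"
    and laplace_2: "laplace M J X 2 < 1"
    and q_eq: "q = enn2real (laplace M J X 2)"
begin

sublocale supercritical_cascade repro_law q
proof
  show "mom 1 = 1" using laplace_1 by (simp add: laplace_eq_mom)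
  show m2: "mom 2 = ennreal q"
    using laplace_2 by (simp add: laplace_eq_mom q_eq order_less_trans[OF _ ennreal_one_less_top])
  show "q < 1"
    using laplace_2 unfolding laplace_eq_mom m2 by (simp add: ennreal_less_one_iff)
  \<comment> \<open>If \<open>q\<close> were 0, all weights in the first generation would vanish
    almost surely, against \<open>m(1) = 1\<close>.\<close>
  show "0 < q"
  proof (rule ccontr)
    assume "\<not> 0 < q"
    then have "(\<integral>\<^sup>+R. total 2 1 R \<partial>Q) = 0"
      using nn_integral_total[of 2 1] by (simp add: m2 ennreal_neg)
    then have "AE R in Q. total 2 1 R = 0"
      by (subst (asm) nn_integral_0_iff_AE) auto
    then have "AE R in Q. total 1 1 R = 0"
    proof eventually_elim
      case (elim R)
      then show ?case
        unfolding total_def by (simp add: nn_integral_0_iff_AE AE_count_space weight_2)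
    qed
    then have "(\<integral>\<^sup>+R. total 1 1 R \<partial>Q) = (\<integral>\<^sup>+R. 0 \<partial>Q)" by (rule nn_integral_cong_AE)
    with nn_integral_total[of 1 1] laplace_1 show False by (simp add: laplace_eq_mom)
  qed
  show "(\<integral>\<^sup>+R. (total 1 1 R)\<^sup>2 \<partial>Q) < \<infinity>"
  proof -
    let ?b = "biggins M J X 1 1"
    have b: "?b \<omega> = enn2real (total 1 1 (array \<omega>))" for \<omega>
      by (simp add: biggins_array laplace_1)
    have i: "integrable M ?b" "integrable M (\<lambda>\<omega>. (?b \<omega> - expectation ?b)\<^sup>2)"
      using finite_var by (auto simp: finite_variance_def)
    have "integrable M (\<lambda>\<omega>. (?b \<omega> - expectation ?b)\<^sup>2 + 2 * expectation ?b * ?b \<omega> - (expectation ?b)\<^sup>2)"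
      using i by simp
    also have "(\<lambda>\<omega>. (?b \<omega> - expectation ?b)\<^sup>2 + 2 * expectation ?b * ?b \<omega> - (expectation ?b)\<^sup>2) = (\<lambda>\<omega>. (?b \<omega>)\<^sup>2)"
      by (auto simp: power2_eq_square algebra_simps)
    finally have fin: "(\<integral>\<^sup>+\<omega>. ennreal ((?b \<omega>)\<^sup>2) \<partial>M) < \<infinity>"
      using integrableD(2) by (fastforce simp: less_top)
    have "(\<integral>\<^sup>+R. total 1 1 R \<partial>Q) \<noteq> \<infinity>"
      using nn_integral_total[of 1 1] laplace_1 by (simp add: laplace_eq_mom)
    then have "AE R in Q. total 1 1 R \<noteq> \<infinity>"
      by (intro nn_integral_PInf_AE) auto
    then have "AE \<omega> in M. total 1 1 (array \<omega>) \<noteq> \<infinity>" by (rule AE_array)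
    then have "AE \<omega> in M. (total 1 1 (array \<omega>))\<^sup>2 = ennreal ((?b \<omega>)\<^sup>2)"
    proof eventually_elim
      case (elim \<omega>)
      then have "ennreal (?b \<omega>) = total 1 1 (array \<omega>)" unfolding b by (simp add: less_top)
      moreover have "0 \<le> ?b \<omega>" unfolding b by simp
      ultimately show ?case using ennreal_power[of "?b \<omega>" 2] by simp
    qed
    then have "(\<integral>\<^sup>+\<omega>. (total 1 1 (array \<omega>))\<^sup>2 \<partial>M) = (\<integral>\<^sup>+\<omega>. ennreal ((?b \<omega>)\<^sup>2) \<partial>M)"
      by (rule nn_integral_cong_AE)
    with fin show ?thesis
      using nn_integral_array[of "\<lambda>R. (total 1 1 R)\<^sup>2"] by simp
  qed
  have 1: "fst \<in> repro_law \<rightarrow>\<^sub>M count_space UNIV"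
    unfolding measurable_cong_sets[OF sets_base refl] repro_space_def by measurable
  have "(\<lambda>R. ennreal_of_enat (fst (R []))) \<in> borel_measurable Q"
    by (rule measurable_compose[OF measurable_compose[OF measurable_Q_component 1]]) simp
  from nn_integral_array[OF this] super
  show "(\<integral>\<^sup>+R. ennreal_of_enat (fst (R [])) \<partial>Q) > 1"
    by (simp add: supercritical_def array_def repro_def)
qed

lemma biggins_1: "biggins M J X 1 n \<omega> = W n (array \<omega>)"
  by (simp add: biggins_array laplace_1 W_eq)

lemma biggins_2: "biggins M J X 2 n \<omega> = Y n (array \<omega>)"
  by (simp add: biggins_array Y_def flip: q_eq)

lemma biggins_limit_1: "biggins_limit M J X 1 \<omega> = Winf (array \<omega>)"
  by (simp add: biggins_limit_def Winf_def biggins_1)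

lemma variance_biggins_limit:
  "finite_variance M (biggins_limit M J X 1)" "variance (biggins_limit M J X 1) = V"
proof -
  have E: "expectation (biggins_limit M J X 1) = 1"
    using integral_array[OF measurable_Winf] by (simp add: biggins_limit_1[abs_def] expectation_Winf)
  show "finite_variance M (biggins_limit M J X 1)"
    using integrable_array[OF measurable_Winf] integrable_array[of "\<lambda>R. (Winf R - 1)\<^sup>2"] integrable_Winf integrable_Winf_square
    unfolding finite_variance_def E by (simp add: biggins_limit_1[abs_def])
  show "variance (biggins_limit M J X 1) = V"
    unfolding E using integral_array[of "\<lambda>R. (Winf R - 1)\<^sup>2"] by (simp add: biggins_limit_1 V_def)
qed

lemma variance_biggins: "variance (biggins M J X 1 1) = \<sigma>2"
proof -
  have E: "expectation (biggins M J X 1 1) = 1"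
    using integral_array[OF measurable_W, of 1] by (simp add: biggins_1[abs_def] expectation_W)
  show ?thesis
    unfolding E using integral_array[of "\<lambda>R. (W 1 R - 1)\<^sup>2"] by (simp add: biggins_1 \<sigma>2_def)
qed

text \<open>The complement to adaptedness: events of the filtration are pullbacks of events on the
  canonical space that are invariant under resampling. The generators suffice, since pullbacks form
  a \<sigma>-algebra.\<close>

lemma filtration_past:
  assumes "A \<in> sets (brw_filtration M J X n)"
  shows "\<exists>A'\<in>sets (past n). A = array -` A' \<inter> space M"
proof -
  have sets: "sets (vimage_algebra (space M) array (past n)) = {array -` A' \<inter> space M | A'. A' \<in> sets (past n)}"
    by (rule sets_vimage_algebra2) simp
  have "repro J X u -` B \<inter> space M \<in> sets (vimage_algebra (space M) array (past n))"
    if "length u < n" "B \<in> sets repro_space" for u B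
  proof -
    let ?A = "{R. R u \<in> B}"
    have "(\<lambda>R. R u) -` B \<inter> space Q \<in> sets Q"
      by (rule measurable_sets[OF measurable_Q_component]) (simp add: sets_base that)
    then have "?A \<in> sets Q" by (simp add: vimage_def)
    moreover have "?A = (\<lambda>R. mix n R (\<lambda>_. (0, \<lambda>_. 0))) -` ?A"
      using that by (auto simp: mix_def)
    ultimately have "?A \<in> sets (past n)" unfolding sets_past by blast
    moreover have "repro J X u -` B \<inter> space M = array -` ?A \<inter> space M"
      by (auto simp: array_def)
    ultimately show ?thesis unfolding sets by blast
  qed
  then have "{repro J X u -` A \<inter> space M | u A. length u < n \<and> A \<in> sets repro_space}
      \<subseteq> sets (vimage_algebra (space M) array (past n))"
    by blast
  from sets.sigma_sets_subset[OF this]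
  have "sigma_sets (space M) {repro J X u -` A \<inter> space M | u A. length u < n \<and> A \<in> sets repro_space}
      \<subseteq> sets (vimage_algebra (space M) array (past n))"
    by simp
  with assms show ?thesis unfolding sets_filtration sets by blast
qed

lemma kernel_mix: "kernel n (mix n R S) = kernel n R"
  by (simp add: kernel_def)

lemma measurable_kernel: "kernel n \<in> Q \<rightarrow>\<^sub>M prob_algebra borel"
  unfolding kernel_def
proof (rule measurable_distr_prob_space2)
  show "(\<lambda>R. Q) \<in> Q \<rightarrow>\<^sub>M prob_algebra Q"
    by (rule measurable_const) (simp add: space_prob_algebra Q.prob_space_axioms)
  have "(\<lambda>x. fluct n (mix n (fst x) (snd x))) \<in> borel_measurable (Q \<Otimes>\<^sub>M Q)"
    by (rule measurable_compose[OF _ measurable_fluct]) measurable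
  then show "(\<lambda>(R, R'). fluct n (mix n R R')) \<in> Q \<Otimes>\<^sub>M Q \<rightarrow>\<^sub>M borel"
    by (simp add: split_beta')
qed

text \<open>Both sides are moved to \<open>Q\<close>, where conditioning is the integration over the
  resampled future. The indicator of an event of the past does not feel the resampling and leaves
  the inner integral, which then is an integral against the kernel.\<close>

lemma conditional_law_kernel:
  "is_conditional_law M (brw_filtration M J X n) (\<lambda>\<omega>. fluct n (array \<omega>)) (\<lambda>\<omega>. kernel n (array \<omega>))"
  unfolding is_conditional_law_def
proof (intro conjI ballI allI impI; (elim conjE)?)
  have "(\<lambda>\<omega>. kernel n (mix n (array \<omega>) (\<lambda>_. (0, \<lambda>_. 0)))) \<in> brw_filtration M J X n \<rightarrow>\<^sub>M prob_algebra borel"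
    by (rule measurable_compose[OF measurable_mix_array measurable_kernel])
  then show "(\<lambda>\<omega>. kernel n (array \<omega>)) \<in> brw_filtration M J X n \<rightarrow>\<^sub>M prob_algebra borel"
    by (simp add: kernel_mix)
  fix A and f :: "(nat \<Rightarrow> real) \<Rightarrow> real"
  assume A: "A \<in> sets (brw_filtration M J X n)" and f [measurable]: "f \<in> borel_measurable borel" and "bounded (range f)"
  then obtain B where B: "\<And>x. \<bar>f x\<bar> \<le> B" by (auto simp: bounded_iff)
  obtain A' where A': "A' \<in> sets (past n)" "A = array -` A' \<inter> space M"
    using filtration_past[OF A] by auto
  have [measurable]: "A' \<in> sets Q" by (rule past_sets_Q[OF A'(1)])
  have ind: "indicator A \<omega> = (indicator A' (array \<omega>) :: real)" if "\<omega> \<in> space M" for \<omega>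
    using that by (simp add: A'(2) indicator_def)
  have fm: "(\<lambda>R. f (fluct n R)) \<in> borel_measurable Q"
    by (rule measurable_compose[OF measurable_fluct f])
  have "(\<lambda>R. \<integral>x. f x \<partial>kernel n R) \<in> borel_measurable Q"
    by (rule measurable_compose[OF measurable_prob_algebraD[OF measurable_kernel]])
       (rule integral_measurable_subprob_algebra[OF f])
  then have km: "(\<lambda>R. indicator A' R * (\<integral>x. f x \<partial>kernel n R)) \<in> borel_measurable Q"
    by measurable
  have fA: "(\<lambda>R. indicator A' R * f (fluct n R)) \<in> borel_measurable Q"
    using fm by measurable
  have "(LINT \<omega>:A|M. f (fluct n (array \<omega>))) = (\<integral>\<omega>. indicator A' (array \<omega>) * f (fluct n (array \<omega>)) \<partial>M)"
    unfolding set_lebesgue_integral_def by (intro Bochner_Integration.integral_cong refl) (simp add: ind)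
  also have "\<dots> = (\<integral>R. indicator A' R * f (fluct n R) \<partial>Q)"
    by (rule integral_array[OF fA])
  also have "\<dots> = (\<integral>R. (\<integral>R'. indicator A' (mix n R R') * f (fluct n (mix n R R')) \<partial>Q) \<partial>Q)"
  proof (rule integral_mix[OF fA])
    fix R show "\<bar>indicator A' R * f (fluct n R)\<bar> \<le> \<bar>B\<bar>"
      using order_trans[OF B abs_ge_self] by (auto simp: indicator_def)
  qed
  also have "\<dots> = (\<integral>R. indicator A' R * (\<integral>x. f x \<partial>kernel n R) \<partial>Q)"
  proof (intro Bochner_Integration.integral_cong refl)
    fix R
    have "indicator A' (mix n R R') = (indicator A' R :: real)" for R'
      using past_mix[OF A'(1), of R R'] by (simp add: indicator_def)
    then show "(\<integral>R'. indicator A' (mix n R R') * f (fluct n (mix n R R')) \<partial>Q) = indicator A' R * (\<integral>x. f x \<partial>kernel n R)"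
      unfolding kernel_def by (simp add: integral_distr[OF measurable_fluct_mix f])
  qed
  also have "\<dots> = (\<integral>\<omega>. indicator A' (array \<omega>) * (\<integral>x. f x \<partial>kernel n (array \<omega>)) \<partial>M)"
    by (rule integral_array[OF km, symmetric])
  also have "\<dots> = (LINT \<omega>:A|M. (\<integral>x. f x \<partial>kernel n (array \<omega>)))"
    unfolding set_lebesgue_integral_def by (intro Bochner_Integration.integral_cong refl) (simp add: ind)
  finally show "(LINT \<omega>:A|M. f (fluct n (array \<omega>))) = (LINT \<omega>:A|M. (\<integral>x. f x \<partial>kernel n (array \<omega>)))" .
qed

lemma AE_kernel_converges_weakly:
  assumes "prob_space N" and U: "gaussian_sequence N U" and mean: "\<And>r. prob_space.expectation N (U r) = 0"
    and cov: "\<And>r s. covariance N (U r) (U s) = q powr (\<bar>real r - real s\<bar> / 2)"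
  shows "AE \<omega> in M. converges_weakly (\<lambda>n. kernel n (array \<omega>))
    (distr N borel (\<lambda>x r. sqrt (V * biggins_limit M J X 2 \<omega>) * U r x))"
proof -
  interpret N: prob_space N by fact
  note Um [measurable] = N.gaussian_sequence_measurable[OF U mean]
  have "AE R in Q. (\<forall>n. regular n R) \<and> (\<forall>\<epsilon>>0. \<forall>\<^sub>F n in sequentially. \<not> large n \<epsilon> R) \<and> convergent (\<lambda>n. Y n R)"
    using AE_regular AE_not_large AE_Y_convergent by eventually_elim simp
  from AE_array[OF this] show ?thesis
  proof eventually_elim
    case (elim \<omega>)
    let ?R = "array \<omega>"
    define y where "y = biggins_limit M J X 2 \<omega>"
    have y: "(\<lambda>n. Y n ?R) \<longlonglongrightarrow> y"
      using elim by (simp add: y_def biggins_limit_def biggins_2 convergent_LIMSEQ_iff)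
    have y0: "0 \<le> y" by (rule LIMSEQ_le_const[OF y]) (simp add: Y_nonneg)
    let ?g = "\<lambda>x r. sqrt (V * y) * U r x"
    have gm: "?g \<in> borel_measurable N"
      by (rule measurable_coordinatewise_then_product) measurable
    show ?case
      unfolding y_def[symmetric]
    proof (rule kernel_converges_weakly[OF _ y])
      show "prob_space (distr N borel ?g)" by (rule N.prob_space_distr[OF gm])
      fix k t
      have "(\<lambda>x::nat\<Rightarrow>real. \<Sum>r<k. t r * x r) \<in> borel_measurable borel" by measurable
      then have "(\<lambda>x::nat\<Rightarrow>real. iexp (\<Sum>r<k. t r * x r)) \<in> borel_measurable borel" by measurable
      \<comment> \<open>For fixed \<open>\<omega>\<close> the scale is a constant and is absorbed
        into the coefficients \<open>t\<close>, so the formula for \<open>U\<close> applies.\<close>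
      from integral_distr[OF gm this]
      have "(CLINT x|distr N borel ?g. iexp (\<Sum>r<k. t r * x r)) = (CLINT x|N. iexp (\<Sum>r<k. (t r * sqrt (V * y)) * U r x))"
        by (simp add: mult.assoc)
      also have "\<dots> = exp (- ((\<Sum>r<k. \<Sum>s<k. (t r * sqrt (V * y)) * (t s * sqrt (V * y)) * covariance N (U r) (U s)) / 2))"
        by (rule N.gaussian_sequence_char[OF U mean])
      also have "(\<Sum>r<k. \<Sum>s<k. (t r * sqrt (V * y)) * (t s * sqrt (V * y)) * covariance N (U r) (U s)) = limit_variance k t * y"
      proof -
        have "(t r * sqrt (V * y)) * (t s * sqrt (V * y)) * covariance N (U r) (U s) =
            (V * y) * (t r * t s * q powr (\<bar>real r - real s\<bar> / 2))" for r s
        proof -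
          have "sqrt (V * y) * sqrt (V * y) = V * y" using V_nonneg y0 by simp
          moreover have "(a * z) * (b * z) * c = (z * z) * (a * b * c)" for a b c z :: real
            by (simp add: mult_ac)
          ultimately show ?thesis by (simp only: cov)
        qed
        then have "(\<Sum>r<k. \<Sum>s<k. (t r * sqrt (V * y)) * (t s * sqrt (V * y)) * covariance N (U r) (U s)) =
            (\<Sum>r<k. \<Sum>s<k. (V * y) * (t r * t s * q powr (\<bar>real r - real s\<bar> / 2)))"
          by (simp only:)
        also have "\<dots> = (V * y) * (\<Sum>r<k. \<Sum>s<k. t r * t s * q powr (\<bar>real r - real s\<bar> / 2))"
          by (simp only: sum_distrib_left)
        finally show ?thesis by (simp add: limit_variance_def)
      qed
      finally show "(CLINT x|distr N borel ?g. iexp (\<Sum>r<k. t r * x r)) = exp (- (limit_variance k t * y / 2))" .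
    next
      fix r
      have "(\<integral>\<^sup>+x. ennreal ((x r)\<^sup>2) \<partial>distr N borel ?g) = (\<integral>\<^sup>+x. ennreal ((sqrt (V * y) * U r x)\<^sup>2) \<partial>N)"
        by (subst nn_integral_distr[OF gm]) auto
      also have "\<dots> < \<infinity>"
        using integrableD(2)[OF integrable_mult_right[OF N.gaussian_sequence_square[OF U mean, of r], of "(sqrt (V * y))\<^sup>2"]]
        by (simp add: power_mult_distrib less_top del: real_sqrt_pow2_iff real_sqrt_pow2)
      finally show "(\<integral>\<^sup>+x. ennreal ((x r)\<^sup>2) \<partial>distr N borel ?g) < \<infinity>" .
    qed (use elim in auto)
  qed
qed

end

theorem theorem1p2:
  fixes M :: "'w measure"
    and J :: "nat list \<Rightarrow> 'w \<Rightarrow> enat"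
    and X :: "nat list \<Rightarrow> nat \<Rightarrow> 'w \<Rightarrow> real"
    and N :: "'v measure"
    and U :: "nat \<Rightarrow> 'v \<Rightarrow> real"
    and L :: "nat \<Rightarrow> 'w \<Rightarrow> (nat \<Rightarrow> real) measure"
    and L_inf :: "'w \<Rightarrow> (nat \<Rightarrow> real) measure"
    and m2 v2 :: real
  assumes "branching_random_walk M J X"
    and "supercritical M J"
    and "laplace M J X 1 = 1"
    and "finite_variance M (biggins M J X 1 1)"
    and "laplace M J X 2 < 1"
    and "m2 = enn2real (laplace M J X 2)"
    and "v2 = prob_space.variance M (biggins_limit M J X 1)"
    and "\<And>n. is_conditional_law M (brw_filtration M J X n)
           (\<lambda>\<omega> r. (biggins_limit M J X 1 \<omega> - biggins M J X 1 (n + r) \<omega>)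
                    / m2 powr (real (n + r) / 2))
           (L n)"
    and "prob_space N"
    and "gaussian_sequence N U"
    and "stationary_sequence N U"
    and "\<And>r. prob_space.expectation N (U r) = 0"
    and "\<And>r s. covariance N (U r) (U s) = m2 powr (\<bar>real r - real s\<bar> / 2)"
    and "\<And>\<omega>. L_inf \<omega> =
           distr N borel (\<lambda>x r. sqrt (v2 * biggins_limit M J X 2 \<omega>) * U r x)"
  shows "finite_variance M (biggins_limit M J X 1)
    \<and> v2 = prob_space.variance M (biggins M J X 1 1) / (1 - m2)
    \<and> L_inf \<in> M \<rightarrow>\<^sub>M prob_algebra borel
    \<and> (AE \<omega> in M. converges_weakly (\<lambda>n. L n \<omega>) (L_inf \<omega>))"
proof -
  interpret branching_random_walk M J X by fact
  interpret supercritical_brw M J X m2 by unfold_locales fact+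
  interpret N: prob_space N by fact
  have v2: "v2 = V" using assms(7) variance_biggins_limit(2) by simp
  have "V = variance (biggins M J X 1 1) / (1 - m2)"
    unfolding variance_biggins by (rule V_eq)
  moreover have "L_inf \<in> M \<rightarrow>\<^sub>M prob_algebra borel"
  proof -
    have "(\<lambda>\<omega>. biggins M J X 2 n \<omega>) \<in> borel_measurable M" for n
      unfolding biggins_2 by (rule measurable_compose[OF measurable_array measurable_Y])
    then have [measurable]: "biggins_limit M J X 2 \<in> borel_measurable M"
      unfolding biggins_limit_def[abs_def] by (intro borel_measurable_lim_metric)
    have [measurable]: "U r \<in> borel_measurable N" for r
      by (rule N.gaussian_sequence_measurable[OF assms(10,12)])
    have "(\<lambda>\<omega>. distr N borel (\<lambda>x r. sqrt (v2 * biggins_limit M J X 2 \<omega>) * U r x)) \<in> M \<rightarrow>\<^sub>M prob_algebra borel"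
    proof (rule measurable_distr_prob_space2)
      show "(\<lambda>\<omega>. N) \<in> M \<rightarrow>\<^sub>M prob_algebra N"
        by (rule measurable_const) (simp add: space_prob_algebra N.prob_space_axioms)
      show "(\<lambda>(\<omega>, x). \<lambda>r. sqrt (v2 * biggins_limit M J X 2 \<omega>) * U r x) \<in> M \<Otimes>\<^sub>M N \<rightarrow>\<^sub>M borel"
        unfolding split_beta' by (rule measurable_coordinatewise_then_product) measurable
    qed
    then show ?thesis by (simp add: assms(14)[abs_def])
  qed
  moreover have "AE \<omega> in M. converges_weakly (\<lambda>n. L n \<omega>) (L_inf \<omega>)"
  proof -
    have eq: "(\<lambda>\<omega> r. (biggins_limit M J X 1 \<omega> - biggins M J X 1 (n + r) \<omega>) / m2 powr (real (n + r) / 2))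
       = (\<lambda>\<omega>. fluct n (array \<omega>))" for n
      by (simp add: fun_eq_iff fluct_def biggins_1 biggins_limit_1)
    \<comment> \<open>\<open>L n\<close> is an arbitrary version of the conditional law and agrees
      with the explicit kernel only off a null set; countably many \<open>n\<close> still leave one
      null set.\<close>
    have "AE \<omega> in M. L n \<omega> = kernel n (array \<omega>)" for n
    proof (rule conditional_law_unique[OF prob_space_axioms subalgebra_filtration])
      show "(\<lambda>\<omega>. fluct n (array \<omega>)) \<in> borel_measurable M"
        by (rule measurable_compose[OF measurable_array measurable_fluct])
      show "is_conditional_law M (brw_filtration M J X n) (\<lambda>\<omega>. fluct n (array \<omega>)) (L n)"
        using assms(8)[of n] unfolding eq .
    qed (rule conditional_law_kernel)
    then have "AE \<omega> in M. \<forall>n. L n \<omega> = kernel n (array \<omega>)" by (simp add: AE_all_countable)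
    with AE_kernel_converges_weakly[OF assms(9,10,12,13)] show ?thesis
      by eventually_elim (simp add: assms(14) v2)
  qed
  ultimately show ?thesis using variance_biggins_limit(1) v2 by simp
qed

end
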